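(* Let $\varphi:G\times M\to M$ be a smooth left action by isometries of a Lie group $G$ on a differentiable manifold $M$ endowed with a metric $d\in\mathcal L(M)$, and let $X\subset M$ be a non-empty compact subset. Let $F$ be an arbitrary Finsler metric on $G/H_X$, with distance function $d_F$, and let $\tau$ be the quotient topology of $G/H_X$. (1) For every $gH_X\in G/H_X$ there exists a $\tau$-neighborhood $O$ of $gH_X$ such that $d_F|_{O\times O}$, $d_X|_{O\times O}$ and $\hat d_X|_{O\times O}$ are Lipschitz equivalent. (2) If $\tau_X$ is the topology induced by $d_X$ and $\hat\tau_X$ is the topology induced by $\hat d_X$, then $\tau_X\subset\hat\tau_X=\tau$.
   Context: All differentiable manifolds (including Lie groups) are Hausdorff with countable basis. The action is by isometries if $d(gx,gy)=d(x,y)$ for all $g\in G$, $x,y\in M$. A Finsler metric on a manifold $N$ is a continuous function $F:TN\to\mathbb R$ whose restriction to each tangent space is a norm; its distance function is $d_F(x,y)=\inf_\gamma\int F(\gamma'(t))\,dt$ over piecewise continuously differentiable paths connecting $x$ and $y$ ($\inf\emptyset=+\infty$). Two metrics $d,\rho$ are Lipschitz equivalent if $c\,d\le\rho\le C\,d$ for some constants $c,C>0$. $\mathcal L(M)$: the set of metrics $d$ on $M$ inducing the manifold topology and such that there is a Finsler metric $F'$ on $M$ for which every $p\in M$ has a neighborhood on which $d$ and $d_{F'}$ are Lipschitz equivalent. $H_X=\{g\in G:gX=X\}$ is a closed subgroup of $G$, and $G/H_X$ carries its unique differentiable structure for which the natural $G$-action is smooth. $d_X(g_1H_X,g_2H_X)=d_H(g_1X,g_2X)$,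 where $d_H(A,B)=\max\{\sup_{a\in A}d(a,B),\sup_{b\in B}d(b,A)\}$. $\hat d_X(p,q)=\inf_\gamma\ell_{d_X}(\gamma)$ over $d_X$-continuous paths from $p$ to $q$ ($\inf\emptyset=+\infty$), where $\ell_{d_X}(\gamma)=\sup\sum_i d_X(\gamma(t_i),\gamma(t_{i-1}))$ over partitions. *)

theory Defs
  imports "HOL-Analysis.Analysis" "HOL-Algebra.Group_Action" "HOL-Algebra.Left_Coset"
begin

section \<open>Smooth manifolds\<close>

text \<open>
  A manifold is modelled on a linear subspace \<open>V\<close> of a Euclidean space type, so its dimension is
  \<open>dim V\<close>. Charts into the type itself would exclude dimension 0 (every type of
  class \<open>euclidean_space\<close> has positive dimension), i.e. for instance discrete Lie groups.

  \<open>Ck_on k V U f\<close>, for \<open>U\<close> relatively open in the subspace \<open>V\<close>: \<open>f\<close> is \<open>k\<close> times continuously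
  differentiable on \<open>U\<close>. The Frechet derivative \<open>D x\<close> within \<open>U\<close> is only determined on \<open>V\<close>, hence
  only the directions in \<open>V\<close> are differentiated further.
\<close>

primrec Ck_on :: "nat \<Rightarrow> 'e::euclidean_space set \<Rightarrow> 'e set \<Rightarrow> ('e \<Rightarrow> 'f::real_normed_vector) \<Rightarrow> bool"
where
  "Ck_on 0 V U f \<longleftrightarrow> continuous_on U f"
| "Ck_on (Suc k) V U f \<longleftrightarrow>
     (\<exists>D. (\<forall>x\<in>U. (f has_derivative D x) (at x within U)) \<and>
          (\<forall>v\<in>V. Ck_on k V U (\<lambda>x. D x v)))"

definition smooth_on :: "'e::euclidean_space set \<Rightarrow> 'e set \<Rightarrow> ('e \<Rightarrow> 'f::real_normed_vector) \<Rightarrow> bool"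
  where "smooth_on V U f \<longleftrightarrow> (\<forall>k. Ck_on k V U f)"

type_synonym ('a, 'e) chart = "'a set \<times> ('a \<Rightarrow> 'e)"

record ('a, 'e) mfd =
  mtop :: "'a topology"
  model :: "'e set"
  atlas :: "('a, 'e) chart set"

definition is_chart :: "'a topology \<Rightarrow> 'e::euclidean_space set \<Rightarrow> ('a, 'e) chart \<Rightarrow> bool"
  where "is_chart T V \<kappa> \<longleftrightarrow>
    openin T (fst \<kappa>) \<and>
    openin (top_of_set V) (snd \<kappa> ` fst \<kappa>) \<and>
    homeomorphic_map (subtopology T (fst \<kappa>)) (top_of_set (snd \<kappa> ` fst \<kappa>)) (snd \<kappa>)"

definition transition :: "('a, 'e) chart \<Rightarrow> ('a, 'e) chart \<Rightarrow> 'e \<Rightarrow> 'e"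
  where "transition \<kappa> \<kappa>' = snd \<kappa>' \<circ> inv_into (fst \<kappa>) (snd \<kappa>)"

text \<open>The atlas is not required to be maximal; it represents the smooth structure it generates.\<close>

definition smooth_manifold :: "('a, 'e::euclidean_space) mfd \<Rightarrow> bool"
  where "smooth_manifold N \<longleftrightarrow>
    subspace (model N) \<and>
    Hausdorff_space (mtop N) \<and> second_countable (mtop N) \<and>
    (\<forall>\<kappa>\<in>atlas N. is_chart (mtop N) (model N) \<kappa>) \<and>
    (\<Union>\<kappa>\<in>atlas N. fst \<kappa>) = topspace (mtop N) \<and>
    (\<forall>\<kappa>\<in>atlas N. \<forall>\<kappa>'\<in>atlas N.
       smooth_on (model N) (snd \<kappa> ` (fst \<kappa> \<inter> fst \<kappa>')) (transition \<kappa> \<kappa>'))"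

definition smooth_map ::
    "('a, 'e::euclidean_space) mfd \<Rightarrow> ('b, 'f::euclidean_space) mfd \<Rightarrow> ('a \<Rightarrow> 'b) \<Rightarrow> bool"
  where "smooth_map N N' f \<longleftrightarrow>
    continuous_map (mtop N) (mtop N') f \<and>
    (\<forall>\<kappa>\<in>atlas N. \<forall>\<kappa>'\<in>atlas N'.
       smooth_on (model N) (snd \<kappa> ` (fst \<kappa> \<inter> f -` fst \<kappa>'))
         (snd \<kappa>' \<circ> f \<circ> inv_into (fst \<kappa>) (snd \<kappa>)))"

definition prod_mfd :: "('a, 'e) mfd \<Rightarrow> ('b, 'f) mfd \<Rightarrow> ('a \<times> 'b, 'e \<times> 'f) mfd"
  where "prod_mfd N N' =
    \<lparr> mtop = prod_topology (mtop N) (mtop N'),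
      model = model N \<times> model N',
      atlas = (\<lambda>(\<kappa>, \<kappa>'). (fst \<kappa> \<times> fst \<kappa>', map_prod (snd \<kappa>) (snd \<kappa>'))) ` (atlas N \<times> atlas N') \<rparr>"

definition lie_group :: "('g, 'r) monoid_scheme \<Rightarrow> ('g, 'e::euclidean_space) mfd \<Rightarrow> bool"
  where "lie_group G GM \<longleftrightarrow>
    group G \<and> smooth_manifold GM \<and> topspace (mtop GM) = carrier G \<and>
    smooth_map (prod_mfd GM GM) GM (\<lambda>(g, h). g \<otimes>\<^bsub>G\<^esub> h) \<and>
    smooth_map GM GM (\<lambda>g. inv\<^bsub>G\<^esub> g)"


section \<open>Tangent bundle and Finsler metrics\<close>

text \<open>
  A tangent vector at \<open>p\<close> is the family of its coordinate vectors: it assigns to every chart around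
  \<open>p\<close> a vector of the model space, and these are related by the differentials of the transition
  maps. Its value on the other charts is fixed to be 0, so that equality of tangent vectors is
  equality of functions. For any single chart around \<open>p\<close>, taking the coordinate vector in this chart
  identifies the tangent space with the model space.
\<close>

definition charts_at :: "('a, 'e) mfd \<Rightarrow> 'a \<Rightarrow> ('a, 'e) chart set"
  where "charts_at N p = {\<kappa> \<in> atlas N. p \<in> fst \<kappa>}"

definition dir_deriv :: "('e::real_normed_vector \<Rightarrow> 'f::real_normed_vector) \<Rightarrow> 'e \<Rightarrow> 'e \<Rightarrow> 'f"
  where "dir_deriv f x v = vector_derivative (\<lambda>t::real. f (x + t *\<^sub>R v)) (at 0)"

definition tangent_space ::
    "('a, 'e::euclidean_space) mfd \<Rightarrow> 'a \<Rightarrow> (('a, 'e) chart \<Rightarrow> 'e) set"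
  where "tangent_space N p =
    {\<xi>. (\<forall>\<kappa>\<in>charts_at N p. \<xi> \<kappa> \<in> model N) \<and>
        (\<forall>\<kappa>\<in>charts_at N p. \<forall>\<kappa>'\<in>charts_at N p.
           \<xi> \<kappa>' = dir_deriv (transition \<kappa> \<kappa>') (snd \<kappa> p) (\<xi> \<kappa>)) \<and>
        (\<forall>\<kappa>. \<kappa> \<notin> charts_at N p \<longrightarrow> \<xi> \<kappa> = 0)}"

definition tangent_bundle ::
    "('a, 'e::euclidean_space) mfd \<Rightarrow> ('a \<times> (('a, 'e) chart \<Rightarrow> 'e)) set"
  where "tangent_bundle N = (SIGMA p:topspace (mtop N). tangent_space N p)"

text \<open>
  The topology for which the bundle charts \<open>(p, \<xi>) \<mapsto> (c p, \<xi> \<kappa>)\<close>, for the charts \<open>\<kappa> = (U, c)\<close>, are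
  homeomorphisms from the part of the tangent bundle over \<open>U\<close> onto the product of \<open>c ` U\<close> and the
  model space.
\<close>

definition tangent_topology ::
    "('a, 'e::euclidean_space) mfd \<Rightarrow> ('a \<times> (('a, 'e) chart \<Rightarrow> 'e)) topology"
  where "tangent_topology N = topology_generated_by
    {{(p, \<xi>) \<in> tangent_bundle N. p \<in> fst \<kappa> \<and> (snd \<kappa> p, \<xi> \<kappa>) \<in> W} | \<kappa> W. \<kappa> \<in> atlas N \<and> open W}"

definition finsler_metric ::
    "('a, 'e::euclidean_space) mfd \<Rightarrow> ('a \<times> (('a, 'e) chart \<Rightarrow> 'e) \<Rightarrow> real) \<Rightarrow> bool"
  where "finsler_metric N F \<longleftrightarrow>
    continuous_map (tangent_topology N) euclideanreal F \<and>
    (\<forall>p\<in>topspace (mtop N).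
       (\<forall>\<xi>\<in>tangent_space N p. 0 \<le> F (p, \<xi>) \<and> (F (p, \<xi>) = 0 \<longleftrightarrow> \<xi> = (\<lambda>\<kappa>. 0))) \<and>
       (\<forall>\<xi>\<in>tangent_space N p. \<forall>a::real. F (p, \<lambda>\<kappa>. a *\<^sub>R \<xi> \<kappa>) = \<bar>a\<bar> * F (p, \<xi>)) \<and>
       (\<forall>\<xi>\<in>tangent_space N p. \<forall>\<eta>\<in>tangent_space N p.
          F (p, \<lambda>\<kappa>. \<xi> \<kappa> + \<eta> \<kappa>) \<le> F (p, \<xi>) + F (p, \<eta>)))"

text \<open>Continuous differentiability on a closed interval; one-sided derivatives at the endpoints.\<close>

definition C1_path_on :: "('a, 'e::euclidean_space) mfd \<Rightarrow> (real \<Rightarrow> 'a) \<Rightarrow> real \<Rightarrow> real \<Rightarrow> bool"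
  where "C1_path_on N \<gamma> a b \<longleftrightarrow>
    continuous_map (top_of_set {a..b}) (mtop N) \<gamma> \<and>
    (\<forall>\<kappa>\<in>atlas N. \<exists>D.
       continuous_on ({a..b} \<inter> \<gamma> -` fst \<kappa>) D \<and>
       (\<forall>t\<in>{a..b} \<inter> \<gamma> -` fst \<kappa>.
          ((snd \<kappa> \<circ> \<gamma>) has_vector_derivative D t) (at t within {a..b})))"

definition piecewise_C1_path :: "('a, 'e::euclidean_space) mfd \<Rightarrow> (real \<Rightarrow> 'a) \<Rightarrow> bool"
  where "piecewise_C1_path N \<gamma> \<longleftrightarrow>
    (\<exists>(n::nat) s. s 0 = 0 \<and> s n = 1 \<and>
       (\<forall>i<n. s i < s (Suc i) \<and> C1_path_on N \<gamma> (s i) (s (Suc i))))"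

definition velocity ::
    "('a, 'e::euclidean_space) mfd \<Rightarrow> (real \<Rightarrow> 'a) \<Rightarrow> real \<Rightarrow> 'a \<times> (('a, 'e) chart \<Rightarrow> 'e)"
  where "velocity N \<gamma> t =
    (\<gamma> t, \<lambda>\<kappa>. if \<kappa> \<in> charts_at N (\<gamma> t)
               then vector_derivative (snd \<kappa> \<circ> \<gamma>) (at t within {0..1}) else 0)"

text \<open>
  The velocity is meaningless at the finitely many break points of a piecewise path, which do not
  affect the integral. The infimum of the empty set is \<open>\<infinity>\<close>.
\<close>

definition finsler_dist ::
    "('a, 'e::euclidean_space) mfd \<Rightarrow> ('a \<times> (('a, 'e) chart \<Rightarrow> 'e) \<Rightarrow> real) \<Rightarrow> 'a \<Rightarrow> 'a \<Rightarrow> ennreal"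
  where "finsler_dist N F x y =
    (INF \<gamma>\<in>{\<gamma>. piecewise_C1_path N \<gamma> \<and> \<gamma> 0 = x \<and> \<gamma> 1 = y}.
       ennreal (integral {0..1} (\<lambda>t. F (velocity N \<gamma> t))))"


section \<open>Metrics\<close>

definition lipschitz_equiv_on ::
    "'a set \<Rightarrow> ('a \<Rightarrow> 'a \<Rightarrow> ennreal) \<Rightarrow> ('a \<Rightarrow> 'a \<Rightarrow> ennreal) \<Rightarrow> bool"
  where "lipschitz_equiv_on A d \<rho> \<longleftrightarrow>
    (\<exists>c C::real. c > 0 \<and> C > 0 \<and>
       (\<forall>x\<in>A. \<forall>y\<in>A. ennreal c * d x y \<le> \<rho> x y \<and> \<rho> x y \<le> ennreal C * d x y))"

text \<open>The class \<open>\<L>(M)\<close>.\<close>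

definition locally_finsler_metrics :: "('a, 'e::euclidean_space) mfd \<Rightarrow> ('a \<Rightarrow> 'a \<Rightarrow> real) set"
  where "locally_finsler_metrics M =
    {d. Metric_space (topspace (mtop M)) d \<and>
        Metric_space.mtopology (topspace (mtop M)) d = mtop M \<and>
        (\<exists>F'. finsler_metric M F' \<and>
           (\<forall>p\<in>topspace (mtop M). \<exists>U. openin (mtop M) U \<and> p \<in> U \<and>
              lipschitz_equiv_on U (\<lambda>x y. ennreal (d x y)) (finsler_dist M F')))}"

text \<open>Topology on \<open>S\<close> induced by a metric that may take the value \<open>\<infinity>\<close>.\<close>

definition emetric_topology :: "'a set \<Rightarrow> ('a \<Rightarrow> 'a \<Rightarrow> ennreal) \<Rightarrow> 'a topology"
  where "emetric_topology S d =
    topology (\<lambda>U. U \<subseteq> S \<and> (\<forall>x\<in>U. \<exists>r>0. \<forall>y\<in>S. d x y < r \<longrightarrow> y \<in> U))"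

lemma openin_emetric_topology:
  "openin (emetric_topology S d) U \<longleftrightarrow> U \<subseteq> S \<and> (\<forall>x\<in>U. \<exists>r>0. \<forall>y\<in>S. d x y < r \<longrightarrow> y \<in> U)"
proof -
  have "istopology (\<lambda>U. U \<subseteq> S \<and> (\<forall>x\<in>U. \<exists>r>0. \<forall>y\<in>S. d x y < r \<longrightarrow> y \<in> U))"
    unfolding istopology_def
  proof (rule conjI; intro allI impI conjI)
    fix A B
    assume "A \<subseteq> S \<and> (\<forall>x\<in>A. \<exists>r>0. \<forall>y\<in>S. d x y < r \<longrightarrow> y \<in> A)"
      and "B \<subseteq> S \<and> (\<forall>x\<in>B. \<exists>r>0. \<forall>y\<in>S. d x y < r \<longrightarrow> y \<in> B)"
    then have A: "\<forall>x\<in>A. \<exists>r>0. \<forall>y\<in>S. d x y < r \<longrightarrow> y \<in> A"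
      and B: "\<forall>x\<in>B. \<exists>r>0. \<forall>y\<in>S. d x y < r \<longrightarrow> y \<in> B"
      and "A \<subseteq> S" by auto
    then show "A \<inter> B \<subseteq> S" by blast
    show "\<forall>x\<in>A \<inter> B. \<exists>r>0. \<forall>y\<in>S. d x y < r \<longrightarrow> y \<in> A \<inter> B"
    proof
      fix x assume "x \<in> A \<inter> B"
      then obtain r s where "r > 0" "\<forall>y\<in>S. d x y < r \<longrightarrow> y \<in> A" "s > 0" "\<forall>y\<in>S. d x y < s \<longrightarrow> y \<in> B"
        using A B by blast
      then show "\<exists>r>0. \<forall>y\<in>S. d x y < r \<longrightarrow> y \<in> A \<inter> B"
        by (intro exI[of _ "min r s"]) auto
    qed
  next
    fix K
    assume K: "\<forall>A\<in>K. A \<subseteq> S \<and> (\<forall>x\<in>A. \<exists>r>0. \<forall>y\<in>S. d x y < r \<longrightarrow> y \<in> A)"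
    then show "\<Union>K \<subseteq> S" by blast
    show "\<forall>x\<in>\<Union>K. \<exists>r>0. \<forall>y\<in>S. d x y < r \<longrightarrow> y \<in> \<Union>K"
    proof
      fix x assume "x \<in> \<Union>K"
      then obtain A where "A \<in> K" "x \<in> A" by blast
      then obtain r where "r > 0" "\<forall>y\<in>S. d x y < r \<longrightarrow> y \<in> A"
        using K by blast
      then show "\<exists>r>0. \<forall>y\<in>S. d x y < r \<longrightarrow> y \<in> \<Union>K"
        using \<open>A \<in> K\<close> by blast
    qed
  qed
  then show ?thesis
    by (simp add: emetric_topology_def)
qed

definition hausdorff_dist :: "('a \<Rightarrow> 'a \<Rightarrow> real) \<Rightarrow> 'a set \<Rightarrow> 'a set \<Rightarrow> ennreal"
  where "hausdorff_dist d A B =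
    max (SUP a\<in>A. INF b\<in>B. ennreal (d a b)) (SUP b\<in>B. INF a\<in>A. ennreal (d b a))"

definition path_length :: "('a \<Rightarrow> 'a \<Rightarrow> ennreal) \<Rightarrow> (real \<Rightarrow> 'a) \<Rightarrow> ennreal"
  where "path_length d \<gamma> =
    (SUP (n, t) \<in> {(n::nat, t::nat \<Rightarrow> real). t 0 = 0 \<and> t n = 1 \<and> (\<forall>i<n. t i \<le> t (Suc i))}.
       \<Sum>i<n. d (\<gamma> (t (Suc i))) (\<gamma> (t i)))"

definition intrinsic_dist :: "'a set \<Rightarrow> ('a \<Rightarrow> 'a \<Rightarrow> ennreal) \<Rightarrow> 'a \<Rightarrow> 'a \<Rightarrow> ennreal"
  where "intrinsic_dist S d p q =
    (INF \<gamma>\<in>{\<gamma>. continuous_map (top_of_set {0..1}) (emetric_topology S d) \<gamma> \<and> \<gamma> 0 = p \<and> \<gamma> 1 = q}.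
       path_length d \<gamma>)"


section \<open>The homogeneous space of a subset\<close>

definition set_stabilizer :: "('g, 'r) monoid_scheme \<Rightarrow> ('g \<Rightarrow> 'm \<Rightarrow> 'm) \<Rightarrow> 'm set \<Rightarrow> 'g set"
  where "set_stabilizer G \<phi> X = stabilizer G (\<lambda>g. image (\<phi> g)) X"

text \<open>On cosets; the choice of representatives is irrelevant by the lemma \<open>coset_dist_eq\<close> below.\<close>

definition coset_dist ::
    "('m \<Rightarrow> 'm \<Rightarrow> real) \<Rightarrow> ('g \<Rightarrow> 'm \<Rightarrow> 'm) \<Rightarrow> 'm set \<Rightarrow> 'g set \<Rightarrow> 'g set \<Rightarrow> ennreal"
  where "coset_dist d \<phi> X P Q =
    hausdorff_dist d (\<phi> (SOME g. g \<in> P) ` X) (\<phi> (SOME g. g \<in> Q) ` X)"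

lemma coset_dist_eq:
  fixes G :: "('g, 'r) monoid_scheme" (structure)
  assumes "group_action G E \<phi>" and "X \<subseteq> E" and g: "g1 \<in> carrier G" "g2 \<in> carrier G"
  shows "coset_dist d \<phi> X (g1 <# set_stabilizer G \<phi> X) (g2 <# set_stabilizer G \<phi> X)
    = hausdorff_dist d (\<phi> g1 ` X) (\<phi> g2 ` X)"
proof -
  interpret group_action G E \<phi> by fact
  interpret group G using group_hom by (simp add: group_hom_def)
  have "\<phi> (SOME k. k \<in> g <# set_stabilizer G \<phi> X) ` X = \<phi> g ` X" if "g \<in> carrier G" for g
  proof -
    have "(SOME k. k \<in> g <# set_stabilizer G \<phi> X) \<in> g <# set_stabilizer G \<phi> X"
    proof (rule someI[of _ g])
      have "\<phi> \<one> ` X = (\<lambda>x. x) ` X"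
        using \<open>X \<subseteq> E\<close> by (intro image_cong refl) (simp add: id_eq_one [symmetric] subset_iff)
      then have "\<one> \<in> set_stabilizer G \<phi> X"
        by (simp add: set_stabilizer_def stabilizer_def)
      then have "g \<otimes> \<one> \<in> g <# set_stabilizer G \<phi> X"
        unfolding l_coset_def by blast
      then show "g \<in> g <# set_stabilizer G \<phi> X"
        using that by simp
    qed
    then obtain h where h: "h \<in> carrier G" "\<phi> h ` X = X"
      "(SOME k. k \<in> g <# set_stabilizer G \<phi> X) = g \<otimes> h"
      by (auto simp: l_coset_def set_stabilizer_def stabilizer_def)
    have "\<phi> (g \<otimes> h) ` X = \<phi> g ` \<phi> h ` X"
      unfolding image_image
      using that h(1) \<open>X \<subseteq> E\<close> by (intro image_cong refl) (metis composition_rule subsetD)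
    then show ?thesis using h by simp
  qed
  then show ?thesis using g by (simp add: coset_dist_def)
qed

text \<open>
  \<open>Q\<close> is the coset space \<open>G/H\<close> with the quotient topology and a smooth structure for which the natural
  action of \<open>G\<close> is smooth. For closed \<open>H\<close> these conditions determine the smooth structure uniquely.
\<close>

definition homogeneous_space ::
    "('g, 'r) monoid_scheme \<Rightarrow> ('g, 'e::euclidean_space) mfd \<Rightarrow> 'g set
      \<Rightarrow> ('g set, 'f::euclidean_space) mfd \<Rightarrow> bool"
  where "homogeneous_space G GM H Q \<longleftrightarrow>
    smooth_manifold Q \<and>
    topspace (mtop Q) = lcosets\<^bsub>G\<^esub> H \<and>
    quotient_map (mtop GM) (mtop Q) (\<lambda>g. g <#\<^bsub>G\<^esub> H) \<and>
    smooth_map (prod_mfd GM Q) Q (\<lambda>(g, P). g <#\<^bsub>G\<^esub> P)"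

end

theory Submission
  imports Defs
begin

text \<open>
  Let \<open>\<parallel>g\<parallel>\<close> be the norm of \<open>g\<close> in a chart of \<open>G\<close> centred at \<open>\<one>\<close>. If \<open>g\<close> minimizes this norm on its
  coset, then near the base point both \<open>d\<^sub>X (H, g H)\<close> and the distance of \<open>H\<close> and \<open>g H\<close> in a chart of
  \<open>G/H\<close> are comparable to \<open>\<parallel>g\<parallel>\<close>. The upper bounds hold because the actions are Lipschitz in charts and
  \<open>X\<close> is compact. The lower bounds come from one argument with powers of group elements, which needs
  only first derivatives and replaces the exponential map and the fact that \<open>G \<rightarrow> G/H\<close> is a submersion.
  By invariance \<open>d\<^sub>X\<close> is then comparable to the chart distance around every point of \<open>G/H\<close>. So is any
  Finsler distance, and so is the intrinsic metric, because \<open>d\<^sub>X\<close> is Lipschitz along straight segments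
  in a chart.

  The intrinsic metric could induce a topology coarser than the quotient topology only through paths that
  are continuous for \<open>d\<^sub>X\<close> but not for the quotient topology; short ones are excluded by Sierpinski's
  theorem that an interval is not a disjoint union of countably many, but more than one, nonempty closed sets.
\<close>

section \<open>Strict differentiability in charts\<close>

text \<open>\<open>d\<^sub>X\<close> can induce a strictly coarser topology than the quotient
  topology: if a line acts on a flat torus with irrational slope and \<open>X\<close> is a point,
  then \<open>G/H\<close> is the line and \<open>d\<^sub>X\<close> is the torus distance along a
  dense orbit. So a \<open>d\<^sub>X\<close>-ball need not be small in charts, and the comparison
  with chart distances is possible only for pairs already close in the quotient topology. No local
  section of \<open>G \<rightarrow> G/H\<close> is at hand; an element of minimal norm in its coset
  replaces one transversal to \<open>H\<close>. The two lower bounds concern two functions of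
  \<open>g\<close> with the same features: each grows at most linearly along powers of
  \<open>g\<close>, up to a factor, and vanishes near \<open>\<one>\<close> only on
  \<open>H\<close>. For \<open>d\<^sub>X\<close> the growth comes from invariance and the triangle
  inequality; for the chart distance, from elements near \<open>\<one>\<close> acting on coordinate
  differences almost as the identity. Invariance moves pairs of points, so the derivative estimates
  must hold with both points varying: this is strict differentiability.\<close>

text \<open>\<open>Ck_on\<close> gives continuity of \<open>D x v\<close> in \<open>x\<close> for
  one fixed direction at a time. Expanding \<open>v\<close> in an orthonormal basis of
  \<open>V\<close> makes it uniform over \<open>v\<close> and yields joint continuity.\<close>

lemma Ck_on_1_derivative:
  fixes f :: "'e::euclidean_space \<Rightarrow> 'f::real_normed_vector"
  assumes V: "subspace V" and "Ck_on (Suc 0) V U f"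
  obtains D where "\<And>x. x \<in> U \<Longrightarrow> (f has_derivative D x) (at x within U)"
    and "\<And>a e. a \<in> U \<Longrightarrow> e > 0 \<Longrightarrow>
      \<exists>\<delta>>0. \<forall>z\<in>U. dist z a < \<delta> \<longrightarrow> (\<forall>v\<in>V. norm (D z v - D a v) \<le> e * norm v)"
    and "continuous_on (U \<times> V) (\<lambda>(x, v). D x v)"
proof -
  obtain D where D: "\<And>x. x \<in> U \<Longrightarrow> (f has_derivative D x) (at x within U)"
    and cont: "\<And>v. v \<in> V \<Longrightarrow> continuous_on U (\<lambda>x. D x v)"
    using assms(2) by auto
  obtain B where B: "B \<subseteq> V" "pairwise orthogonal B" "\<And>x. x \<in> B \<Longrightarrow> norm x = 1"
    "independent B" "span B = V"
    using orthonormal_basis_subspace[OF V] by metis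
  then have fin: "finite B"
    using independent_imp_finite by blast
  have rep: "D x v = (\<Sum>b\<in>B. (v \<bullet> b) *\<^sub>R D x b)" if "x \<in> U" "v \<in> V" for x v
  proof -
    interpret bounded_linear "D x"
      using D[OF that(1)] by (rule has_derivative_bounded_linear)
    have "D x (\<Sum>b\<in>B. (v \<bullet> b) *\<^sub>R b) = (\<Sum>b\<in>B. (v \<bullet> b) *\<^sub>R D x b)"
      by (simp add: sum scaleR)
    moreover have "(\<Sum>b\<in>B. (v \<bullet> b) *\<^sub>R b) = v"
      using orthonormal_basis_expand[of B v] B fin that(2) by auto
    ultimately show ?thesis by simp
  qed
  show thesis
  proof (rule that[OF D])
    fix a and e :: real assume a: "a \<in> U" and "e > 0"
    \<comment> \<open>\<open>s z\<close> dominates the operator norm of \<open>D z - D a\<close> on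
      \<open>V\<close>. Since \<open>s a = 0\<close>, continuity of \<open>s\<close> at
      \<open>a\<close> is already the required bound.\<close>
    define s where "s z = (\<Sum>b\<in>B. norm (D z b - D a b))" for z
    have "continuous_on U s"
      unfolding s_def using B(1) by (intro continuous_intros cont) auto
    then obtain \<delta> where "\<delta> > 0" and \<delta>: "\<And>z. z \<in> U \<Longrightarrow> dist z a < \<delta> \<Longrightarrow> dist (s z) (s a) < e"
      using a \<open>e > 0\<close> unfolding continuous_on_iff by metis
    have "norm (D z v - D a v) \<le> e * norm v" if "z \<in> U" "dist z a < \<delta>" "v \<in> V" for z v
    proof -
      have "D z v - D a v = (\<Sum>b\<in>B. (v \<bullet> b) *\<^sub>R (D z b - D a b))"
        using rep that a by (simp add: scaleR_diff_right sum_subtractf)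
      also have "norm \<dots> \<le> (\<Sum>b\<in>B. norm v * norm (D z b - D a b))"
      proof (intro sum_norm_le)
        fix b assume "b \<in> B"
        then have "\<bar>v \<bullet> b\<bar> \<le> norm v"
          using Cauchy_Schwarz_ineq2[of v b] B(3) by simp
        then show "norm ((v \<bullet> b) *\<^sub>R (D z b - D a b)) \<le> norm v * norm (D z b - D a b)"
          by (simp add: mult_right_mono)
      qed
      also have "\<dots> = norm v * s z"
        by (simp add: s_def sum_distrib_left)
      also have "\<dots> \<le> norm v * e"
      proof (rule mult_left_mono)
        show "s z \<le> e"
          using \<delta>[OF that(1,2)] by (simp add: dist_real_def s_def)
      qed simp
      finally show ?thesis by (simp add: mult.commute)
    qed
    then show "\<exists>\<delta>>0. \<forall>z\<in>U. dist z a < \<delta> \<longrightarrow> (\<forall>v\<in>V. norm (D z v - D a v) \<le> e * norm v)"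
      using \<open>\<delta> > 0\<close> by blast
  next
    have "continuous_on (U \<times> V) (\<lambda>p. \<Sum>b\<in>B. (snd p \<bullet> b) *\<^sub>R D (fst p) b)"
      using B(1) by (intro continuous_intros continuous_on_compose2[OF cont]) auto
    then show "continuous_on (U \<times> V) (\<lambda>(x, v). D x v)"
      by (rule continuous_on_eq) (auto simp: rep)
  qed
qed

lemma openin_subspace_ball:
  assumes "openin (top_of_set V) U" "a \<in> U"
  obtains \<delta> where "\<delta> > 0" "V \<inter> ball a \<delta> \<subseteq> U" "V \<inter> cball a \<delta> \<subseteq> U"
proof -
  obtain e where "e > 0" "\<And>y. y \<in> V \<Longrightarrow> dist y a < e \<Longrightarrow> y \<in> U"
    using assms unfolding openin_euclidean_subtopology_iff by metis
  then have "V \<inter> cball a (e/2) \<subseteq> U"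
    by (auto simp: dist_commute)
  moreover have "V \<inter> ball a (e/2) \<subseteq> U"
    using calculation by auto
  ultimately show thesis
    using that[of "e/2"] \<open>e > 0\<close> by auto
qed

text \<open>The mean value inequality for \<open>f\<close> minus its linear part at
  \<open>a\<close>, on the convex set \<open>V \<inter> ball a \<delta>\<close>.\<close>

lemma strict_differentiability:
  fixes f :: "'e::euclidean_space \<Rightarrow> 'f::real_normed_vector"
  assumes V: "subspace V" and U: "openin (top_of_set V) U" and f: "Ck_on (Suc 0) V U f" and a: "a \<in> U"
  obtains A where "bounded_linear A"
    and "\<And>e. e > 0 \<Longrightarrow> \<exists>\<delta>>0. V \<inter> ball a \<delta> \<subseteq> U \<and>
      (\<forall>x\<in>V \<inter> ball a \<delta>. \<forall>y\<in>V \<inter> ball a \<delta>. norm (f x - f y - A (x - y)) \<le> e * norm (x - y))"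
proof -
  obtain D where D: "\<And>x. x \<in> U \<Longrightarrow> (f has_derivative D x) (at x within U)"
    and close: "\<And>a e. a \<in> U \<Longrightarrow> e > 0 \<Longrightarrow>
      \<exists>\<delta>>0. \<forall>z\<in>U. dist z a < \<delta> \<longrightarrow> (\<forall>v\<in>V. norm (D z v - D a v) \<le> e * norm v)"
    using Ck_on_1_derivative[OF V f] by metis
  show thesis
  proof (rule that)
    show lin: "bounded_linear (D a)"
      using D[OF a] by (rule has_derivative_bounded_linear)
    fix e :: real assume "e > 0"
    obtain \<delta>1 where \<delta>1: "\<delta>1 > 0" "V \<inter> ball a \<delta>1 \<subseteq> U"
      using openin_subspace_ball[OF U a] by metis
    obtain \<delta>2 where \<delta>2: "\<delta>2 > 0" "\<forall>z\<in>U. dist z a < \<delta>2 \<longrightarrow> (\<forall>v\<in>V. norm (D z v - D a v) \<le> e * norm v)"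
      using close[OF a \<open>e > 0\<close>] by auto
    define \<delta> where "\<delta> = min \<delta>1 \<delta>2"
    define S where "S = V \<inter> ball a \<delta>"
    have S: "S \<subseteq> U" using \<delta>1 by (auto simp: S_def \<delta>_def)
    have "convex S" unfolding S_def
      using V by (intro convex_Int subspace_imp_convex convex_ball)
    have "norm (f x - f y - D a (x - y)) \<le> e * norm (x - y)" if x: "x \<in> S" and y: "y \<in> S" for x y
    proof -
      define w where "w = x - y"
      have w: "w \<in> V" using x y V by (auto simp: S_def w_def subspace_diff)
      \<comment> \<open>\<open>D z\<close> and \<open>D a\<close> are known to be close only on
        \<open>V\<close>, so their difference is not controlled as an operator on the whole space.
        Along the segment only the direction \<open>w \<in> V\<close> occurs.\<close>
      define g where "g t = f (y + t *\<^sub>R w) - t *\<^sub>R D a w" for t :: real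
      have seg: "y + t *\<^sub>R w \<in> S" if "t \<in> {0..1}" for t
        using convexD_alt[OF \<open>convex S\<close> y x, of t] that
        by (simp add: w_def algebra_simps)
      have "norm (g 1 - g 0) \<le> (e * norm w) * norm (1 - 0 :: real)"
      proof (rule differentiable_bound[where S = "{0..1}"])
        fix t :: real assume t: "t \<in> {0..1}"
        have "((\<lambda>t. y + t *\<^sub>R w) has_derivative (\<lambda>h. h *\<^sub>R w)) (at t within {0..1})"
          by (auto intro!: derivative_eq_intros)
        then have "((\<lambda>t. f (y + t *\<^sub>R w)) has_derivative (\<lambda>h. D (y + t *\<^sub>R w) (h *\<^sub>R w))) (at t within {0..1})"
          by (rule has_derivative_in_compose2[where t = U, OF D, rotated -1]) (use seg S t in auto)
        then show "(g has_derivative (\<lambda>h. D (y + t *\<^sub>R w) (h *\<^sub>R w) - h *\<^sub>R D a w)) (at t within {0..1})"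
          unfolding g_def by (auto intro!: derivative_eq_intros)
        have "y + t *\<^sub>R w \<in> U" and "dist (y + t *\<^sub>R w) a < \<delta>2"
          using seg[OF t] S by (auto simp: S_def \<delta>_def dist_commute)
        then have "norm (D (y + t *\<^sub>R w) w - D a w) \<le> e * norm w"
          using \<delta>2(2) w by blast
        moreover have "D (y + t *\<^sub>R w) (h *\<^sub>R w) = h *\<^sub>R D (y + t *\<^sub>R w) w" for h
          using has_derivative_bounded_linear[OF D[OF \<open>y + t *\<^sub>R w \<in> U\<close>]]
          by (simp add: linear_simps)
        ultimately show "onorm (\<lambda>h. D (y + t *\<^sub>R w) (h *\<^sub>R w) - h *\<^sub>R D a w) \<le> e * norm w"
          by (intro onorm_le) (simp flip: scaleR_diff_right add: mult.commute[of _ "\<bar>_\<bar>"] mult_left_mono)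
      qed auto
      moreover have "g 1 - g 0 = f x - f y - D a (x - y)"
        by (simp add: g_def w_def algebra_simps)
      ultimately show ?thesis
        by (simp add: w_def)
    qed
    then show "\<exists>\<delta>>0. V \<inter> ball a \<delta> \<subseteq> U \<and>
      (\<forall>x\<in>V \<inter> ball a \<delta>. \<forall>y\<in>V \<inter> ball a \<delta>. norm (f x - f y - D a (x - y)) \<le> e * norm (x - y))"
      using S \<delta>1(1) \<delta>2(1) unfolding S_def \<delta>_def by (intro exI[of _ "min \<delta>1 \<delta>2"]) auto
  qed
qed

section \<open>Charts as coordinates and strict derivatives of smooth maps\<close>

abbreviation cdist :: "('a, 'e::real_normed_vector) chart \<Rightarrow> 'a \<Rightarrow> 'a \<Rightarrow> real"
  where "cdist \<kappa> x y \<equiv> norm (snd \<kappa> x - snd \<kappa> y)"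

abbreviation chart_inv :: "('a, 'e) chart \<Rightarrow> 'e \<Rightarrow> 'a"
  where "chart_inv \<kappa> \<equiv> inv_into (fst \<kappa>) (snd \<kappa>)"

lemma is_chartD:
  assumes "is_chart T V \<kappa>"
  shows "openin T (fst \<kappa>)" and "fst \<kappa> \<subseteq> topspace T" and "inj_on (snd \<kappa>) (fst \<kappa>)"
    and "snd \<kappa> ` fst \<kappa> \<subseteq> V" and "openin (top_of_set V) (snd \<kappa> ` fst \<kappa>)"
    and "homeomorphic_map (subtopology T (fst \<kappa>)) (top_of_set (snd \<kappa> ` fst \<kappa>)) (snd \<kappa>)"
proof -
  show o: "openin T (fst \<kappa>)" and h: "homeomorphic_map (subtopology T (fst \<kappa>)) (top_of_set (snd \<kappa> ` fst \<kappa>)) (snd \<kappa>)"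
    and i: "openin (top_of_set V) (snd \<kappa> ` fst \<kappa>)"
    using assms by (auto simp: is_chart_def)
  show s: "fst \<kappa> \<subseteq> topspace T" using o by (rule openin_subset)
  show "inj_on (snd \<kappa>) (fst \<kappa>)"
    using homeomorphic_imp_injective_map[OF h] s by (simp add: Int_absorb1)
  show "snd \<kappa> ` fst \<kappa> \<subseteq> V" using openin_imp_subset[OF i] .
qed

lemma chart_inv_left [simp]: "is_chart T V \<kappa> \<Longrightarrow> x \<in> fst \<kappa> \<Longrightarrow> chart_inv \<kappa> (snd \<kappa> x) = x"
  by (meson inv_into_f_f is_chartD(3))

lemma is_chart_image:
  assumes "is_chart T V \<kappa>" "openin T W"
  shows "openin (top_of_set V) (snd \<kappa> ` (fst \<kappa> \<inter> W))"
proof -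
  have "open_map (subtopology T (fst \<kappa>)) (top_of_set (snd \<kappa> ` fst \<kappa>)) (snd \<kappa>)"
    using is_chartD(6)[OF assms(1)] by (rule homeomorphic_imp_open_map)
  moreover have "openin (subtopology T (fst \<kappa>)) (fst \<kappa> \<inter> W)"
    using assms(2) by (rule openin_subtopology_Int2)
  ultimately have "openin (top_of_set (snd \<kappa> ` fst \<kappa>)) (snd \<kappa> ` (fst \<kappa> \<inter> W))"
    unfolding open_map_def by blast
  then show ?thesis
    using is_chartD(5)[OF assms(1)] openin_trans by blast
qed

lemma is_chart_continuous:
  assumes "is_chart T V \<kappa>"
  shows "continuous_map (subtopology T (fst \<kappa>)) (top_of_set V) (snd \<kappa>)"
  using homeomorphic_imp_continuous_map[OF is_chartD(6)[OF assms]] is_chartD(4)[OF assms]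
  by (auto simp: continuous_map_in_subtopology)

lemma is_chart_preimage:
  assumes "is_chart T V \<kappa>" "openin (top_of_set V) W"
  shows "openin T {x \<in> fst \<kappa>. snd \<kappa> x \<in> W}"
proof -
  have "openin (subtopology T (fst \<kappa>)) {x \<in> topspace (subtopology T (fst \<kappa>)). snd \<kappa> x \<in> W}"
    using is_chart_continuous[OF assms(1)] assms(2) by (rule openin_continuous_map_preimage)
  moreover have "topspace (subtopology T (fst \<kappa>)) = fst \<kappa>"
    using is_chartD(2)[OF assms(1)] by auto
  ultimately show ?thesis
    using openin_trans_full[OF _ is_chartD(1)[OF assms(1)]] by (simp del: topspace_subtopology)
qed

lemma is_chart_preimage_open:
  assumes "is_chart T V \<kappa>" "open W"
  shows "openin T {x \<in> fst \<kappa>. snd \<kappa> x \<in> W}"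
proof -
  have "{x \<in> fst \<kappa>. snd \<kappa> x \<in> W} = {x \<in> fst \<kappa>. snd \<kappa> x \<in> V \<inter> W}"
    using is_chartD(4)[OF assms(1)] by auto
  then show ?thesis
    using is_chart_preimage[OF assms(1) openin_open_Int[OF assms(2)]] by simp
qed

lemma is_chart_inv_continuous:
  assumes "is_chart T V \<kappa>"
  shows "continuous_map (top_of_set (snd \<kappa> ` fst \<kappa>)) T (chart_inv \<kappa>)"
proof -
  have "continuous_map (top_of_set (snd \<kappa> ` fst \<kappa>)) (subtopology T (fst \<kappa>)) (chart_inv \<kappa>)"
    unfolding continuous_map_def
  proof (intro conjI allI impI)
    show "chart_inv \<kappa> \<in> topspace (top_of_set (snd \<kappa> ` fst \<kappa>)) \<rightarrow> topspace (subtopology T (fst \<kappa>))"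
      using assms is_chartD(2)[OF assms] by auto
    fix W assume "openin (subtopology T (fst \<kappa>)) W"
    then have W: "openin (top_of_set (snd \<kappa> ` fst \<kappa>)) (snd \<kappa> ` W)" "W \<subseteq> fst \<kappa>"
      using homeomorphic_imp_open_map[OF is_chartD(6)[OF assms]] openin_subset[of "subtopology T (fst \<kappa>)" W]
      by (auto simp: open_map_def)
    moreover have "{x \<in> topspace (top_of_set (snd \<kappa> ` fst \<kappa>)). chart_inv \<kappa> x \<in> W} = snd \<kappa> ` W"
      using W(2) assms by (auto simp: subset_iff)
    ultimately show "openin (top_of_set (snd \<kappa> ` fst \<kappa>)) {x \<in> topspace (top_of_set (snd \<kappa> ` fst \<kappa>)). chart_inv \<kappa> x \<in> W}"
      by simp
  qed
  then show ?thesis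
    by (simp add: continuous_map_in_subtopology)
qed

lemma is_chart_nbhd:
  assumes "is_chart T V \<kappa>" "openin T W" "p \<in> W" "p \<in> fst \<kappa>"
  obtains \<delta> where "\<delta> > 0"
    and "\<And>z. z \<in> V \<Longrightarrow> z \<in> cball (snd \<kappa> p) \<delta> \<Longrightarrow> z \<in> snd \<kappa> ` fst \<kappa>"
    and "\<And>z. z \<in> V \<Longrightarrow> z \<in> cball (snd \<kappa> p) \<delta> \<Longrightarrow> chart_inv \<kappa> z \<in> fst \<kappa>"
    and "\<And>z. z \<in> V \<Longrightarrow> z \<in> cball (snd \<kappa> p) \<delta> \<Longrightarrow> chart_inv \<kappa> z \<in> W"
    and "\<And>z. z \<in> V \<Longrightarrow> z \<in> cball (snd \<kappa> p) \<delta> \<Longrightarrow> snd \<kappa> (chart_inv \<kappa> z) = z"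
proof -
  obtain \<delta> where \<delta>: "\<delta> > 0" "V \<inter> cball (snd \<kappa> p) \<delta> \<subseteq> snd \<kappa> ` (fst \<kappa> \<inter> W)"
    using openin_subspace_ball[OF is_chart_image[OF assms(1,2)], of "snd \<kappa> p"] assms(3,4) by blast
  then have *: "\<exists>x\<in>fst \<kappa> \<inter> W. z = snd \<kappa> x" if "z \<in> V" "z \<in> cball (snd \<kappa> p) \<delta>" for z
    using that by blast
  show thesis
    by (rule that[OF \<delta>(1)]) (use * assms(1) in fastforce)+
qed

text \<open>\<open>chart_inv \<kappa>\<close> is continuous and maps the compact set
  \<open>V \<inter> cball a r\<close> onto this set. Such compact neighborhoods later control where
  a path leaves a chart.\<close>

lemma compactin_chart_cball:
  assumes ch: "is_chart T V \<kappa>" and V: "subspace V"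
    and ball: "\<And>z. z \<in> V \<Longrightarrow> z \<in> cball a r \<Longrightarrow> z \<in> snd \<kappa> ` fst \<kappa>"
  shows "compactin T {x \<in> fst \<kappa>. snd \<kappa> x \<in> cball a r}"
proof -
  have "compactin (top_of_set (snd \<kappa> ` fst \<kappa>)) (V \<inter> cball a r)"
    using ball by (auto simp: compactin_subtopology intro!: closed_Int_compact closed_subspace V)
  then have "compactin T (chart_inv \<kappa> ` (V \<inter> cball a r))"
    by (rule image_compactin[OF _ is_chart_inv_continuous[OF ch]])
  moreover have "chart_inv \<kappa> ` (V \<inter> cball a r) = {x \<in> fst \<kappa>. snd \<kappa> x \<in> cball a r}"
  proof (intro subset_antisym subsetI)
    fix x assume "x \<in> chart_inv \<kappa> ` (V \<inter> cball a r)"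
    then show "x \<in> {x \<in> fst \<kappa>. snd \<kappa> x \<in> cball a r}"
      using ball ch by force
  next
    fix x assume "x \<in> {x \<in> fst \<kappa>. snd \<kappa> x \<in> cball a r}"
    then show "x \<in> chart_inv \<kappa> ` (V \<inter> cball a r)"
      using is_chartD(4)[OF ch] ch by (intro image_eqI[of _ _ "snd \<kappa> x"]) auto
  qed
  ultimately show ?thesis by simp
qed

lemma is_chart_prod:
  assumes "is_chart T V \<kappa>" "is_chart T' V' \<kappa>'"
  shows "is_chart (prod_topology T T') (V \<times> V') (fst \<kappa> \<times> fst \<kappa>', map_prod (snd \<kappa>) (snd \<kappa>'))"
proof -
  obtain g g' where "homeomorphic_maps (subtopology T (fst \<kappa>)) (top_of_set (snd \<kappa> ` fst \<kappa>)) (snd \<kappa>) g"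
    "homeomorphic_maps (subtopology T' (fst \<kappa>')) (top_of_set (snd \<kappa>' ` fst \<kappa>')) (snd \<kappa>') g'"
    using assms[THEN is_chartD(6)] unfolding homeomorphic_map_maps by blast
  then have "homeomorphic_map (prod_topology (subtopology T (fst \<kappa>)) (subtopology T' (fst \<kappa>')))
      (prod_topology (top_of_set (snd \<kappa> ` fst \<kappa>)) (top_of_set (snd \<kappa>' ` fst \<kappa>')))
      (\<lambda>(x, y). (snd \<kappa> x, snd \<kappa>' y))"
    unfolding homeomorphic_map_maps by (blast intro: homeomorphic_maps_prod[THEN iffD2])
  moreover have "(\<lambda>(x, y). (snd \<kappa> x, snd \<kappa>' y)) = map_prod (snd \<kappa>) (snd \<kappa>')"
    by auto
  moreover have "prod_topology (top_of_set V) (top_of_set V') = top_of_set (V \<times> V')"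
    for V :: "'b::euclidean_space set" and V' :: "'d::euclidean_space set"
    by (simp flip: subtopology_Times add: euclidean_product_topology)
  ultimately show ?thesis
    using assms[THEN is_chartD(1)] assms[THEN is_chartD(5)]
    by (auto simp: is_chart_def subtopology_Times map_prod_surj_on openin_Times openin_prod_Times_iff map_prod_image)
qed

text \<open>The part of the manifold axioms that passes to products without further work.\<close>

definition locally_charted :: "('a, 'e::euclidean_space) mfd \<Rightarrow> bool"
  where "locally_charted N \<longleftrightarrow> subspace (model N) \<and> (\<forall>\<kappa>\<in>atlas N. is_chart (mtop N) (model N) \<kappa>)"

lemma smooth_manifold_imp_locally_charted: "smooth_manifold N \<Longrightarrow> locally_charted N"
  by (auto simp: smooth_manifold_def locally_charted_def)

lemma locally_charted_prod:
  assumes "locally_charted N" "locally_charted N'"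
  shows "locally_charted (prod_mfd N N')"
  using assms by (auto simp: locally_charted_def prod_mfd_def subspace_Times is_chart_prod)

text \<open>Strict differentiability at \<open>p\<close> of the coordinate expression, with points
  of the manifold as variables, so that it can be applied without chart inverses.\<close>

definition strict_chart_deriv ::
    "('a, 'e::euclidean_space) mfd \<Rightarrow> ('a, 'e) chart \<Rightarrow> ('b, 'f::euclidean_space) chart \<Rightarrow> ('a \<Rightarrow> 'b) \<Rightarrow> 'a \<Rightarrow> ('e \<Rightarrow> 'f) \<Rightarrow> bool"
  where "strict_chart_deriv N \<kappa> \<kappa>' f p A \<longleftrightarrow> bounded_linear A \<and>
    (\<forall>e>0. \<exists>U. openin (mtop N) U \<and> p \<in> U \<and> U \<subseteq> fst \<kappa> \<and> f ` U \<subseteq> fst \<kappa>' \<and>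
      (\<forall>x\<in>U. \<forall>y\<in>U. norm (snd \<kappa>' (f x) - snd \<kappa>' (f y) - A (snd \<kappa> x - snd \<kappa> y))
        \<le> e * cdist \<kappa> x y))"

lemma smooth_map_strict_chart_deriv:
  fixes N :: "('a, 'e::euclidean_space) mfd" and N' :: "('b, 'f::euclidean_space) mfd"
  assumes N: "locally_charted N" "locally_charted N'" and f: "smooth_map N N' f"
    and \<kappa>: "\<kappa> \<in> charts_at N p" and \<kappa>': "\<kappa>' \<in> charts_at N' (f p)"
  obtains A where "strict_chart_deriv N \<kappa> \<kappa>' f p A"
proof -
  have ch: "is_chart (mtop N) (model N) \<kappa>" "is_chart (mtop N') (model N') \<kappa>'"
    and p: "p \<in> fst \<kappa>" "f p \<in> fst \<kappa>'" and V: "subspace (model N)"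
    using N \<kappa> \<kappa>' by (auto simp: locally_charted_def charts_at_def)
  define W where "W = {x \<in> topspace (mtop N). f x \<in> fst \<kappa>'}"
  have W: "openin (mtop N) W"
    using f is_chartD(1)[OF ch(2)] unfolding W_def smooth_map_def by (auto intro: openin_continuous_map_preimage)
  define Z where "Z = snd \<kappa> ` (fst \<kappa> \<inter> f -` fst \<kappa>')"
  have "fst \<kappa> \<inter> f -` fst \<kappa>' = fst \<kappa> \<inter> W"
    using is_chartD(2)[OF ch(1)] by (auto simp: W_def)
  then have Z: "openin (top_of_set (model N)) Z"
    using is_chart_image[OF ch(1) W] by (simp add: Z_def)
  define F where "F = snd \<kappa>' \<circ> f \<circ> chart_inv \<kappa>"
  have F: "Ck_on (Suc 0) (model N) Z F"
    using f \<kappa> \<kappa>' unfolding smooth_map_def smooth_on_def Z_def F_def charts_at_def by blast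
  have "snd \<kappa> p \<in> Z"
    using p by (auto simp: Z_def)
  then obtain A where A: "bounded_linear A" and *: "\<And>e. e > 0 \<Longrightarrow> \<exists>\<delta>>0. model N \<inter> ball (snd \<kappa> p) \<delta> \<subseteq> Z \<and>
      (\<forall>x\<in>model N \<inter> ball (snd \<kappa> p) \<delta>. \<forall>y\<in>model N \<inter> ball (snd \<kappa> p) \<delta>. norm (F x - F y - A (x - y)) \<le> e * norm (x - y))"
    using strict_differentiability[OF V Z F] by metis
  show thesis
  proof (rule that, unfold strict_chart_deriv_def, intro conjI allI impI)
    show "bounded_linear A" by (fact A)
    fix e :: real assume "e > 0"
    then obtain \<delta> where "\<delta> > 0" and \<delta>: "\<And>x y. x \<in> model N \<inter> ball (snd \<kappa> p) \<delta> \<Longrightarrow>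
        y \<in> model N \<inter> ball (snd \<kappa> p) \<delta> \<Longrightarrow> norm (F x - F y - A (x - y)) \<le> e * norm (x - y)"
      using * by metis
    define U where "U = W \<inter> {x \<in> fst \<kappa>. snd \<kappa> x \<in> ball (snd \<kappa> p) \<delta>}"
    have U: "openin (mtop N) U"
      unfolding U_def by (intro openin_Int W is_chart_preimage_open[OF ch(1)] open_ball)
    have "norm (snd \<kappa>' (f x) - snd \<kappa>' (f y) - A (snd \<kappa> x - snd \<kappa> y)) \<le> e * cdist \<kappa> x y"
      if "x \<in> U" "y \<in> U" for x y
      using \<delta>[of "snd \<kappa> x" "snd \<kappa> y"] that is_chartD(4)[OF ch(1)] ch(1) by (auto simp: F_def U_def)
    then show "\<exists>U. openin (mtop N) U \<and> p \<in> U \<and> U \<subseteq> fst \<kappa> \<and> f ` U \<subseteq> fst \<kappa>' \<and>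
      (\<forall>x\<in>U. \<forall>y\<in>U. norm (snd \<kappa>' (f x) - snd \<kappa>' (f y) - A (snd \<kappa> x - snd \<kappa> y)) \<le> e * cdist \<kappa> x y)"
      using U p \<open>\<delta> > 0\<close> is_chartD(2)[OF ch(1)]
      by (intro exI[of _ U]) (auto simp: U_def W_def)
  qed
qed

lemma prod_chart_in_charts_at:
  assumes "\<kappa>1 \<in> charts_at N1 a" "\<kappa>2 \<in> charts_at N2 b"
  shows "(fst \<kappa>1 \<times> fst \<kappa>2, map_prod (snd \<kappa>1) (snd \<kappa>2)) \<in> charts_at (prod_mfd N1 N2) (a, b)"
  using assms unfolding charts_at_def prod_mfd_def by (auto intro!: image_eqI[of _ _ "(\<kappa>1, \<kappa>2)"])

text \<open>A neighborhood of \<open>(a, b)\<close> contains a product of neighborhoods, and the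
  norm of a pair is at most the sum of the norms. This separates the two variables.\<close>

lemma strict_chart_deriv_prod:
  assumes A: "strict_chart_deriv (prod_mfd N1 N2) (fst \<kappa>1 \<times> fst \<kappa>2, map_prod (snd \<kappa>1) (snd \<kappa>2)) \<kappa>3 f (a, b) A"
    and "e > 0"
  obtains U1 U2 where "openin (mtop N1) U1" "a \<in> U1" "U1 \<subseteq> fst \<kappa>1"
    "openin (mtop N2) U2" "b \<in> U2" "U2 \<subseteq> fst \<kappa>2"
    "\<And>x y. x \<in> U1 \<Longrightarrow> y \<in> U2 \<Longrightarrow> f (x, y) \<in> fst \<kappa>3"
    "\<And>x x' y y'. x \<in> U1 \<Longrightarrow> x' \<in> U1 \<Longrightarrow> y \<in> U2 \<Longrightarrow> y' \<in> U2 \<Longrightarrow>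
       norm (snd \<kappa>3 (f (x, y)) - snd \<kappa>3 (f (x', y')) - A (snd \<kappa>1 x - snd \<kappa>1 x', snd \<kappa>2 y - snd \<kappa>2 y'))
         \<le> e * (cdist \<kappa>1 x x' + cdist \<kappa>2 y y')"
proof -
  have mt: "mtop (prod_mfd N1 N2) = prod_topology (mtop N1) (mtop N2)"
    by (simp add: prod_mfd_def)
  obtain U where U: "openin (prod_topology (mtop N1) (mtop N2)) U" "(a, b) \<in> U" "U \<subseteq> fst \<kappa>1 \<times> fst \<kappa>2"
    and f3: "f ` U \<subseteq> fst \<kappa>3"
    and le: "\<forall>x\<in>U. \<forall>y\<in>U. norm (snd \<kappa>3 (f x) - snd \<kappa>3 (f y) - A (map_prod (snd \<kappa>1) (snd \<kappa>2) x - map_prod (snd \<kappa>1) (snd \<kappa>2) y))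
      \<le> e * norm (map_prod (snd \<kappa>1) (snd \<kappa>2) x - map_prod (snd \<kappa>1) (snd \<kappa>2) y)"
    using A \<open>e > 0\<close> unfolding strict_chart_deriv_def mt fst_conv snd_conv by meson
  obtain U1 U2 where U12: "openin (mtop N1) U1" "a \<in> U1" "openin (mtop N2) U2" "b \<in> U2" "U1 \<times> U2 \<subseteq> U"
    using U(1,2) unfolding openin_prod_topology_alt by blast
  show thesis
  proof (rule that[OF U12(1,2) _ U12(3,4)])
    fix x x' y y' assume *: "x \<in> U1" "x' \<in> U1" "y \<in> U2" "y' \<in> U2"
    then have "(x, y) \<in> U" "(x', y') \<in> U"
      using U12(5) by auto
    then have "norm (snd \<kappa>3 (f (x, y)) - snd \<kappa>3 (f (x', y')) - A (snd \<kappa>1 x - snd \<kappa>1 x', snd \<kappa>2 y - snd \<kappa>2 y'))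
        \<le> e * norm (snd \<kappa>1 x - snd \<kappa>1 x', snd \<kappa>2 y - snd \<kappa>2 y')"
      using le by fastforce
    also have "\<dots> \<le> e * (cdist \<kappa>1 x x' + cdist \<kappa>2 y y')"
      using \<open>e > 0\<close> by (intro mult_left_mono norm_Pair_le) auto
    finally show "norm (snd \<kappa>3 (f (x, y)) - snd \<kappa>3 (f (x', y')) - A (snd \<kappa>1 x - snd \<kappa>1 x', snd \<kappa>2 y - snd \<kappa>2 y'))
         \<le> e * (cdist \<kappa>1 x x' + cdist \<kappa>2 y y')" .
  next
    fix x y assume "x \<in> U1" "y \<in> U2"
    then have "(x, y) \<in> U"
      using U12(5) by auto
    then show "f (x, y) \<in> fst \<kappa>3"
      using f3 by auto
  qed (use U(3) U12(2,4,5) in auto)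
qed

text \<open>Source of the upper bounds for the actions: a strictly differentiable map differs near
  the point from a bounded linear map by a Lipschitz error.\<close>

lemma smooth_map2_lipschitz:
  fixes N1 :: "('a, 'e::euclidean_space) mfd" and N2 :: "('b, 'f::euclidean_space) mfd"
    and N3 :: "('c, 'h::euclidean_space) mfd"
  assumes lc: "locally_charted N1" "locally_charted N2" "locally_charted N3"
    and f: "smooth_map (prod_mfd N1 N2) N3 (\<lambda>(x, y). f x y)"
    and "\<kappa>1 \<in> charts_at N1 a" and "\<kappa>2 \<in> charts_at N2 b" and "\<kappa>3 \<in> charts_at N3 (f a b)"
  obtains U1 U2 L where "openin (mtop N1) U1" "a \<in> U1" "U1 \<subseteq> fst \<kappa>1"
    "openin (mtop N2) U2" "b \<in> U2" "U2 \<subseteq> fst \<kappa>2" "L > 0"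
    "\<And>x y. x \<in> U1 \<Longrightarrow> y \<in> U2 \<Longrightarrow> f x y \<in> fst \<kappa>3"
    "\<And>x x' y y'. x \<in> U1 \<Longrightarrow> x' \<in> U1 \<Longrightarrow> y \<in> U2 \<Longrightarrow> y' \<in> U2 \<Longrightarrow>
       cdist \<kappa>3 (f x y) (f x' y')
         \<le> L * (cdist \<kappa>1 x x' + cdist \<kappa>2 y y')"
proof -
  have "\<kappa>3 \<in> charts_at N3 ((\<lambda>(x, y). f x y) (a, b))"
    using assms by simp
  then obtain A where A: "strict_chart_deriv (prod_mfd N1 N2) (fst \<kappa>1 \<times> fst \<kappa>2, map_prod (snd \<kappa>1) (snd \<kappa>2)) \<kappa>3 (\<lambda>(x, y). f x y) (a, b) A"
    using smooth_map_strict_chart_deriv[OF locally_charted_prod[OF lc(1,2)] lc(3) f prod_chart_in_charts_at[OF assms(5,6)]]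
    by metis
  obtain U1 U2 where U: "openin (mtop N1) U1" "a \<in> U1" "U1 \<subseteq> fst \<kappa>1"
    "openin (mtop N2) U2" "b \<in> U2" "U2 \<subseteq> fst \<kappa>2" "\<And>x y. x \<in> U1 \<Longrightarrow> y \<in> U2 \<Longrightarrow> (\<lambda>(x, y). f x y) (x, y) \<in> fst \<kappa>3"
    and le: "\<And>x x' y y'. x \<in> U1 \<Longrightarrow> x' \<in> U1 \<Longrightarrow> y \<in> U2 \<Longrightarrow> y' \<in> U2 \<Longrightarrow>
         norm (snd \<kappa>3 ((\<lambda>(x, y). f x y) (x, y)) - snd \<kappa>3 ((\<lambda>(x, y). f x y) (x', y')) - A (snd \<kappa>1 x - snd \<kappa>1 x', snd \<kappa>2 y - snd \<kappa>2 y'))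
           \<le> 1 * (cdist \<kappa>1 x x' + cdist \<kappa>2 y y')"
    using strict_chart_deriv_prod[OF A zero_less_one] by metis
  obtain K where K: "K > 0" "\<And>z. norm (A z) \<le> norm z * K"
    using bounded_linear.pos_bounded A unfolding strict_chart_deriv_def by metis
  show thesis
  \<comment> \<open>\<open>K\<close> bounds the linear part, and \<open>1\<close> is the error
    fraction allowed in \<open>le\<close>.\<close>
  proof (rule that[OF U(1-6), of "1 + K"])
    fix x x' y y' assume *: "x \<in> U1" "x' \<in> U1" "y \<in> U2" "y' \<in> U2"
    let ?v = "snd \<kappa>1 x - snd \<kappa>1 x'" and ?w = "snd \<kappa>2 y - snd \<kappa>2 y'"
    have "norm (A (?v, ?w)) \<le> (norm ?v + norm ?w) * K"
      using K(2)[of "(?v, ?w)"] mult_right_mono[OF norm_Pair_le[of ?v ?w], of K] K(1) by linarith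
    then show "cdist \<kappa>3 (f x y) (f x' y') \<le> (1 + K) * (norm ?v + norm ?w)"
      using le[OF *] norm_triangle_sub[of "snd \<kappa>3 (f x y) - snd \<kappa>3 (f x' y')" "A (?v, ?w)"]
      by (simp add: algebra_simps)
  qed (use K U(7) in auto)
qed

text \<open>The derivative \<open>A\<close> need not be computed: at the parameter \<open>a\<close>
  the map is the identity, so the strict estimate at \<open>x = x' = a\<close> already forces
  \<open>A (0, w)\<close> to be within \<open>(e/2) * norm w\<close> of \<open>w\<close>. The same
  estimate at nearby \<open>x\<close> costs another \<open>e/2\<close>.\<close>

lemma smooth_action_near_identity:
  fixes N1 :: "('a, 'e::euclidean_space) mfd" and N2 :: "('b, 'f::euclidean_space) mfd"
  assumes lc: "locally_charted N1" "locally_charted N2"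
    and f: "smooth_map (prod_mfd N1 N2) N2 (\<lambda>(x, y). f x y)"
    and \<kappa>1: "\<kappa>1 \<in> charts_at N1 a" and \<kappa>2: "\<kappa>2 \<in> charts_at N2 b"
    and id: "\<And>y. y \<in> topspace (mtop N2) \<Longrightarrow> f a y = y" and "e > 0"
  obtains U1 U2 where "openin (mtop N1) U1" "a \<in> U1" "U1 \<subseteq> fst \<kappa>1"
    "openin (mtop N2) U2" "b \<in> U2" "U2 \<subseteq> fst \<kappa>2"
    "\<And>x y. x \<in> U1 \<Longrightarrow> y \<in> U2 \<Longrightarrow> f x y \<in> fst \<kappa>2"
    "\<And>x y y'. x \<in> U1 \<Longrightarrow> y \<in> U2 \<Longrightarrow> y' \<in> U2 \<Longrightarrow>
       norm (snd \<kappa>2 (f x y) - snd \<kappa>2 (f x y') - (snd \<kappa>2 y - snd \<kappa>2 y')) \<le> e * cdist \<kappa>2 y y'"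
proof -
  have "b \<in> topspace (mtop N2)"
    using \<kappa>2 lc(2) is_chartD(2)[of "mtop N2" "model N2" \<kappa>2] by (auto simp: locally_charted_def charts_at_def)
  then have "\<kappa>2 \<in> charts_at N2 ((\<lambda>(x, y). f x y) (a, b))"
    using id \<kappa>2 by simp
  then obtain A where A: "strict_chart_deriv (prod_mfd N1 N2) (fst \<kappa>1 \<times> fst \<kappa>2, map_prod (snd \<kappa>1) (snd \<kappa>2)) \<kappa>2 (\<lambda>(x, y). f x y) (a, b) A"
    using smooth_map_strict_chart_deriv[OF locally_charted_prod[OF lc] lc(2) f prod_chart_in_charts_at[OF \<kappa>1 \<kappa>2]]
    by metis
  obtain U1 U2 where U: "openin (mtop N1) U1" "a \<in> U1" "U1 \<subseteq> fst \<kappa>1"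
    "openin (mtop N2) U2" "b \<in> U2" "U2 \<subseteq> fst \<kappa>2" "\<And>x y. x \<in> U1 \<Longrightarrow> y \<in> U2 \<Longrightarrow> (\<lambda>(x, y). f x y) (x, y) \<in> fst \<kappa>2"
    and le: "\<And>x x' y y'. x \<in> U1 \<Longrightarrow> x' \<in> U1 \<Longrightarrow> y \<in> U2 \<Longrightarrow> y' \<in> U2 \<Longrightarrow>
         norm (snd \<kappa>2 ((\<lambda>(x, y). f x y) (x, y)) - snd \<kappa>2 ((\<lambda>(x, y). f x y) (x', y')) - A (snd \<kappa>1 x - snd \<kappa>1 x', snd \<kappa>2 y - snd \<kappa>2 y'))
           \<le> (e/2) * (cdist \<kappa>1 x x' + cdist \<kappa>2 y y')"
    using strict_chart_deriv_prod[OF A half_gt_zero[OF \<open>e > 0\<close>]] by metis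
  show thesis
  proof (rule that[OF U(1-6)])
    fix x y y' assume x: "x \<in> U1" and y: "y \<in> U2" "y' \<in> U2"
    let ?w = "snd \<kappa>2 y - snd \<kappa>2 y'"
    have "f a y = y" "f a y' = y'"
      using y U(4) openin_subset id by blast+
    then have "norm (?w - A (0, ?w)) \<le> (e/2) * norm ?w"
      using le[OF U(2) U(2) y] by simp
    moreover have "norm (snd \<kappa>2 (f x y) - snd \<kappa>2 (f x y') - A (0, ?w)) \<le> (e/2) * norm ?w"
      using le[OF x x y] by simp
    moreover have "norm (snd \<kappa>2 (f x y) - snd \<kappa>2 (f x y') - ?w)
        \<le> norm (snd \<kappa>2 (f x y) - snd \<kappa>2 (f x y') - A (0, ?w)) + norm (?w - A (0, ?w))"
      using norm_triangle_ineq4[of "snd \<kappa>2 (f x y) - snd \<kappa>2 (f x y') - A (0, ?w)" "?w - A (0, ?w)"]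
      by simp
    moreover have "(e/2) * norm ?w + (e/2) * norm ?w = e * norm ?w"
      by simp
    ultimately show "norm (snd \<kappa>2 (f x y) - snd \<kappa>2 (f x y') - ?w) \<le> e * norm ?w"
      by linarith
  qed (use U(7) in auto)
qed

section \<open>Tangent vectors and Finsler distances\<close>

text \<open>Lets a derivative be taken only over the parameters for which a path stays in a chart
  domain.\<close>

lemma at_within_eventually:
  assumes "eventually P (at t within S)"
  shows "at t within S = at t within (S \<inter> {s. P s})"
proof -
  obtain W where W: "open W" "t \<in> W" "\<And>s. s \<in> W \<Longrightarrow> s \<noteq> t \<Longrightarrow> s \<in> S \<Longrightarrow> P s"
    using assms unfolding eventually_at_topological by blast
  then show ?thesis
    by (intro at_within_nhd[of t W]) auto
qed

text \<open>If \<open>z\<close> is the component of \<open>v\<close> orthogonal to \<open>V\<close>,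
  the function \<open>\<sigma> s \<bullet> z\<close> vanishes near \<open>t\<close>. Hence its
  derivative \<open>v \<bullet> z\<close>, the square of the norm of \<open>z\<close>, is
  zero.\<close>

lemma vector_derivative_in_subspace:
  fixes \<sigma> :: "real \<Rightarrow> 'e::euclidean_space"
  assumes V: "subspace V" and d: "(\<sigma> has_vector_derivative v) (at t within S)"
    and ev: "eventually (\<lambda>s. \<sigma> s \<in> V) (at t within S)" and t: "t \<in> S" "\<sigma> t \<in> V" and nb: "at t within S \<noteq> bot"
  shows "v \<in> V"
proof -
  obtain y z where y: "y \<in> V" and z: "\<And>w. w \<in> V \<Longrightarrow> orthogonal z w" and v: "v = y + z"
    using orthogonal_subspace_decomp_exists[of V v] V by (metis span_eq_iff)
  have z0: "w \<bullet> z = 0" if "w \<in> V" for w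
    using z[OF that] by (simp add: orthogonal_def inner_commute)
  have "((\<lambda>s. \<sigma> s \<bullet> z) has_vector_derivative v \<bullet> z) (at t within S)"
    using bounded_linear.has_vector_derivative[OF bounded_linear_inner_left d] .
  moreover have "((\<lambda>s. \<sigma> s \<bullet> z) has_vector_derivative 0) (at t within S)"
    unfolding has_vector_derivative_def
  proof (rule has_derivative_transform_eventually)
    show "((\<lambda>_. 0) has_derivative (\<lambda>x. x *\<^sub>R 0)) (at t within S)" by simp
    show "\<forall>\<^sub>F s in at t within S. 0 = \<sigma> s \<bullet> z"
      using ev by eventually_elim (use z0 in auto)
  qed (use t z0 in auto)
  ultimately have "v \<bullet> z = 0"
    using vector_derivative_unique_within[OF nb] by blast
  then have "z = 0"
    using z0[OF y] v by (simp add: inner_add_left)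
  then show ?thesis using y v by simp
qed

lemma charts_atD:
  assumes "smooth_manifold N" "\<kappa> \<in> charts_at N p"
  shows "is_chart (mtop N) (model N) \<kappa>" "openin (mtop N) (fst \<kappa>)" "p \<in> fst \<kappa>" "\<kappa> \<in> atlas N"
    "subspace (model N)" "snd \<kappa> p \<in> model N" "p \<in> topspace (mtop N)"
proof -
  show *: "is_chart (mtop N) (model N) \<kappa>" "p \<in> fst \<kappa>" "\<kappa> \<in> atlas N" "subspace (model N)"
    using assms by (auto simp: smooth_manifold_def charts_at_def)
  show "openin (mtop N) (fst \<kappa>)" "snd \<kappa> p \<in> model N" "p \<in> topspace (mtop N)"
    using is_chartD(1,2,4)[OF *(1)] *(2) by auto
qed

lemma
  fixes N :: "('a, 'e::euclidean_space) mfd"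
  assumes N: "smooth_manifold N" and \<kappa>: "\<kappa> \<in> atlas N" "\<kappa>' \<in> atlas N"
  defines "Z \<equiv> snd \<kappa> ` (fst \<kappa> \<inter> fst \<kappa>')"
  shows transition_openin: "openin (top_of_set (model N)) Z"
    and transition_Ck1: "Ck_on (Suc 0) (model N) Z (transition \<kappa> \<kappa>')"
    and transition_apply: "x \<in> fst \<kappa> \<Longrightarrow> transition \<kappa> \<kappa>' (snd \<kappa> x) = snd \<kappa>' x"
    and transition_in_model: "z \<in> Z \<Longrightarrow> transition \<kappa> \<kappa>' z \<in> model N"
proof -
  have ch: "is_chart (mtop N) (model N) \<kappa>" "is_chart (mtop N) (model N) \<kappa>'"
    using N \<kappa> by (auto simp: smooth_manifold_def)
  show "openin (top_of_set (model N)) Z"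
    unfolding Z_def by (intro is_chart_image[OF ch(1)] is_chartD(1)[OF ch(2)])
  show "Ck_on (Suc 0) (model N) Z (transition \<kappa> \<kappa>')"
    using N \<kappa> unfolding smooth_manifold_def smooth_on_def Z_def by blast
  show ap: "transition \<kappa> \<kappa>' (snd \<kappa> x) = snd \<kappa>' x" if "x \<in> fst \<kappa>" for x
    using ch(1) that by (simp add: transition_def)
  show "z \<in> Z \<Longrightarrow> transition \<kappa> \<kappa>' z \<in> model N"
    using ap is_chartD(4)[OF ch(2)] by (auto simp: Z_def)
qed

text \<open>\<open>dir_deriv\<close> differentiates along a full line, \<open>Ck_on\<close> only
  within \<open>Z\<close>. As \<open>Z\<close> is relatively open in the model space, a line in a
  model direction stays in \<open>Z\<close> for small parameters, so the two derivatives
  agree.\<close>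

lemma
  fixes N :: "('a, 'e::euclidean_space) mfd"
  assumes N: "smooth_manifold N" and \<kappa>: "\<kappa> \<in> atlas N" "\<kappa>' \<in> atlas N"
  defines "Z \<equiv> snd \<kappa> ` (fst \<kappa> \<inter> fst \<kappa>')"
  shows transition_compose_derivative: "\<And>\<sigma> v t S. (\<sigma> has_vector_derivative v) (at t within S) \<Longrightarrow> \<sigma> t \<in> Z \<Longrightarrow> t \<in> S \<Longrightarrow>
      v \<in> model N \<Longrightarrow> eventually (\<lambda>s. \<sigma> s \<in> Z) (at t within S) \<Longrightarrow>
      ((\<lambda>s. transition \<kappa> \<kappa>' (\<sigma> s)) has_vector_derivative dir_deriv (transition \<kappa> \<kappa>') (\<sigma> t) v) (at t within S)"
    and dir_deriv_continuous: "continuous_on (Z \<times> model N) (\<lambda>(z, v). dir_deriv (transition \<kappa> \<kappa>') z v)"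
    and dir_deriv_in_model: "\<And>z v. z \<in> Z \<Longrightarrow> v \<in> model N \<Longrightarrow> dir_deriv (transition \<kappa> \<kappa>') z v \<in> model N"
    and dir_deriv_scaleR: "\<And>z v a. z \<in> Z \<Longrightarrow> v \<in> model N \<Longrightarrow>
      dir_deriv (transition \<kappa> \<kappa>') z (a *\<^sub>R v) = a *\<^sub>R dir_deriv (transition \<kappa> \<kappa>') z v"
proof -
  let ?f = "transition \<kappa> \<kappa>'" and ?V = "model N"
  have V: "subspace ?V" using N by (simp add: smooth_manifold_def)
  have Zo: "openin (top_of_set ?V) Z" and ZV: "Z \<subseteq> ?V"
    using transition_openin[OF N \<kappa>] openin_imp_subset[OF transition_openin[OF N \<kappa>]] unfolding Z_def by auto
  obtain D where D: "\<And>x. x \<in> Z \<Longrightarrow> (?f has_derivative D x) (at x within Z)"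
    and Dc: "continuous_on (Z \<times> ?V) (\<lambda>(x, v). D x v)"
    using Ck_on_1_derivative[OF V transition_Ck1[OF N \<kappa>]] unfolding Z_def by metis
  have comp: "((\<lambda>s. ?f (\<sigma> s)) has_vector_derivative D (\<sigma> t) v) (at t within S)"
    if d: "(\<sigma> has_vector_derivative v) (at t within S)" and t: "\<sigma> t \<in> Z" "t \<in> S" "v \<in> ?V"
      and ev: "eventually (\<lambda>s. \<sigma> s \<in> Z) (at t within S)"
    for \<sigma> :: "real \<Rightarrow> 'e" and v t S
  proof -
    let ?S = "S \<inter> {s. \<sigma> s \<in> Z}"
    note eq = at_within_eventually[OF ev]
    have "(\<sigma> has_derivative (\<lambda>h. h *\<^sub>R v)) (at t within ?S)"
      using d unfolding eq has_vector_derivative_def .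
    then have "((\<lambda>s. ?f (\<sigma> s)) has_derivative (\<lambda>h. D (\<sigma> t) (h *\<^sub>R v))) (at t within ?S)"
      by (rule has_derivative_in_compose2[OF D, rotated -1]) (use t in auto)
    moreover have "D (\<sigma> t) (h *\<^sub>R v) = h *\<^sub>R D (\<sigma> t) v" for h
      using has_derivative_bounded_linear[OF D[OF t(1)]] by (simp add: linear_simps)
    ultimately show ?thesis
      unfolding eq has_vector_derivative_def by simp
  qed
  have line: "((\<lambda>s. z + s *\<^sub>R v) has_vector_derivative v) (at 0)"
    and line_ev: "eventually (\<lambda>s. z + s *\<^sub>R v \<in> Z) (at 0)" if z: "z \<in> Z" "v \<in> ?V" for z v
  proof -
    show "((\<lambda>s. z + s *\<^sub>R v) has_vector_derivative v) (at 0)"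
      by (auto intro!: derivative_eq_intros simp: has_vector_derivative_def)
    obtain \<delta> where \<delta>: "\<delta> > 0" "?V \<inter> ball z \<delta> \<subseteq> Z"
      using openin_subspace_ball[OF Zo z(1)] by metis
    have "((\<lambda>s. z + s *\<^sub>R v) \<longlongrightarrow> z + 0 *\<^sub>R v) (at 0)"
      by (intro tendsto_intros)
    then have "eventually (\<lambda>s. dist (z + s *\<^sub>R v) (z + 0 *\<^sub>R v) < \<delta>) (at 0)"
      using \<delta>(1) unfolding tendsto_iff by blast
    then show "eventually (\<lambda>s. z + s *\<^sub>R v \<in> Z) (at 0)"
    proof eventually_elim
      case (elim s)
      have "z + s *\<^sub>R v \<in> ?V"
        using z ZV V by (auto intro: subspace_add subspace_scale)
      then show ?case using elim \<delta>(2) by (auto simp: dist_commute)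
    qed
  qed
  have dd: "dir_deriv ?f z v = D z v" if "z \<in> Z" "v \<in> ?V" for z v
    using comp[OF line[OF that] _ _ that(2) line_ev[OF that]] that(1)
    by (simp add: dir_deriv_def vector_derivative_at)
  show "((\<lambda>s. ?f (\<sigma> s)) has_vector_derivative dir_deriv ?f (\<sigma> t) v) (at t within S)"
    if "(\<sigma> has_vector_derivative v) (at t within S)" "\<sigma> t \<in> Z" "t \<in> S" "v \<in> ?V"
      "eventually (\<lambda>s. \<sigma> s \<in> Z) (at t within S)" for \<sigma> v t S
    using comp that dd by simp
  show "continuous_on (Z \<times> ?V) (\<lambda>(z, v). dir_deriv ?f z v)"
    using Dc by (rule continuous_on_eq) (auto simp: dd)
  show "dir_deriv ?f z (a *\<^sub>R v) = a *\<^sub>R dir_deriv ?f z v" if "z \<in> Z" "v \<in> ?V" for z v a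
    using has_derivative_bounded_linear[OF D[OF that(1)]] that V by (simp add: dd subspace_scale linear_simps)
  show "dir_deriv ?f z v \<in> ?V" if "z \<in> Z" "v \<in> ?V" for z v
  proof -
    have *: "((\<lambda>s. ?f (z + s *\<^sub>R v)) has_vector_derivative D z v) (at 0 within UNIV)"
      using comp[OF line[OF that] _ _ that(2) line_ev[OF that]] that(1) by simp
    have "eventually (\<lambda>s. ?f (z + s *\<^sub>R v) \<in> ?V) (at 0)"
      using line_ev[OF that] by eventually_elim (use transition_in_model[OF N \<kappa>] in \<open>auto simp: Z_def\<close>)
    then have "D z v \<in> ?V"
      using transition_in_model[OF N \<kappa>] that(1) by (intro vector_derivative_in_subspace[OF V *]) (auto simp: Z_def)
    then show ?thesis using dd that by simp
  qed
qed

text \<open>Inverse of the identification \<open>\<xi> \<mapsto> \<xi> \<kappa>\<close> of the tangent space at \<open>p\<close> with the model space.\<close>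

definition tangent_lift ::
    "('a, 'e::euclidean_space) mfd \<Rightarrow> ('a, 'e) chart \<Rightarrow> 'a \<Rightarrow> 'e \<Rightarrow> (('a, 'e) chart \<Rightarrow> 'e)"
  where "tangent_lift N \<kappa> p v =
    (\<lambda>\<kappa>'. if \<kappa>' \<in> charts_at N p then dir_deriv (transition \<kappa> \<kappa>') (snd \<kappa> p) v else 0)"

text \<open>The chain rule for a transition map, applied while the path is in both charts. The
  properties of \<open>tangent_lift\<close> below are read off from derivatives of curves with this
  rule and uniqueness of derivatives.\<close>

lemma path_chart_derivative:
  fixes N :: "('a, 'e::euclidean_space) mfd"
  assumes N: "smooth_manifold N" and \<kappa>: "\<kappa> \<in> charts_at N (\<gamma> t)" and \<kappa>': "\<kappa>' \<in> charts_at N (\<gamma> t)"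
    and d: "((\<lambda>s. snd \<kappa> (\<gamma> s)) has_vector_derivative v) (at t within S)" and t: "t \<in> S" "v \<in> model N"
    and ev: "eventually (\<lambda>s. \<gamma> s \<in> fst \<kappa>) (at t within S)" "eventually (\<lambda>s. \<gamma> s \<in> fst \<kappa>') (at t within S)"
  shows "((\<lambda>s. snd \<kappa>' (\<gamma> s)) has_vector_derivative tangent_lift N \<kappa> (\<gamma> t) v \<kappa>') (at t within S)"
proof -
  have at: "\<kappa> \<in> atlas N" "\<kappa>' \<in> atlas N" "\<gamma> t \<in> fst \<kappa>" "\<gamma> t \<in> fst \<kappa>'"
    using \<kappa> \<kappa>' by (auto simp: charts_at_def)
  have "eventually (\<lambda>s. snd \<kappa> (\<gamma> s) \<in> snd \<kappa> ` (fst \<kappa> \<inter> fst \<kappa>')) (at t within S)"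
    using ev by eventually_elim auto
  then have "((\<lambda>s. transition \<kappa> \<kappa>' (snd \<kappa> (\<gamma> s))) has_vector_derivative
      dir_deriv (transition \<kappa> \<kappa>') (snd \<kappa> (\<gamma> t)) v) (at t within S)"
    using at t by (intro transition_compose_derivative[OF N at(1,2) d]) auto
  then have "((\<lambda>s. snd \<kappa>' (\<gamma> s)) has_vector_derivative
      dir_deriv (transition \<kappa> \<kappa>') (snd \<kappa> (\<gamma> t)) v) (at t within S)"
    unfolding has_vector_derivative_def
  proof (rule has_derivative_transform_eventually)
    show "\<forall>\<^sub>F s in at t within S. transition \<kappa> \<kappa>' (snd \<kappa> (\<gamma> s)) = snd \<kappa>' (\<gamma> s)"
      using ev(1) by eventually_elim (rule transition_apply[OF N at(1,2)])
  qed (use t transition_apply[OF N at(1,2)] at in auto)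
  then show ?thesis
    using \<kappa>' by (simp add: tangent_lift_def)
qed

text \<open>Realizes a model vector as the velocity of a curve at \<open>p\<close>. For large
  parameters the argument may leave the chart image, where the inverse is arbitrary; hence only
  statements near \<open>0\<close>.\<close>

lemma chart_line:
  fixes N :: "('a, 'e::euclidean_space) mfd"
  assumes N: "smooth_manifold N" and \<kappa>: "\<kappa> \<in> charts_at N p" and v: "v \<in> model N"
  defines "\<gamma> \<equiv> \<lambda>s::real. chart_inv \<kappa> (snd \<kappa> p + s *\<^sub>R v)"
  shows "\<gamma> 0 = p" and "((\<lambda>s. snd \<kappa> (\<gamma> s)) has_vector_derivative v) (at 0)"
    and "openin (mtop N) W \<Longrightarrow> p \<in> W \<Longrightarrow> eventually (\<lambda>s. \<gamma> s \<in> W) (at 0)"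
proof -
  note ch = charts_atD(1)[OF N \<kappa>] and p = charts_atD(3)[OF N \<kappa>] and V = charts_atD(5)[OF N \<kappa>]
    and pV = charts_atD(6)[OF N \<kappa>]
  have line: "snd \<kappa> p + s *\<^sub>R v \<in> model N" for s
    using pV v V by (auto intro: subspace_add subspace_scale)
  have ev: "eventually (\<lambda>s. snd \<kappa> p + s *\<^sub>R v \<in> cball (snd \<kappa> p) \<delta>) (at 0)" if "\<delta> > 0" for \<delta>
  proof -
    have "((\<lambda>s. snd \<kappa> p + s *\<^sub>R v) \<longlongrightarrow> snd \<kappa> p + 0 *\<^sub>R v) (at 0)"
      by (intro tendsto_intros)
    then have "eventually (\<lambda>s. dist (snd \<kappa> p + s *\<^sub>R v) (snd \<kappa> p + 0 *\<^sub>R v) < \<delta>) (at 0)"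
      using that unfolding tendsto_iff by blast
    then show ?thesis by eventually_elim (simp add: dist_commute)
  qed
  show \<gamma>0: "\<gamma> 0 = p"
    using ch p by (simp add: \<gamma>_def)
  show "eventually (\<lambda>s. \<gamma> s \<in> W) (at 0)" if W: "openin (mtop N) W" "p \<in> W"
  proof -
    obtain \<delta> where "\<delta> > 0" and \<delta>: "\<And>z. z \<in> model N \<Longrightarrow> z \<in> cball (snd \<kappa> p) \<delta> \<Longrightarrow> chart_inv \<kappa> z \<in> W"
      using is_chart_nbhd[OF ch W p] by metis
    show ?thesis
      using ev[OF \<open>\<delta> > 0\<close>] by eventually_elim (use \<delta> line in \<open>auto simp: \<gamma>_def\<close>)
  qed
  obtain \<delta> where "\<delta> > 0" and \<delta>: "\<And>z. z \<in> model N \<Longrightarrow> z \<in> cball (snd \<kappa> p) \<delta> \<Longrightarrow> snd \<kappa> (chart_inv \<kappa> z) = z"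
    using is_chart_nbhd[OF ch is_chartD(1)[OF ch] p p] by metis
  show "((\<lambda>s. snd \<kappa> (\<gamma> s)) has_vector_derivative v) (at 0)"
    unfolding has_vector_derivative_def
  proof (rule has_derivative_transform_eventually)
    show "((\<lambda>s. snd \<kappa> p + s *\<^sub>R v) has_derivative (\<lambda>x. x *\<^sub>R v)) (at 0)"
      by (auto intro!: derivative_eq_intros)
    show "\<forall>\<^sub>F s in at 0. snd \<kappa> p + s *\<^sub>R v = snd \<kappa> (\<gamma> s)"
      using ev[OF \<open>\<delta> > 0\<close>] by eventually_elim (use \<delta> line in \<open>auto simp: \<gamma>_def\<close>)
  qed (use \<gamma>0 in auto)
qed

lemma tangent_lift_self:
  assumes N: "smooth_manifold N" and \<kappa>: "\<kappa> \<in> charts_at N p" and v: "v \<in> model N"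
  shows "tangent_lift N \<kappa> p v \<kappa> = v"
proof -
  let ?\<gamma> = "\<lambda>s::real. chart_inv \<kappa> (snd \<kappa> p + s *\<^sub>R v)"
  note cl = chart_line[OF N \<kappa> v]
  note ev = cl(3)[OF charts_atD(2,3)[OF N \<kappa>]]
  have "((\<lambda>s. snd \<kappa> (?\<gamma> s)) has_vector_derivative tangent_lift N \<kappa> (?\<gamma> 0) v \<kappa>) (at 0)"
    by (rule path_chart_derivative[OF N _ _ cl(2) _ v ev ev]) (use cl(1) \<kappa> in auto)
  then show ?thesis
    using vector_derivative_unique_at cl(1,2) by metis
qed

text \<open>All components are derivatives at \<open>0\<close> of one and the same curve, read in
  different charts. The compatibility condition is then uniqueness of the derivative.\<close>

lemma tangent_lift_in_tangent_space:
  assumes N: "smooth_manifold N" and \<kappa>: "\<kappa> \<in> charts_at N p" and v: "v \<in> model N"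
  shows "tangent_lift N \<kappa> p v \<in> tangent_space N p"
proof -
  let ?\<gamma> = "\<lambda>s::real. chart_inv \<kappa> (snd \<kappa> p + s *\<^sub>R v)"
  note cl = chart_line[OF N \<kappa> v]
  have ev: "eventually (\<lambda>s. ?\<gamma> s \<in> fst \<kappa>') (at 0)" if "\<kappa>' \<in> charts_at N p" for \<kappa>'
    by (intro cl(3) charts_atD[OF N that])
  have der: "((\<lambda>s. snd \<kappa>' (?\<gamma> s)) has_vector_derivative tangent_lift N \<kappa> p v \<kappa>') (at 0)"
    if "\<kappa>' \<in> charts_at N p" for \<kappa>'
    using path_chart_derivative[OF N _ _ cl(2) _ v ev[OF \<kappa>] ev[OF that]] cl(1) \<kappa> that by simp
  have mem: "tangent_lift N \<kappa> p v \<kappa>' \<in> model N" if "\<kappa>' \<in> charts_at N p" for \<kappa>'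
    using dir_deriv_in_model[OF N, of \<kappa> \<kappa>' "snd \<kappa> p" v] \<kappa> that v by (auto simp: tangent_lift_def charts_at_def)
  have cocycle: "tangent_lift N \<kappa> p v \<kappa>'' = dir_deriv (transition \<kappa>' \<kappa>'') (snd \<kappa>' p) (tangent_lift N \<kappa> p v \<kappa>')"
    if "\<kappa>' \<in> charts_at N p" "\<kappa>'' \<in> charts_at N p" for \<kappa>' \<kappa>''
  proof -
    have "((\<lambda>s. snd \<kappa>'' (?\<gamma> s)) has_vector_derivative tangent_lift N \<kappa>' p (tangent_lift N \<kappa> p v \<kappa>') \<kappa>'') (at 0)"
      using path_chart_derivative[OF N _ _ der[OF that(1)] _ mem[OF that(1)] ev[OF that(1)] ev[OF that(2)]] cl(1) that by simp
    then show ?thesis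
      using vector_derivative_unique_at der[OF that(2)] that(2) by (metis tangent_lift_def)
  qed
  show ?thesis
    unfolding tangent_space_def mem_Collect_eq
  proof (intro conjI ballI allI impI)
    fix \<kappa>' assume "\<kappa>' \<in> charts_at N p"
    then show "tangent_lift N \<kappa> p v \<kappa>' \<in> model N" by (rule mem)
  next
    fix \<kappa>' \<kappa>'' assume "\<kappa>' \<in> charts_at N p" "\<kappa>'' \<in> charts_at N p"
    then show "tangent_lift N \<kappa> p v \<kappa>'' = dir_deriv (transition \<kappa>' \<kappa>'') (snd \<kappa>' p) (tangent_lift N \<kappa> p v \<kappa>')"
      by (rule cocycle)
  next
    fix \<kappa>' assume "\<kappa>' \<notin> charts_at N p"
    then show "tangent_lift N \<kappa> p v \<kappa>' = 0"
      by (simp add: tangent_lift_def)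
  qed
qed

lemma tangent_space_eq_lift:
  assumes "\<xi> \<in> tangent_space N p" "\<kappa> \<in> charts_at N p"
  shows "\<xi> = tangent_lift N \<kappa> p (\<xi> \<kappa>)"
proof
  fix \<kappa>'
  have "\<xi> \<kappa>' = dir_deriv (transition \<kappa> \<kappa>') (snd \<kappa> p) (\<xi> \<kappa>)" if "\<kappa>' \<in> charts_at N p"
    using assms that unfolding tangent_space_def by blast
  moreover have "\<xi> \<kappa>' = 0" if "\<kappa>' \<notin> charts_at N p"
    using assms that unfolding tangent_space_def by blast
  ultimately show "\<xi> \<kappa>' = tangent_lift N \<kappa> p (\<xi> \<kappa>) \<kappa>'"
    unfolding tangent_lift_def by presburger
qed

lemma tangent_lift_scaleR:
  assumes N: "smooth_manifold N" and \<kappa>: "\<kappa> \<in> charts_at N p" and v: "v \<in> model N"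
  shows "tangent_lift N \<kappa> p (a *\<^sub>R v) = (\<lambda>\<kappa>'. a *\<^sub>R tangent_lift N \<kappa> p v \<kappa>')"
proof
  fix \<kappa>'
  have V: "subspace (model N)" using N by (simp add: smooth_manifold_def)
  show "tangent_lift N \<kappa> p (a *\<^sub>R v) \<kappa>' = a *\<^sub>R tangent_lift N \<kappa> p v \<kappa>'"
  proof (cases "\<kappa>' \<in> charts_at N p")
    case False then show ?thesis by (simp add: tangent_lift_def)
  next
    case True
    then show ?thesis
      using \<kappa> v by (auto simp: tangent_lift_def charts_at_def intro!: dir_deriv_scaleR[OF N])
  qed
qed

text \<open>The inverse bundle chart is continuous. Over an overlap of charts, the preimage of a
  generating set is described by the transition map and its directional derivative. This allows a
  Finsler metric to be studied in coordinates, where compactness is available.\<close>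

lemma tangent_lift_continuous:
  fixes N :: "('a, 'e::euclidean_space) mfd"
  assumes N: "smooth_manifold N" and \<kappa>: "\<kappa> \<in> atlas N"
  shows "continuous_map (top_of_set (snd \<kappa> ` fst \<kappa> \<times> model N)) (tangent_topology N)
    (\<lambda>(z, v). (chart_inv \<kappa> z, tangent_lift N \<kappa> (chart_inv \<kappa> z) v))"
    (is "continuous_map (top_of_set ?S) _ ?g")
proof -
  have ch: "is_chart (mtop N) (model N) \<kappa>" using N \<kappa> by (simp add: smooth_manifold_def)
  have at: "\<kappa> \<in> charts_at N (chart_inv \<kappa> z)" "chart_inv \<kappa> z \<in> fst \<kappa>" "snd \<kappa> (chart_inv \<kappa> z) = z"
    if "z \<in> snd \<kappa> ` fst \<kappa>" for z
    using that ch \<kappa> by (auto simp: charts_at_def)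
  have TB: "?g (z, v) \<in> tangent_bundle N" if "z \<in> snd \<kappa> ` fst \<kappa>" "v \<in> model N" for z v
    using tangent_lift_in_tangent_space[OF N at(1)[OF that(1)] that(2)] charts_atD(7)[OF N at(1)[OF that(1)]]
    by (simp add: tangent_bundle_def)
  show ?thesis
    unfolding tangent_topology_def
  proof (rule continuous_on_generated_topo)
    fix U assume "U \<in> {{(p, \<xi>) \<in> tangent_bundle N. p \<in> fst \<kappa> \<and> (snd \<kappa> p, \<xi> \<kappa>) \<in> W} | \<kappa> W. \<kappa> \<in> atlas N \<and> open W}"
    then obtain \<kappa>' W where \<kappa>': "\<kappa>' \<in> atlas N" and W: "open W"
      and U: "U = {(p, \<xi>) \<in> tangent_bundle N. p \<in> fst \<kappa>' \<and> (snd \<kappa>' p, \<xi> \<kappa>') \<in> W}"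
      by blast
    let ?Z = "snd \<kappa> ` (fst \<kappa> \<inter> fst \<kappa>')"
    let ?h = "\<lambda>(z, v). (transition \<kappa> \<kappa>' z, dir_deriv (transition \<kappa> \<kappa>') z v)"
    have Zo: "openin (top_of_set (model N)) ?Z"
      by (rule transition_openin[OF N \<kappa> \<kappa>'])
    have "continuous_on ?Z (transition \<kappa> \<kappa>')"
      using transition_Ck1[OF N \<kappa> \<kappa>'] by (auto intro: has_derivative_continuous_on)
    then have "continuous_on (?Z \<times> model N) (\<lambda>x. (transition \<kappa> \<kappa>' (fst x), (\<lambda>(z, v). dir_deriv (transition \<kappa> \<kappa>') z v) x))"
      by (intro continuous_on_Pair dir_deriv_continuous[OF N \<kappa> \<kappa>'])
        (auto intro!: continuous_on_compose2[OF _ continuous_on_fst[OF continuous_on_id]])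
    then have "continuous_on (?Z \<times> model N) ?h"
      by (simp add: case_prod_unfold)
    then have "openin (top_of_set (?Z \<times> model N)) ((?Z \<times> model N) \<inter> ?h -` W)"
      using W by (rule continuous_openin_preimage_gen)
    moreover have "openin (top_of_set ?S) (?Z \<times> model N)"
      using Zo is_chartD(4)[OF ch] by (intro openin_Times openin_subset_trans[OF Zo]) auto
    ultimately have "openin (top_of_set ?S) ((?Z \<times> model N) \<inter> ?h -` W)"
      by (rule openin_trans)
    moreover have "?g -` U \<inter> topspace (top_of_set ?S) = (?Z \<times> model N) \<inter> ?h -` W"
    proof (rule Set.set_eqI)
      fix zv :: "'e \<times> 'e"
      obtain z v where zv: "zv = (z, v)" by fastforce
      have "(z, v) \<in> ?g -` U \<inter> topspace (top_of_set ?S) \<longleftrightarrow>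
        z \<in> snd \<kappa> ` fst \<kappa> \<and> v \<in> model N \<and> chart_inv \<kappa> z \<in> fst \<kappa>' \<and>
        (snd \<kappa>' (chart_inv \<kappa> z), tangent_lift N \<kappa> (chart_inv \<kappa> z) v \<kappa>') \<in> W"
        using TB by (auto simp: U)
      also have "\<dots> \<longleftrightarrow> z \<in> ?Z \<and> v \<in> model N \<and> ?h (z, v) \<in> W"
      proof (cases "z \<in> ?Z")
        case True
        then obtain x where x: "x \<in> fst \<kappa>" "x \<in> fst \<kappa>'" "z = snd \<kappa> x" by blast
        then have "chart_inv \<kappa> z = x" "\<kappa>' \<in> charts_at N x"
          using ch \<kappa>' by (auto simp: charts_at_def)
        then show ?thesis
          using x True transition_apply[OF N \<kappa> \<kappa>'] by (auto simp: tangent_lift_def)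
      next
        case False
        then show ?thesis
          using ch by auto
      qed
      finally show "zv \<in> ?g -` U \<inter> topspace (top_of_set ?S) \<longleftrightarrow> zv \<in> (?Z \<times> model N) \<inter> ?h -` W"
        unfolding zv by auto
    qed
    ultimately show "openin (top_of_set ?S) (?g -` U \<inter> topspace (top_of_set ?S))"
      by simp
  next
    \<comment> \<open>A generated topology has the union of its generators as its space. The
      generator with \<open>W = UNIV\<close> contains the whole image.\<close>
    have "{(p, \<xi>) \<in> tangent_bundle N. p \<in> fst \<kappa> \<and> (snd \<kappa> p, \<xi> \<kappa>) \<in> UNIV} \<in>
      {{(p, \<xi>) \<in> tangent_bundle N. p \<in> fst \<kappa> \<and> (snd \<kappa> p, \<xi> \<kappa>) \<in> W} | \<kappa> W. \<kappa> \<in> atlas N \<and> open W}"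
      using \<kappa> open_UNIV by blast
    moreover have "?g ` topspace (top_of_set ?S) \<subseteq> {(p, \<xi>) \<in> tangent_bundle N. p \<in> fst \<kappa> \<and> (snd \<kappa> p, \<xi> \<kappa>) \<in> UNIV}"
      using TB at(2) by auto
    ultimately show "?g ` topspace (top_of_set ?S) \<subseteq>
      \<Union>{{(p, \<xi>) \<in> tangent_bundle N. p \<in> fst \<kappa> \<and> (snd \<kappa> p, \<xi> \<kappa>) \<in> W} | \<kappa> W. \<kappa> \<in> atlas N \<and> open W}"
      by (metis (no_types, lifting) Sup_upper2)
  qed
qed

text \<open>In coordinates \<open>F\<close> is continuous and positive on the compact product of a
  closed ball with the unit sphere, so it has a positive minimum and a finite maximum there.
  Homogeneity extends the bounds to all vectors.\<close>

lemma finsler_lift_bounds: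
  fixes N :: "('a, 'e::euclidean_space) mfd"
  assumes N: "smooth_manifold N" and F: "finsler_metric N F" and \<kappa>: "\<kappa> \<in> charts_at N p"
  obtains \<rho> c C where "\<rho> > 0" "c > 0" "C > 0"
    "\<And>z. z \<in> model N \<Longrightarrow> z \<in> cball (snd \<kappa> p) \<rho> \<Longrightarrow> z \<in> snd \<kappa> ` fst \<kappa>"
    "\<And>x v. x \<in> fst \<kappa> \<Longrightarrow> snd \<kappa> x \<in> cball (snd \<kappa> p) \<rho> \<Longrightarrow> v \<in> model N \<Longrightarrow>
      c * norm v \<le> F (x, tangent_lift N \<kappa> x v) \<and> F (x, tangent_lift N \<kappa> x v) \<le> C * norm v"
proof -
  note ch = charts_atD[OF N \<kappa>]
  let ?V = "model N"
  define \<Phi> where "\<Phi> zv = F (chart_inv \<kappa> (fst zv), tangent_lift N \<kappa> (chart_inv \<kappa> (fst zv)) (snd zv))" for zv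
  have "continuous_map (top_of_set (snd \<kappa> ` fst \<kappa> \<times> ?V)) euclideanreal (F \<circ> (\<lambda>(z, v). (chart_inv \<kappa> z, tangent_lift N \<kappa> (chart_inv \<kappa> z) v)))"
    using tangent_lift_continuous[OF N ch(4)] F unfolding finsler_metric_def
    by (blast intro: continuous_map_compose)
  then have \<Phi>: "continuous_on (snd \<kappa> ` fst \<kappa> \<times> ?V) \<Phi>"
    by (simp add: \<Phi>_def o_def case_prod_unfold)
  obtain \<rho> where "\<rho> > 0" and \<rho>: "\<And>z. z \<in> ?V \<Longrightarrow> z \<in> cball (snd \<kappa> p) \<rho> \<Longrightarrow> z \<in> snd \<kappa> ` fst \<kappa>"
    using is_chart_nbhd[OF ch(1,2,3,3)] by metis
  define K where "K = (?V \<inter> cball (snd \<kappa> p) \<rho>) \<times> (?V \<inter> sphere 0 1)"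
  have cl: "closed ?V" using ch(5) by (rule closed_subspace)
  have "compact K"
    unfolding K_def by (intro compact_Times closed_Int_compact cl compact_cball compact_sphere)
  have K\<Phi>: "continuous_on K \<Phi>"
    using \<Phi> by (rule continuous_on_subset) (use \<rho> in \<open>auto simp: K_def\<close>)
  have norm_F: "\<And>\<xi>. \<xi> \<in> tangent_space N x \<Longrightarrow> 0 \<le> F (x, \<xi>) \<and> (F (x, \<xi>) = 0 \<longleftrightarrow> \<xi> = (\<lambda>\<kappa>. 0))"
    and hom_F: "\<And>\<xi> a. \<xi> \<in> tangent_space N x \<Longrightarrow> F (x, \<lambda>\<kappa>. a *\<^sub>R \<xi> \<kappa>) = \<bar>a\<bar> * F (x, \<xi>)"
    if "x \<in> topspace (mtop N)" for x
    using F that unfolding finsler_metric_def by blast+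
  have pos: "\<Phi> (z, v) > 0" if zv: "(z, v) \<in> K" for z v
  proof -
    have z: "z \<in> snd \<kappa> ` fst \<kappa>" and v: "v \<in> ?V" "v \<noteq> 0"
      using zv \<rho> by (auto simp: K_def)
    define x where "x = chart_inv \<kappa> z"
    have x: "\<kappa> \<in> charts_at N x"
      using z ch(1,4) by (auto simp: x_def charts_at_def)
    have "tangent_lift N \<kappa> x v \<noteq> (\<lambda>\<kappa>. 0)"
      using tangent_lift_self[OF N x v(1)] v(2) by metis
    then have "F (x, tangent_lift N \<kappa> x v) > 0"
      using norm_F[OF charts_atD(7)[OF N x] tangent_lift_in_tangent_space[OF N x v(1)]] by linarith
    then show ?thesis by (simp add: \<Phi>_def x_def)
  qed
  obtain c C where "c > 0" "C > 0" and cC: "\<And>z v. (z, v) \<in> K \<Longrightarrow> c \<le> \<Phi> (z, v) \<and> \<Phi> (z, v) \<le> C"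
  proof (cases "K = {}")
    \<comment> \<open>\<open>K\<close> is empty exactly when the model space is zero-dimensional.
      The zero vector, treated separately below, is then the only tangent vector.\<close>
    case True
    then show thesis using that[of 1 1] by simp
  next
    case False
    then obtain k0 k1 where "k0 \<in> K" "\<And>k. k \<in> K \<Longrightarrow> \<Phi> k0 \<le> \<Phi> k" "k1 \<in> K" "\<And>k. k \<in> K \<Longrightarrow> \<Phi> k \<le> \<Phi> k1"
      using continuous_attains_inf[OF \<open>compact K\<close> _ K\<Phi>] continuous_attains_sup[OF \<open>compact K\<close> _ K\<Phi>] by metis
    then show thesis
      using that[of "\<Phi> k0" "\<Phi> k1"] pos by (metis surj_pair)
  qed
  show thesis
  proof (rule that[OF \<open>\<rho> > 0\<close> \<open>c > 0\<close> \<open>C > 0\<close> \<rho>])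
    fix x v assume x: "x \<in> fst \<kappa>" "snd \<kappa> x \<in> cball (snd \<kappa> p) \<rho>" and v: "v \<in> ?V"
    have at: "\<kappa> \<in> charts_at N x"
      using x(1) ch(4) by (simp add: charts_at_def)
    show "c * norm v \<le> F (x, tangent_lift N \<kappa> x v) \<and> F (x, tangent_lift N \<kappa> x v) \<le> C * norm v"
    proof (cases "v = 0")
      case True
      have "tangent_lift N \<kappa> x (0 *\<^sub>R v) = (\<lambda>\<kappa>'. 0 *\<^sub>R tangent_lift N \<kappa> x v \<kappa>')"
        by (rule tangent_lift_scaleR[OF N at v])
      then have "F (x, tangent_lift N \<kappa> x v) = 0"
        using norm_F[OF charts_atD(7)[OF N at] tangent_lift_in_tangent_space[OF N at v]] True by simp
      then show ?thesis using True by simp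
    next
      case False
      define w where "w = v /\<^sub>R norm v"
      have w: "w \<in> ?V" "norm w = 1" and vw: "v = norm v *\<^sub>R w"
        using False v ch(5) by (auto simp: w_def subspace_scale)
      have "(snd \<kappa> x, w) \<in> K"
        using w x charts_atD(6)[OF N at] by (auto simp: K_def)
      then have "c \<le> F (x, tangent_lift N \<kappa> x w) \<and> F (x, tangent_lift N \<kappa> x w) \<le> C"
        using cC ch(1) x(1) by (force simp: \<Phi>_def)
      moreover have "F (x, tangent_lift N \<kappa> x v) = norm v * F (x, tangent_lift N \<kappa> x w)"
        using hom_F[OF charts_atD(7)[OF N at] tangent_lift_in_tangent_space[OF N at w(1)], of "norm v"]
          tangent_lift_scaleR[OF N at w(1), of "norm v"] vw by simp
      ultimately show ?thesis
        by (simp add: mult.commute[of _ "norm v"] mult_left_mono)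
    qed
  qed
qed

section \<open>Straight segments in a chart and the upper bound for Finsler distances\<close>

definition chart_segment :: "('a, 'e::euclidean_space) chart \<Rightarrow> 'a \<Rightarrow> 'a \<Rightarrow> real \<Rightarrow> 'a"
  where "chart_segment \<kappa> x y t = chart_inv \<kappa> (snd \<kappa> x + t *\<^sub>R (snd \<kappa> y - snd \<kappa> x))"

lemma chart_segment_facts:
  fixes N :: "('a, 'e::euclidean_space) mfd"
  assumes ch: "is_chart T V \<kappa>" and V: "subspace V"
    and ball: "\<And>z. z \<in> V \<Longrightarrow> z \<in> cball a \<rho> \<Longrightarrow> z \<in> snd \<kappa> ` fst \<kappa>"
    and x: "x \<in> fst \<kappa>" "snd \<kappa> x \<in> cball a \<rho>" and y: "y \<in> fst \<kappa>" "snd \<kappa> y \<in> cball a \<rho>"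
  shows "chart_segment \<kappa> x y 0 = x" "chart_segment \<kappa> x y 1 = y"
    and "\<And>t. t \<in> {0..1} \<Longrightarrow> chart_segment \<kappa> x y t \<in> fst \<kappa>"
    and "\<And>t. t \<in> {0..1} \<Longrightarrow> snd \<kappa> (chart_segment \<kappa> x y t) = snd \<kappa> x + t *\<^sub>R (snd \<kappa> y - snd \<kappa> x)"
    and "\<And>t. t \<in> {0..1} \<Longrightarrow> snd \<kappa> (chart_segment \<kappa> x y t) \<in> cball a \<rho>"
    and "continuous_map (top_of_set {0..1}) T (chart_segment \<kappa> x y)"
proof -
  have seg: "snd \<kappa> x + t *\<^sub>R (snd \<kappa> y - snd \<kappa> x) \<in> V \<inter> cball a \<rho>" if "t \<in> {0..1}" for t :: real
  proof -
    have "(1 - t) *\<^sub>R snd \<kappa> x + t *\<^sub>R snd \<kappa> y \<in> V \<inter> cball a \<rho>"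
      using x y is_chartD(4)[OF ch] that V
      by (intro convexD_alt convex_Int subspace_imp_convex convex_cball) auto
    then show ?thesis by (simp add: algebra_simps)
  qed
  show "chart_segment \<kappa> x y 0 = x" "chart_segment \<kappa> x y 1 = y"
    using ch x y by (auto simp: chart_segment_def)
  have *: "\<exists>q\<in>fst \<kappa>. snd \<kappa> q = snd \<kappa> x + t *\<^sub>R (snd \<kappa> y - snd \<kappa> x)" if "t \<in> {0..1}" for t
    using seg[OF that] ball by (metis IntD1 IntD2 image_iff)
  show "chart_segment \<kappa> x y t \<in> fst \<kappa>"
    "snd \<kappa> (chart_segment \<kappa> x y t) = snd \<kappa> x + t *\<^sub>R (snd \<kappa> y - snd \<kappa> x)"
    "snd \<kappa> (chart_segment \<kappa> x y t) \<in> cball a \<rho>" if "t \<in> {0..1}" for t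
    using *[OF that] seg[OF that] ch unfolding chart_segment_def by (metis chart_inv_left IntD2)+
  have "continuous_map (top_of_set {0..1}) (top_of_set (snd \<kappa> ` fst \<kappa>)) (\<lambda>t. snd \<kappa> x + t *\<^sub>R (snd \<kappa> y - snd \<kappa> x))"
    using seg ball by (auto simp: continuous_map_in_subtopology intro!: continuous_intros)
  from continuous_map_compose[OF this is_chart_inv_continuous[OF ch]]
  show "continuous_map (top_of_set {0..1}) T (chart_segment \<kappa> x y)"
    by (simp add: o_def chart_segment_def[abs_def])
qed

lemma continuous_map_eventually:
  assumes "continuous_map (top_of_set S) T \<gamma>" "openin T W" "t \<in> S" "\<gamma> t \<in> W"
  shows "eventually (\<lambda>s. \<gamma> s \<in> W) (at t within S)"
proof -
  have "openin (top_of_set S) {s \<in> S. \<gamma> s \<in> W}"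
    using openin_continuous_map_preimage[OF assms(1,2)] by simp
  then obtain B where "open B" "{s \<in> S. \<gamma> s \<in> W} = S \<inter> B"
    unfolding openin_open by auto
  then show ?thesis
    unfolding eventually_at_topological using assms(3,4) by (intro exI[of _ B]) auto
qed

lemma velocity_eq_tangent_lift:
  fixes N :: "('a, 'e::euclidean_space) mfd"
  assumes N: "smooth_manifold N" and \<kappa>: "\<kappa> \<in> charts_at N (\<gamma> t)" and t: "t \<in> {0..1}"
    and d: "((\<lambda>s. snd \<kappa> (\<gamma> s)) has_vector_derivative v) (at t within {0..1})" and v: "v \<in> model N"
    and \<gamma>: "continuous_map (top_of_set {0..1}) (mtop N) \<gamma>"
  shows "velocity N \<gamma> t = (\<gamma> t, tangent_lift N \<kappa> (\<gamma> t) v)"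
proof -
  have "vector_derivative (snd \<kappa>' \<circ> \<gamma>) (at t within {0..1}) = tangent_lift N \<kappa> (\<gamma> t) v \<kappa>'"
    if "\<kappa>' \<in> charts_at N (\<gamma> t)" for \<kappa>'
  proof (rule vector_derivative_within_closed_interval)
    have ev: "eventually (\<lambda>s. \<gamma> s \<in> fst \<kappa>') (at t within {0..1})" if "\<kappa>' \<in> charts_at N (\<gamma> t)" for \<kappa>'
      by (rule continuous_map_eventually[OF \<gamma> charts_atD(2)[OF N that] t charts_atD(3)[OF N that]])
    show "(snd \<kappa>' \<circ> \<gamma> has_vector_derivative tangent_lift N \<kappa> (\<gamma> t) v \<kappa>') (at t within {0..1})"
      using path_chart_derivative[where \<gamma> = \<gamma>, OF N \<kappa> that d t v ev[OF \<kappa>] ev[OF that]] by (simp add: o_def)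
  qed (use t in auto)
  then show ?thesis
    by (auto simp: velocity_def tangent_lift_def)
qed

text \<open>In any other chart the segment is a line followed by a transition map, so its derivative
  there is a \<open>dir_deriv\<close>, which is continuous.\<close>

lemma chart_segment_piecewise_C1:
  fixes N :: "('a, 'e::euclidean_space) mfd"
  assumes N: "smooth_manifold N" and \<kappa>: "\<kappa> \<in> atlas N"
    and ball: "\<And>z. z \<in> model N \<Longrightarrow> z \<in> cball a \<rho> \<Longrightarrow> z \<in> snd \<kappa> ` fst \<kappa>"
    and x: "x \<in> fst \<kappa>" "snd \<kappa> x \<in> cball a \<rho>" and y: "y \<in> fst \<kappa>" "snd \<kappa> y \<in> cball a \<rho>"
  shows "piecewise_C1_path N (chart_segment \<kappa> x y)"
    and "\<And>t. t \<in> {0..1} \<Longrightarrow> velocity N (chart_segment \<kappa> x y) t =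
      (chart_segment \<kappa> x y t, tangent_lift N \<kappa> (chart_segment \<kappa> x y t) (snd \<kappa> y - snd \<kappa> x))"
proof -
  have V: "subspace (model N)" and ch: "is_chart (mtop N) (model N) \<kappa>"
    using N \<kappa> by (auto simp: smooth_manifold_def)
  let ?\<gamma> = "chart_segment \<kappa> x y"
  define w where "w = snd \<kappa> y - snd \<kappa> x"
  have w: "w \<in> model N"
    using is_chartD(4)[OF ch] x y V by (auto simp: w_def intro: subspace_diff)
  note seg = chart_segment_facts[OF ch V ball x y, simplified, folded w_def]
  have at: "\<kappa> \<in> charts_at N (?\<gamma> t)" if "t \<in> {0..1}" for t
    using seg(3) that \<kappa> by (simp add: charts_at_def)
  have d: "((\<lambda>s. snd \<kappa> (?\<gamma> s)) has_vector_derivative w) (at t within {0..1})" if t: "t \<in> {0..1}" for t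
  proof (rule has_vector_derivative_weaken)
    show "((\<lambda>t. snd \<kappa> x + t *\<^sub>R w) has_vector_derivative w) (at t within {0..1})"
      by (auto intro!: derivative_eq_intros simp: has_vector_derivative_def)
  qed (use t seg in auto)
  have ev: "eventually (\<lambda>s. ?\<gamma> s \<in> fst \<kappa>') (at t within {0..1})" if "\<kappa>' \<in> charts_at N (?\<gamma> t)" "t \<in> {0..1}" for \<kappa>' t
    by (rule continuous_map_eventually[OF seg(6) charts_atD(2)[OF N that(1)] that(2) charts_atD(3)[OF N that(1)]])
  show "velocity N ?\<gamma> t = (?\<gamma> t, tangent_lift N \<kappa> (?\<gamma> t) (snd \<kappa> y - snd \<kappa> x))" if "t \<in> {0..1}" for t
    unfolding w_def[symmetric] by (rule velocity_eq_tangent_lift[OF N at[OF that] that d[OF that] w seg(6)])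
  have "C1_path_on N ?\<gamma> 0 1"
    unfolding C1_path_on_def
  proof (intro conjI ballI seg(6))
    fix \<kappa>' assume \<kappa>': "\<kappa>' \<in> atlas N"
    let ?T = "{0..1} \<inter> ?\<gamma> -` fst \<kappa>'" and ?D = "\<lambda>t. dir_deriv (transition \<kappa> \<kappa>') (snd \<kappa> x + t *\<^sub>R w) w"
    have at': "\<kappa>' \<in> charts_at N (?\<gamma> t)" if "t \<in> ?T" for t
      using that \<kappa>' by (simp add: charts_at_def)
    have "continuous_on ?T (\<lambda>t. (\<lambda>(z, v). dir_deriv (transition \<kappa> \<kappa>') z v) (snd \<kappa> x + t *\<^sub>R w, w))"
    proof (rule continuous_on_compose2[OF dir_deriv_continuous[OF N \<kappa> \<kappa>']])
      show "continuous_on ?T (\<lambda>t. (snd \<kappa> x + t *\<^sub>R w, w))"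
        by (intro continuous_intros)
      show "(\<lambda>t. (snd \<kappa> x + t *\<^sub>R w, w)) ` ?T \<subseteq> snd \<kappa> ` (fst \<kappa> \<inter> fst \<kappa>') \<times> model N"
      proof (rule image_subsetI)
        fix t :: real assume "t \<in> ?T"
        then show "(snd \<kappa> x + t *\<^sub>R w, w) \<in> snd \<kappa> ` (fst \<kappa> \<inter> fst \<kappa>') \<times> model N"
          using w seg(3,4) by (auto intro!: image_eqI[of _ _ "?\<gamma> t"])
      qed
    qed
    then have "continuous_on ?T ?D" by simp
    moreover have "((snd \<kappa>' \<circ> ?\<gamma>) has_vector_derivative ?D t) (at t within {0..1})" if "t \<in> ?T" for t
    proof -
      have t: "t \<in> {0..1}" using that by simp
      have "((\<lambda>s. snd \<kappa>' (?\<gamma> s)) has_vector_derivative tangent_lift N \<kappa> (?\<gamma> t) w \<kappa>') (at t within {0..1})"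
        by (rule path_chart_derivative[OF N at[OF t] at'[OF that] d[OF t] t w ev[OF at[OF t] t] ev[OF at'[OF that] t]])
      then show ?thesis
        using seg(4)[of t] t at'[OF that] by (simp add: tangent_lift_def o_def)
    qed
    ultimately show "\<exists>D. continuous_on ?T D \<and> (\<forall>t\<in>?T. ((snd \<kappa>' \<circ> ?\<gamma>) has_vector_derivative D t) (at t within {0..1}))"
      by blast
  qed
  \<comment> \<open>A single piece: \<open>n = 1\<close>, with break points \<open>real 0\<close>
    and \<open>real 1\<close>.\<close>
  then show "piecewise_C1_path N ?\<gamma>"
    unfolding piecewise_C1_path_def by (intro exI[of _ 1] exI[of _ real]) auto
qed

text \<open>The \<open>integral\<close> of a function that is not integrable is 0, so
  \<open>0 \<le> B\<close> covers that case and no integrability has to be assumed.\<close>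

lemma integral_le_const_unit_interval:
  fixes f :: "real \<Rightarrow> real"
  assumes "\<And>t. t \<in> {0..1} \<Longrightarrow> f t \<le> B" "0 \<le> B"
  shows "integral {0..1} f \<le> B"
proof (cases "f integrable_on {0..1}")
  case True
  then have "integral {0..1} f \<le> integral {0..1} (\<lambda>_::real. B)"
    using assms(1) by (intro integral_le) auto
  then show ?thesis by simp
next
  case False
  then show ?thesis using assms(2) by (simp add: not_integrable_integral)
qed

text \<open>The chart segment competes in the infimum, and its speed is at most \<open>C\<close>
  times its constant coordinate speed.\<close>

lemma finsler_dist_chart_upper:
  fixes N :: "('a, 'e::euclidean_space) mfd"
  assumes N: "smooth_manifold N" and F: "finsler_metric N F" and \<kappa>: "\<kappa> \<in> charts_at N p"
  obtains U C where "openin (mtop N) U" "p \<in> U" "U \<subseteq> fst \<kappa>" "C > 0"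
    "\<And>x y. x \<in> U \<Longrightarrow> y \<in> U \<Longrightarrow> finsler_dist N F x y \<le> ennreal (C * cdist \<kappa> x y)"
proof -
  note ch = charts_atD[OF N \<kappa>]
  obtain \<rho> c C where "\<rho> > 0" "C > 0"
    and \<rho>: "\<And>z. z \<in> model N \<Longrightarrow> z \<in> cball (snd \<kappa> p) \<rho> \<Longrightarrow> z \<in> snd \<kappa> ` fst \<kappa>"
    and C: "\<And>x v. x \<in> fst \<kappa> \<Longrightarrow> snd \<kappa> x \<in> cball (snd \<kappa> p) \<rho> \<Longrightarrow> v \<in> model N \<Longrightarrow>
      c * norm v \<le> F (x, tangent_lift N \<kappa> x v) \<and> F (x, tangent_lift N \<kappa> x v) \<le> C * norm v"
    using finsler_lift_bounds[OF N F \<kappa>] by metis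
  define U where "U = {x \<in> fst \<kappa>. snd \<kappa> x \<in> ball (snd \<kappa> p) \<rho>}"
  show thesis
  proof (rule that[of U C])
    show "openin (mtop N) U"
      unfolding U_def by (rule is_chart_preimage_open[OF ch(1) open_ball])
    fix x y assume "x \<in> U" "y \<in> U"
    then have x: "x \<in> fst \<kappa>" "snd \<kappa> x \<in> cball (snd \<kappa> p) \<rho>" and y: "y \<in> fst \<kappa>" "snd \<kappa> y \<in> cball (snd \<kappa> p) \<rho>"
      by (auto simp: U_def)
    let ?\<gamma> = "chart_segment \<kappa> x y"
    note seg = chart_segment_facts[OF ch(1,5) \<rho> x y]
      and C1 = chart_segment_piecewise_C1[OF N ch(4) \<rho> x y]
    have w: "snd \<kappa> y - snd \<kappa> x \<in> model N"
      using is_chartD(4)[OF ch(1)] x y ch(5) by (auto intro: subspace_diff)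
    have "integral {0..1} (\<lambda>t. F (velocity N ?\<gamma> t)) \<le> C * cdist \<kappa> x y"
    proof (rule integral_le_const_unit_interval)
      fix t :: real assume "t \<in> {0..1}"
      then show "F (velocity N ?\<gamma> t) \<le> C * cdist \<kappa> x y"
        using C[OF seg(3) seg(5) w, of t] C1(2) by (simp add: norm_minus_commute)
    qed (use \<open>C > 0\<close> in simp)
    moreover have "finsler_dist N F x y \<le> ennreal (integral {0..1} (\<lambda>t. F (velocity N ?\<gamma> t)))"
      unfolding finsler_dist_def using C1(1) seg(1,2) by (intro INF_lower) auto
    ultimately show "finsler_dist N F x y \<le> ennreal (C * cdist \<kappa> x y)"
      using ennreal_leI order_trans by blast
  qed (use ch(3) \<open>\<rho> > 0\<close> \<open>C > 0\<close> in \<open>auto simp: U_def\<close>)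
qed

section \<open>Velocities of piecewise differentiable paths and the lower bound for Finsler
  distances\<close>

lemma piecewise_C1_pathE:
  fixes N :: "('a, 'e::euclidean_space) mfd"
  assumes "piecewise_C1_path N \<gamma>"
  obtains n and s :: "nat \<Rightarrow> real" where "s 0 = 0" "s n = 1" "\<And>i. i < n \<Longrightarrow> s i < s (Suc i)"
    "\<And>i. i < n \<Longrightarrow> C1_path_on N \<gamma> (s i) (s (Suc i))"
    "\<And>i. i \<le> n \<Longrightarrow> 0 \<le> s i \<and> s i \<le> 1"
    "\<And>t. t \<in> {0..1} \<Longrightarrow> \<exists>i<n. t \<in> {s i..s (Suc i)}"
proof -
  obtain n and s :: "nat \<Rightarrow> real" where s: "s 0 = 0" "s n = 1" "\<And>i. i < n \<Longrightarrow> s i < s (Suc i)"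
    "\<And>i. i < n \<Longrightarrow> C1_path_on N \<gamma> (s i) (s (Suc i))"
    using assms unfolding piecewise_C1_path_def by blast
  have mono: "s i \<le> s j" if "i \<le> j" "j \<le> n" for i j
    using that
  proof (induction rule: dec_induct)
    case (step m)
    then show ?case using s(3)[of m] by simp
  qed simp
  show thesis
  proof (rule that[OF s])
    show "0 \<le> s i \<and> s i \<le> 1" if "i \<le> n" for i
      using mono[of 0 i] mono[of i n] that s by simp
    fix t :: real assume t: "t \<in> {0..1}"
    \<comment> \<open>The first piece whose right end is not before \<open>t\<close>; by minimality
      its left end is not after \<open>t\<close>.\<close>
    define j where "j = (LEAST j. t \<le> s (Suc j))"
    have "n > 0" using s(1,2) by (cases n) auto
    then have "t \<le> s (Suc (n - 1))" using t s(2) by simp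
    then have j: "t \<le> s (Suc j)" "j \<le> n - 1"
      unfolding j_def by (rule LeastI, rule Least_le)
    moreover have "s j \<le> t"
    proof (cases j)
      case 0 then show ?thesis using t s(1) by simp
    next
      case (Suc k)
      then have "k < (LEAST j. t \<le> s (Suc j))" by (simp flip: j_def)
      then have "\<not> t \<le> s (Suc k)"
        using not_less_Least[of k "\<lambda>j. t \<le> s (Suc j)"] by simp
      then show ?thesis using Suc by simp
    qed
    ultimately show "\<exists>i<n. t \<in> {s i..s (Suc i)}"
      using \<open>n > 0\<close> by (intro exI[of _ j]) auto
  qed
qed

lemma piecewise_C1_path_continuous:
  fixes N :: "('a, 'e::euclidean_space) mfd"
  assumes "piecewise_C1_path N \<gamma>"
  shows "continuous_map (top_of_set {0..1}) (mtop N) \<gamma>"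
proof -
  obtain n and s :: "nat \<Rightarrow> real" where s: "\<And>i. i < n \<Longrightarrow> C1_path_on N \<gamma> (s i) (s (Suc i))"
    and s01: "\<And>i. i \<le> n \<Longrightarrow> 0 \<le> s i \<and> s i \<le> 1"
    and cover: "\<And>t. t \<in> {0..1} \<Longrightarrow> \<exists>i<n. t \<in> {s i..s (Suc i)}"
    using piecewise_C1_pathE[OF assms] by metis
  have sub: "{s i..s (Suc i)} \<subseteq> {0..1}" if "i < n" for i
    using s01[of i] s01[of "Suc i"] that by auto
  show ?thesis
  proof (rule pasting_lemma_closed[where I = "{..<n}" and T = "\<lambda>i. {s i..s (Suc i)}" and f = "\<lambda>_. \<gamma>"])
    show "closedin (top_of_set {0..1}) {s i..s (Suc i)}" if "i \<in> {..<n}" for i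
      using that by (intro closed_subset sub closed_real_atLeastAtMost) simp
    show "continuous_map (subtopology (top_of_set {0..1}) {s i..s (Suc i)}) (mtop N) \<gamma>" if "i \<in> {..<n}" for i
    proof -
      have "{0..1} \<inter> {s i..s (Suc i)} = {s i..s (Suc i)}"
        using sub[of i] that by blast
      then show ?thesis
        using s[of i] that by (simp add: C1_path_on_def subtopology_subtopology del: Int_atLeastAtMost)
    qed
    show "\<exists>j. j \<in> {..<n} \<and> t \<in> {s j..s (Suc j)} \<and> \<gamma> t = \<gamma> t" if "t \<in> topspace (top_of_set {0..1})" for t
      using cover[of t] that by auto
  qed auto
qed

text \<open>At the ends of a piece \<open>velocity\<close> may be meaningless, since it
  differentiates within all of \<open>{0..1}\<close>. The field \<open>\<xi>\<close> uses one-sided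
  derivatives instead and is continuous up to the ends, which later gives integrability.\<close>

lemma C1_path_on_velocity:
  fixes N :: "('a, 'e::euclidean_space) mfd"
  assumes N: "smooth_manifold N" and \<gamma>: "C1_path_on N \<gamma> a b" and ab: "a < b" "0 \<le> a" "b \<le> 1"
  obtains \<xi> where "continuous_map (top_of_set {a..b}) (tangent_topology N) (\<lambda>t. (\<gamma> t, \<xi> t))"
    and "\<And>t. t \<in> {a..b} \<Longrightarrow> \<xi> t \<in> tangent_space N (\<gamma> t)"
    and "\<And>t \<kappa>. t \<in> {a<..<b} \<Longrightarrow> \<kappa> \<in> charts_at N (\<gamma> t) \<Longrightarrow> ((\<lambda>s. snd \<kappa> (\<gamma> s)) has_vector_derivative \<xi> t \<kappa>) (at t)"
    and "\<And>t. t \<in> {a<..<b} \<Longrightarrow> velocity N \<gamma> t = (\<gamma> t, \<xi> t)"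
proof -
  have cont: "continuous_map (top_of_set {a..b}) (mtop N) \<gamma>"
    using \<gamma> by (simp add: C1_path_on_def)
  have V: "subspace (model N)" using N by (simp add: smooth_manifold_def)
  obtain D where Dc: "\<And>\<kappa>. \<kappa> \<in> atlas N \<Longrightarrow> continuous_on ({a..b} \<inter> \<gamma> -` fst \<kappa>) (D \<kappa>)"
    and D: "\<And>\<kappa> t. \<kappa> \<in> atlas N \<Longrightarrow> t \<in> {a..b} \<inter> \<gamma> -` fst \<kappa> \<Longrightarrow>
      ((\<lambda>s. snd \<kappa> (\<gamma> s)) has_vector_derivative D \<kappa> t) (at t within {a..b})"
    using \<gamma> unfolding C1_path_on_def o_def by metis
  \<comment> \<open>The derivatives \<open>D\<close> were chosen chart by chart. Uniqueness of
    derivatives (\<open>lift\<close> below) shows that they fit together to a tangent vector; the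
    value 0 elsewhere is the convention of \<open>tangent_space\<close>.\<close>
  define \<xi> where "\<xi> t \<kappa> = (if \<kappa> \<in> charts_at N (\<gamma> t) then D \<kappa> t else 0)" for t \<kappa>
  have ev: "eventually (\<lambda>s. \<gamma> s \<in> fst \<kappa>) (at t within {a..b})" if "\<kappa> \<in> charts_at N (\<gamma> t)" "t \<in> {a..b}" for \<kappa> t
    by (rule continuous_map_eventually[OF cont charts_atD(2)[OF N that(1)] that(2) charts_atD(3)[OF N that(1)]])
  have nb: "at t within {a..b} \<noteq> bot" if "t \<in> {a..b}" for t
    using that ab(1) by (simp add: trivial_limit_within islimpt_Icc)
  have D': "((\<lambda>s. snd \<kappa> (\<gamma> s)) has_vector_derivative D \<kappa> t) (at t within {a..b})"
    if "\<kappa> \<in> charts_at N (\<gamma> t)" "t \<in> {a..b}" for t \<kappa>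
    using D that by (auto simp: charts_at_def)
  have Dmem: "D \<kappa> t \<in> model N" if \<kappa>: "\<kappa> \<in> charts_at N (\<gamma> t)" and t: "t \<in> {a..b}" for t \<kappa>
  proof (rule vector_derivative_in_subspace[OF V D'[OF that] _ t _ nb[OF t]])
    show "\<forall>\<^sub>F s in at t within {a..b}. snd \<kappa> (\<gamma> s) \<in> model N"
      using ev[OF \<kappa> t] by eventually_elim (use is_chartD(4)[OF charts_atD(1)[OF N \<kappa>]] in auto)
  qed (rule charts_atD(6)[OF N \<kappa>])
  have lift: "\<xi> t = tangent_lift N \<kappa> (\<gamma> t) (D \<kappa> t)" if \<kappa>: "\<kappa> \<in> charts_at N (\<gamma> t)" and t: "t \<in> {a..b}" for t \<kappa>
  proof
    fix \<kappa>'
    show "\<xi> t \<kappa>' = tangent_lift N \<kappa> (\<gamma> t) (D \<kappa> t) \<kappa>'"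
    proof (cases "\<kappa>' \<in> charts_at N (\<gamma> t)")
      case True
      have "((\<lambda>s. snd \<kappa>' (\<gamma> s)) has_vector_derivative tangent_lift N \<kappa> (\<gamma> t) (D \<kappa> t) \<kappa>') (at t within {a..b})"
        by (rule path_chart_derivative[where \<gamma> = \<gamma>, OF N \<kappa> True D'[OF that] t Dmem[OF that] ev[OF \<kappa> t] ev[OF True t]])
      then show ?thesis
        using vector_derivative_unique_within[OF nb[OF t] D'[OF True t]] True by (simp add: \<xi>_def)
    qed (simp add: \<xi>_def tangent_lift_def)
  qed
  have ex: "\<exists>\<kappa>. \<kappa> \<in> charts_at N (\<gamma> t)" if "t \<in> {a..b}" for t
  proof -
    have "\<gamma> t \<in> topspace (mtop N)"
      using cont that by (auto simp: continuous_map_def)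
    then show ?thesis
      using N unfolding smooth_manifold_def charts_at_def by blast
  qed
  have ts: "\<xi> t \<in> tangent_space N (\<gamma> t)" if t: "t \<in> {a..b}" for t
    using ex[OF t] lift[OF _ t] tangent_lift_in_tangent_space[OF N] Dmem[OF _ t] by metis
  have tb: "(\<gamma> t, \<xi> t) \<in> tangent_bundle N" if t: "t \<in> {a..b}" for t
    using ts[OF t] ex[OF t] charts_atD(7)[OF N] by (auto simp: tangent_bundle_def)
  have int: "((\<lambda>s. snd \<kappa> (\<gamma> s)) has_vector_derivative \<xi> t \<kappa>) (at t)" if "t \<in> {a<..<b}" "\<kappa> \<in> charts_at N (\<gamma> t)" for t \<kappa>
    using D'[OF that(2)] that by (simp add: \<xi>_def at_within_Icc_at)
  show thesis
  proof (rule that[OF _ ts int])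
    show "velocity N \<gamma> t = (\<gamma> t, \<xi> t)" if t: "t \<in> {a<..<b}" for t
    proof -
      have "vector_derivative (snd \<kappa> \<circ> \<gamma>) (at t within {0..1}) = \<xi> t \<kappa>" if "\<kappa> \<in> charts_at N (\<gamma> t)" for \<kappa>
        using int[OF t that] t ab by (intro vector_derivative_at_within_ivl) (auto simp: o_def)
      then show ?thesis by (auto simp: velocity_def \<xi>_def)
    qed
    show "continuous_map (top_of_set {a..b}) (tangent_topology N) (\<lambda>t. (\<gamma> t, \<xi> t))"
      unfolding tangent_topology_def
    proof (rule continuous_on_generated_topo)
      fix U assume "U \<in> {{(p, \<xi>) \<in> tangent_bundle N. p \<in> fst \<kappa> \<and> (snd \<kappa> p, \<xi> \<kappa>) \<in> W} | \<kappa> W. \<kappa> \<in> atlas N \<and> open W}"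
      then obtain \<kappa> W where \<kappa>: "\<kappa> \<in> atlas N" and W: "open W"
        and U: "U = {(p, \<xi>) \<in> tangent_bundle N. p \<in> fst \<kappa> \<and> (snd \<kappa> p, \<xi> \<kappa>) \<in> W}"
        by blast
      let ?T = "{a..b} \<inter> \<gamma> -` fst \<kappa>"
      have "is_chart (mtop N) (model N) \<kappa>" using N \<kappa> by (simp add: smooth_manifold_def)
      from openin_continuous_map_preimage[OF cont is_chartD(1)[OF this]]
      have To: "openin (top_of_set {a..b}) ?T"
        by (simp add: Int_def vimage_def)
      have "continuous_on ?T (\<lambda>t. snd \<kappa> (\<gamma> t))"
        unfolding continuous_on_eq_continuous_within
      proof
        fix t assume t: "t \<in> ?T"
        then have "continuous (at t within {a..b}) (\<lambda>s. snd \<kappa> (\<gamma> s))"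
          using D[OF \<kappa> t] has_vector_derivative_continuous by blast
        then show "continuous (at t within ?T) (\<lambda>s. snd \<kappa> (\<gamma> s))"
          by (rule continuous_within_subset) auto
      qed
      then have "continuous_on ?T (\<lambda>t. (snd \<kappa> (\<gamma> t), D \<kappa> t))"
        by (intro continuous_on_Pair Dc[OF \<kappa>])
      then have "openin (top_of_set ?T) (?T \<inter> (\<lambda>t. (snd \<kappa> (\<gamma> t), D \<kappa> t)) -` W)"
        using W by (rule continuous_openin_preimage_gen)
      then have "openin (top_of_set {a..b}) (?T \<inter> (\<lambda>t. (snd \<kappa> (\<gamma> t), D \<kappa> t)) -` W)"
        using To by (rule openin_trans)
      moreover have "(\<lambda>t. (\<gamma> t, \<xi> t)) -` U \<inter> topspace (top_of_set {a..b}) = ?T \<inter> (\<lambda>t. (snd \<kappa> (\<gamma> t), D \<kappa> t)) -` W"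
        using tb \<kappa> by (auto simp: U \<xi>_def charts_at_def)
      ultimately show "openin (top_of_set {a..b}) ((\<lambda>t. (\<gamma> t, \<xi> t)) -` U \<inter> topspace (top_of_set {a..b}))"
        by simp
    next
      show "(\<lambda>t. (\<gamma> t, \<xi> t)) ` topspace (top_of_set {a..b}) \<subseteq>
        \<Union>{{(p, \<xi>) \<in> tangent_bundle N. p \<in> fst \<kappa> \<and> (snd \<kappa> p, \<xi> \<kappa>) \<in> W} | \<kappa> W. \<kappa> \<in> atlas N \<and> open W}"
      proof (rule image_subsetI)
        fix t assume "t \<in> topspace (top_of_set {a..b})"
        then have t: "t \<in> {a..b}" by simp
        obtain \<kappa> where \<kappa>: "\<kappa> \<in> charts_at N (\<gamma> t)" using ex[OF t] by blast
        have "(\<gamma> t, \<xi> t) \<in> {(p, \<xi>) \<in> tangent_bundle N. p \<in> fst \<kappa> \<and> (snd \<kappa> p, \<xi> \<kappa>) \<in> UNIV}"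
          using tb[OF t] charts_atD(3)[OF N \<kappa>] by simp
        then show "(\<gamma> t, \<xi> t) \<in> \<Union>{{(p, \<xi>) \<in> tangent_bundle N. p \<in> fst \<kappa> \<and> (snd \<kappa> p, \<xi> \<kappa>) \<in> W} | \<kappa> W. \<kappa> \<in> atlas N \<and> open W}"
          using charts_atD(4)[OF N \<kappa>] open_UNIV by blast
      qed
    qed
  qed
qed

text \<open>On each piece the integrand agrees with a continuous function except at the two ends.
  Integrability matters for the lower bound: otherwise the value 0 of an undefined integral could
  undercut it.\<close>

lemma piecewise_C1_path_velocity:
  fixes N :: "('a, 'e::euclidean_space) mfd"
  assumes N: "smooth_manifold N" and \<gamma>: "piecewise_C1_path N \<gamma>" and F: "finsler_metric N F"
  obtains T and \<xi> :: "real \<Rightarrow> ('a, 'e) chart \<Rightarrow> 'e" where "finite T"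
    "\<And>t. t \<in> {0..1} - T \<Longrightarrow> \<xi> t \<in> tangent_space N (\<gamma> t)"
    "\<And>t \<kappa>. t \<in> {0..1} - T \<Longrightarrow> \<kappa> \<in> charts_at N (\<gamma> t) \<Longrightarrow> ((\<lambda>s. snd \<kappa> (\<gamma> s)) has_vector_derivative \<xi> t \<kappa>) (at t)"
    "\<And>t. t \<in> {0..1} - T \<Longrightarrow> velocity N \<gamma> t = (\<gamma> t, \<xi> t)"
    "(\<lambda>t. F (velocity N \<gamma> t)) integrable_on {0..1}"
proof -
  obtain n and s :: "nat \<Rightarrow> real" where s0: "s 0 = 0" "s n = 1" and sm: "\<And>i. i < n \<Longrightarrow> s i < s (Suc i)"
    and s: "\<And>i. i < n \<Longrightarrow> C1_path_on N \<gamma> (s i) (s (Suc i))"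
    and s01: "\<And>i. i \<le> n \<Longrightarrow> 0 \<le> s i \<and> s i \<le> 1"
    and cover: "\<And>t. t \<in> {0..1} \<Longrightarrow> \<exists>i<n. t \<in> {s i..s (Suc i)}"
    using piecewise_C1_pathE[OF \<gamma>] by metis
  define P where "P i \<xi> \<longleftrightarrow> continuous_map (top_of_set {s i..s (Suc i)}) (tangent_topology N) (\<lambda>t. (\<gamma> t, \<xi> t)) \<and>
      (\<forall>t\<in>{s i..s (Suc i)}. \<xi> t \<in> tangent_space N (\<gamma> t)) \<and>
      (\<forall>t\<in>{s i<..<s (Suc i)}. \<forall>\<kappa>\<in>charts_at N (\<gamma> t). ((\<lambda>s. snd \<kappa> (\<gamma> s)) has_vector_derivative \<xi> t \<kappa>) (at t)) \<and>
      (\<forall>t\<in>{s i<..<s (Suc i)}. velocity N \<gamma> t = (\<gamma> t, \<xi> t))" for i \<xi>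
  have "\<exists>\<xi>. P i \<xi>" if i: "i < n" for i
    unfolding P_def
    by (rule C1_path_on_velocity[OF N s[OF i] sm[OF i]]) (use s01[of i] s01[of "Suc i"] i in auto)
  then obtain \<xi> where P: "\<And>i. i < n \<Longrightarrow> P i (\<xi> i)"
    by metis
  have \<xi>c: "\<And>i. i < n \<Longrightarrow> continuous_map (top_of_set {s i..s (Suc i)}) (tangent_topology N) (\<lambda>t. (\<gamma> t, \<xi> i t))"
    and \<xi>t: "\<And>i t. i < n \<Longrightarrow> t\<in>{s i..s (Suc i)} \<Longrightarrow> \<xi> i t \<in> tangent_space N (\<gamma> t)"
    and \<xi>d: "\<And>i t \<kappa>. i < n \<Longrightarrow> t\<in>{s i<..<s (Suc i)} \<Longrightarrow> \<kappa>\<in>charts_at N (\<gamma> t) \<Longrightarrow> ((\<lambda>s. snd \<kappa> (\<gamma> s)) has_vector_derivative \<xi> i t \<kappa>) (at t)"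
    and \<xi>v: "\<And>i t. i < n \<Longrightarrow> t\<in>{s i<..<s (Suc i)} \<Longrightarrow> velocity N \<gamma> t = (\<gamma> t, \<xi> i t)"
    using P unfolding P_def by blast+
  define T where "T = s ` {..n}"
  have idx: "\<exists>i<n. t \<in> {s i<..<s (Suc i)}" if t: "t \<in> {0..1} - T" for t
  proof -
    obtain i where i: "i < n" "t \<in> {s i..s (Suc i)}" using cover t by blast
    have "t \<noteq> s i" "t \<noteq> s (Suc i)" using t i(1) unfolding T_def by auto
    then show ?thesis using i by (intro exI[of _ i]) auto
  qed
  have piece: "(\<lambda>t. F (velocity N \<gamma> t)) integrable_on {s i..s (Suc i)}" if i: "i < n" for i
  proof (rule integrable_spike_finite[of "{s i, s (Suc i)}"])
    have "continuous_map (top_of_set {s i..s (Suc i)}) euclideanreal (F \<circ> (\<lambda>t. (\<gamma> t, \<xi> i t)))"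
      using F \<xi>c[OF i] unfolding finsler_metric_def by (blast intro: continuous_map_compose)
    then show "(\<lambda>t. F (\<gamma> t, \<xi> i t)) integrable_on {s i..s (Suc i)}"
      by (intro integrable_continuous_real) (simp add: o_def)
    show "F (velocity N \<gamma> t) = F (\<gamma> t, \<xi> i t)" if "t \<in> {s i..s (Suc i)} - {s i, s (Suc i)}" for t
      using \<xi>v[OF i, of t] that by auto
  qed simp
  have "(\<lambda>t. F (velocity N \<gamma> t)) integrable_on {0..s i}" if "i \<le> n" for i
    using that
  proof (induction i)
    case (Suc i)
    then show ?case
      using s01[of i] sm[of i] by (intro Henstock_Kurzweil_Integration.integrable_combine[OF _ _ _ piece[of i]]) auto
  qed (simp add: s0 integrable_on_refl[of _ 0, simplified])
  then have int: "(\<lambda>t. F (velocity N \<gamma> t)) integrable_on {0..1}"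
    using s0(2) by (metis order_refl)
  \<comment> \<open>The fields of the pieces are combined by choosing, away from the break points, a
    piece with \<open>t\<close> in its interior.\<close>
  define \<xi>' where "\<xi>' t = \<xi> (SOME i. i < n \<and> t \<in> {s i<..<s (Suc i)}) t" for t
  have pick: "\<exists>i. i < n \<and> t \<in> {s i<..<s (Suc i)} \<and> \<xi>' t = \<xi> i t" if t: "t \<in> {0..1} - T" for t
    using someI_ex[OF idx[OF t, unfolded Bex_def]] unfolding \<xi>'_def by blast
  show thesis
  proof (rule that[of T \<xi>', OF _ _ _ _ int])
    fix t assume t: "t \<in> {0..1} - T"
    obtain i where i: "i < n" "t \<in> {s i<..<s (Suc i)}" "\<xi>' t = \<xi> i t" using pick[OF t] by blast
    show "\<xi>' t \<in> tangent_space N (\<gamma> t)" using \<xi>t[OF i(1), of t] i by auto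
    show "velocity N \<gamma> t = (\<gamma> t, \<xi>' t)" using \<xi>v[OF i(1,2)] i(3) by simp
    show "((\<lambda>s. snd \<kappa> (\<gamma> s)) has_vector_derivative \<xi>' t \<kappa>) (at t)" if "\<kappa> \<in> charts_at N (\<gamma> t)" for \<kappa>
      using \<xi>d[OF i(1,2) that] i(3) by simp
  qed (simp add: T_def)
qed

lemma finsler_nonneg:
  assumes "finsler_metric N F" "p \<in> topspace (mtop N)" "\<xi> \<in> tangent_space N p"
  shows "0 \<le> F (p, \<xi>)"
  using assms unfolding finsler_metric_def by blast

text \<open>As long as a path stays in a small compact set, its length is at least \<open>c\<close>
  times its coordinate displacement, by the fundamental theorem of calculus. A path that leaves is
  long already at the exit time, so it cannot be a shortcut.\<close>

lemma finsler_dist_chart_lower: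
  fixes N :: "('a, 'e::euclidean_space) mfd"
  assumes N: "smooth_manifold N" and F: "finsler_metric N F" and \<kappa>: "\<kappa> \<in> charts_at N p"
  obtains U c where "openin (mtop N) U" "p \<in> U" "U \<subseteq> fst \<kappa>" "c > 0"
    "\<And>x y. x \<in> U \<Longrightarrow> y \<in> U \<Longrightarrow> ennreal (c * cdist \<kappa> x y) \<le> finsler_dist N F x y"
proof -
  note ch = charts_atD[OF N \<kappa>]
  let ?V = "model N"
  obtain \<rho> c C where "\<rho> > 0" "c > 0"
    and \<rho>: "\<And>z. z \<in> ?V \<Longrightarrow> z \<in> cball (snd \<kappa> p) \<rho> \<Longrightarrow> z \<in> snd \<kappa> ` fst \<kappa>"
    and cC: "\<And>x v. x \<in> fst \<kappa> \<Longrightarrow> snd \<kappa> x \<in> cball (snd \<kappa> p) \<rho> \<Longrightarrow> v \<in> ?V \<Longrightarrow>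
      c * norm v \<le> F (x, tangent_lift N \<kappa> x v) \<and> F (x, tangent_lift N \<kappa> x v) \<le> C * norm v"
    using finsler_lift_bounds[OF N F \<kappa>] by metis
  define B where "B r = {x \<in> fst \<kappa>. snd \<kappa> x \<in> ball (snd \<kappa> p) r}" for r
  have Bo: "openin (mtop N) (B r)" for r
    unfolding B_def by (rule is_chart_preimage_open[OF ch(1) open_ball])
  define K where "K = {x \<in> fst \<kappa>. snd \<kappa> x \<in> cball (snd \<kappa> p) (\<rho>/2)}"
  have half: "cball (snd \<kappa> p) (\<rho>/2) \<subseteq> cball (snd \<kappa> p) \<rho>"
    using \<open>\<rho> > 0\<close> by (intro subset_cball) simp
  have "compactin (mtop N) K"
    unfolding K_def using \<rho> half by (intro compactin_chart_cball[OF ch(1,5)]) blast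
  then have Kc: "closedin (mtop N) K"
    using N by (intro compactin_imp_closedin) (auto simp: smooth_manifold_def)
  have BK: "B (\<rho>/2) \<subseteq> K"
    by (auto simp: K_def B_def)
  have K: "x \<in> fst \<kappa> \<and> snd \<kappa> x \<in> cball (snd \<kappa> p) (\<rho>/2)" if "x \<in> K" for x
    using that by (simp add: K_def)
  show thesis
  \<comment> \<open>Two points of \<open>B (\<rho>/8)\<close> are less than \<open>\<rho>/4\<close>
    apart, whereas a path from there to the boundary of \<open>B (\<rho>/2)\<close> is displaced by
    more than \<open>3 * \<rho>/8\<close>.\<close>
  proof (rule that[of "B (\<rho>/8)" c])
    show "openin (mtop N) (B (\<rho>/8))" by (rule Bo)
  next
    fix x y assume x: "x \<in> B (\<rho>/8)" and y: "y \<in> B (\<rho>/8)"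
    have "c * cdist \<kappa> x y \<le> integral {0..1} (\<lambda>t. F (velocity N \<gamma> t))"
      if \<gamma>: "piecewise_C1_path N \<gamma>" "\<gamma> 0 = x" "\<gamma> 1 = y" for \<gamma>
    proof -
      let ?F = "\<lambda>t. F (velocity N \<gamma> t)"
      have \<gamma>c: "continuous_map (top_of_set {0..1}) (mtop N) \<gamma>"
        by (rule piecewise_C1_path_continuous[OF \<gamma>(1)])
      obtain T and \<xi> :: "real \<Rightarrow> ('a, 'e) chart \<Rightarrow> 'e" where T: "finite T"
        and \<xi>t: "\<And>t. t \<in> {0..1} - T \<Longrightarrow> \<xi> t \<in> tangent_space N (\<gamma> t)"
        and \<xi>d: "\<And>t \<kappa>. t \<in> {0..1} - T \<Longrightarrow> \<kappa> \<in> charts_at N (\<gamma> t) \<Longrightarrow> ((\<lambda>s. snd \<kappa> (\<gamma> s)) has_vector_derivative \<xi> t \<kappa>) (at t)"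
        and \<xi>v: "\<And>t. t \<in> {0..1} - T \<Longrightarrow> velocity N \<gamma> t = (\<gamma> t, \<xi> t)"
        and int: "?F integrable_on {0..1}"
        using piecewise_C1_path_velocity[OF N \<gamma>(1) F] by metis
      have top: "\<gamma> t \<in> topspace (mtop N)" if "t \<in> {0..1}" for t
        using \<gamma>c that by (auto simp: continuous_map_def)
      \<comment> \<open>At the points of \<open>T\<close> the velocity need not be tangent and
        \<open>F\<close> could be negative there. Setting these values to 0 gives a nonnegative
        integrand with the same integral.\<close>
      define G where "G t = (if t \<in> T then 0 else ?F t)" for t
      have Gint: "G integrable_on {0..1}"
        by (rule integrable_spike_finite[OF T _ int]) (simp add: G_def)
      have GF: "integral {0..1} G = integral {0..1} ?F"
        by (rule integral_spike[OF negligible_finite[OF T]]) (simp add: G_def)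
      have G0: "G t \<ge> 0" if "t \<in> {0..1}" for t
        using finsler_nonneg[OF F top[OF that] \<xi>t[of t]] \<xi>v[of t] that by (auto simp: G_def)
      \<comment> \<open>Applied with \<open>b = 1\<close> to a path that stays inside, and with the
        first exit time to one that does not.\<close>
      have up_to: "c * cdist \<kappa> (\<gamma> b) x \<le> integral {0..1} G"
        if b: "0 \<le> b" "b \<le> 1" and inK: "\<And>t. t \<in> {0..b} \<Longrightarrow> \<gamma> t \<in> K" for b
      proof -
        have at: "\<kappa> \<in> charts_at N (\<gamma> t)" if "t \<in> {0..b}" for t
          using K[OF inK[OF that]] ch(4) by (simp add: charts_at_def)
        define f' where "f' t = (if t \<in> T then 0 else \<xi> t \<kappa>)" for t
        have "(f' has_integral (snd \<kappa> (\<gamma> b) - snd \<kappa> (\<gamma> 0))) {0..b}"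
        proof (rule fundamental_theorem_of_calculus_interior_strong[OF T b(1)])
          show "((\<lambda>t. snd \<kappa> (\<gamma> t)) has_vector_derivative f' t) (at t)" if "t \<in> {0<..<b} - T" for t
            using \<xi>d[OF _ at, of t] that b by (simp add: f'_def)
          have "continuous_map (top_of_set {0..b}) (subtopology (mtop N) (fst \<kappa>)) \<gamma>"
            using continuous_map_from_subtopology_mono[OF \<gamma>c, of "{0..b}"] b K inK
            by (auto simp: continuous_map_in_subtopology)
          from continuous_map_compose[OF this is_chart_continuous[OF ch(1)]]
          show "continuous_on {0..b} (\<lambda>t. snd \<kappa> (\<gamma> t))"
            by (simp add: continuous_map_in_subtopology o_def)
        qed
        then have f': "f' integrable_on {0..b}" "integral {0..b} f' = snd \<kappa> (\<gamma> b) - snd \<kappa> x"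
          using \<gamma>(2) by (auto simp: has_integral_iff)
        have Gb: "G integrable_on {0..b}"
          using integrable_subinterval_real[OF Gint] b by simp
        have le: "norm (f' t) \<le> G t / c" if t: "t \<in> {0..b}" for t
        proof (cases "t \<in> T")
          case False
          then have t': "t \<in> {0..1} - T" using t b by auto
          have mem: "\<xi> t \<kappa> \<in> ?V"
            using \<xi>t[OF t'] at[OF t] unfolding tangent_space_def by blast
          have "c * norm (\<xi> t \<kappa>) \<le> F (\<gamma> t, tangent_lift N \<kappa> (\<gamma> t) (\<xi> t \<kappa>))"
            using cC[OF _ _ mem, of "\<gamma> t"] K[OF inK[OF t]] half by blast
          also have "\<dots> = F (\<gamma> t, \<xi> t)"
            by (simp only: tangent_space_eq_lift[OF \<xi>t[OF t'] at[OF t], symmetric])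
          finally have "c * norm (\<xi> t \<kappa>) \<le> F (\<gamma> t, \<xi> t)" .
          then show ?thesis
            using False \<xi>v[OF t'] \<open>c > 0\<close> by (simp add: f'_def G_def field_simps)
        qed (simp add: f'_def G_def)
        have "norm (integral {0..b} f') \<le> integral {0..b} (\<lambda>t. G t / c)"
          by (rule Henstock_Kurzweil_Integration.integral_norm_bound_integral[OF f'(1) _ le])
            (use integrable_on_divide[OF Gb] in simp)
        also have "\<dots> = integral {0..b} G / c" by simp
        also have "\<dots> \<le> integral {0..1} G / c"
          using \<open>c > 0\<close> b G0 by (intro divide_right_mono integral_subset_le[OF _ Gb Gint]) auto
        finally show ?thesis
          using f'(2) \<open>c > 0\<close> by (simp add: field_simps)
      qed
      \<comment> \<open>The parameters outside the open ball form a closed set, so a first exit time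
        exists.\<close>
      define E where "E = {t \<in> {0..1}. \<gamma> t \<notin> B (\<rho>/2)}"
      show ?thesis
      proof (cases "E = {}")
        case True
        then have "\<gamma> t \<in> K" if "t \<in> {0..1}" for t
          using that BK by (auto simp: E_def)
        then show ?thesis
          using up_to[of 1] \<gamma>(3) GF by (simp add: norm_minus_commute)
      next
        case False
        have "openin (top_of_set {0..1}) {t \<in> {0..1}. \<gamma> t \<in> B (\<rho>/2)}"
          using openin_continuous_map_preimage[OF \<gamma>c Bo] by simp
        moreover have "{0..1} - {t \<in> {0..1}. \<gamma> t \<in> B (\<rho>/2)} = E"
          by (auto simp: E_def)
        ultimately have "closed E"
          by (metis closed_atLeastAtMost closedin_closed_trans closedin_diff closedin_subtopology_refl topspace_euclidean_subtopology subset_UNIV topspace_euclidean)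
        define b where "b = Inf E"
        have bdd: "bdd_below E" by (auto simp: E_def intro: bdd_belowI[of _ 0])
        have bE: "b \<in> E"
          unfolding b_def using closed_contains_Inf[OF False bdd \<open>closed E\<close>] .
        then have b: "0 \<le> b" "b \<le> 1" "\<gamma> b \<notin> B (\<rho>/2)" by (auto simp: E_def)
        have before: "\<gamma> t \<in> K" if "0 \<le> t" "t < b" for t
        proof -
          have "t \<notin> E" using cInf_lower[OF _ bdd, of t] that by (auto simp: b_def)
          then show ?thesis using that b BK by (auto simp: E_def)
        qed
        have "x \<in> B (\<rho>/2)" using x \<open>\<rho> > 0\<close> by (auto simp: B_def)
        then have "b > 0" using b \<gamma>(2) by (cases "b = 0") auto
        \<comment> \<open>The path could leave the chart domain at the very moment \<open>b\<close>.
          This is excluded because \<open>K\<close>, compact in a Hausdorff space, is closed in the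
          whole manifold and contains the path just before \<open>b\<close>.\<close>
        have "\<gamma> b \<in> K"
        proof (rule ccontr)
          assume "\<gamma> b \<notin> K"
          then have "eventually (\<lambda>s. \<gamma> s \<in> topspace (mtop N) - K) (at b within {0..1})"
            using continuous_map_eventually[OF \<gamma>c, of "topspace (mtop N) - K" b] Kc top[of b] b by auto
          then obtain e where e: "e > 0" "\<And>s. s \<in> {0..1} \<Longrightarrow> s \<noteq> b \<Longrightarrow> dist s b < e \<Longrightarrow> \<gamma> s \<notin> K"
            unfolding eventually_at by auto
          define s where "s = max 0 (b - e/2)"
          have "0 \<le> s" "s < b" "dist s b < e"
            using \<open>b > 0\<close> e(1) by (auto simp: s_def dist_real_def)
          then show False using before[of s] e(2)[of s] b by simp
        qed
        then have Kb: "\<gamma> t \<in> K" if "t \<in> {0..b}" for t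
          using before[of t] that by (cases "t = b") auto
        have "dist (snd \<kappa> p) (snd \<kappa> (\<gamma> b)) \<ge> \<rho>/2"
          using b(3) K[OF \<open>\<gamma> b \<in> K\<close>] by (simp add: B_def)
        moreover have "dist (snd \<kappa> p) (snd \<kappa> x) < \<rho>/8" "dist (snd \<kappa> p) (snd \<kappa> y) < \<rho>/8"
          using x y by (auto simp: B_def)
        moreover have "cdist \<kappa> x y \<le> dist (snd \<kappa> p) (snd \<kappa> x) + dist (snd \<kappa> p) (snd \<kappa> y)"
          by (metis dist_norm dist_triangle3)
        moreover have "dist (snd \<kappa> p) (snd \<kappa> (\<gamma> b)) \<le> dist (snd \<kappa> p) (snd \<kappa> x) + cdist \<kappa> (\<gamma> b) x"
          by (metis dist_norm dist_commute dist_triangle)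
        ultimately have "cdist \<kappa> x y \<le> cdist \<kappa> (\<gamma> b) x"
          using \<open>\<rho> > 0\<close> by linarith
        then have "c * cdist \<kappa> x y \<le> c * cdist \<kappa> (\<gamma> b) x"
          using \<open>c > 0\<close> by simp
        also have "\<dots> \<le> integral {0..1} G"
          by (rule up_to[OF b(1,2) Kb])
        finally show ?thesis using GF by simp
      qed
    qed
    then show "ennreal (c * cdist \<kappa> x y) \<le> finsler_dist N F x y"
      unfolding finsler_dist_def by (intro INF_greatest) (auto intro: ennreal_leI)
  qed (use ch(3) \<open>\<rho> > 0\<close> \<open>c > 0\<close> in \<open>auto simp: B_def\<close>)
qed

section \<open>Invariant metrics on homogeneous spaces\<close>

lemma continuous_map_into_real_iff_local:
  "continuous_map T euclideanreal f \<longleftrightarrow>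
    (\<forall>x\<in>topspace T. \<forall>e>0. \<exists>U. openin T U \<and> x \<in> U \<and> (\<forall>y\<in>U. \<bar>f y - f x\<bar> < e))"
  using Met_TC.continuous_map_to_metric[of T f]
  by (simp add: dist_real_def abs_minus_commute)

lemma prod_nbhd:
  assumes "continuous_map (prod_topology S T) Z (\<lambda>(x, y). f x y)" "openin Z W"
    and "a \<in> topspace S" "b \<in> topspace T" "f a b \<in> W"
  obtains U1 U2 where "openin S U1" "a \<in> U1" "openin T U2" "b \<in> U2"
    "\<And>x y. x \<in> U1 \<Longrightarrow> y \<in> U2 \<Longrightarrow> f x y \<in> W"
proof -
  have "openin (prod_topology S T) {p \<in> topspace (prod_topology S T). (\<lambda>(x, y). f x y) p \<in> W}" (is "openin _ ?O")
    using assms(1,2) by (rule openin_continuous_map_preimage)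
  moreover have "(a, b) \<in> ?O" using assms by simp
  ultimately obtain U1 U2 where "openin S U1" "a \<in> U1" "openin T U2" "b \<in> U2" and "U1 \<times> U2 \<subseteq> ?O"
    unfolding openin_prod_topology_alt by blast
  show thesis
  proof (rule that[OF \<open>openin S U1\<close> \<open>a \<in> U1\<close> \<open>openin T U2\<close> \<open>b \<in> U2\<close>])
    fix x y assume "x \<in> U1" "y \<in> U2"
    then have "(x, y) \<in> ?O"
      using \<open>U1 \<times> U2 \<subseteq> ?O\<close> by blast
    then show "f x y \<in> W" by simp
  qed
qed

lemma chart_exists:
  assumes "smooth_manifold N" "p \<in> topspace (mtop N)"
  obtains \<kappa> where "\<kappa> \<in> charts_at N p"
  using assms unfolding smooth_manifold_def charts_at_def by blast

no_notation subset_mset (infix \<open><#\<close> 50)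

text \<open>Keeps of \<open>M\<close> and \<open>X\<close> only what the comparison with charts
  uses: a finite invariant metric on \<open>G/H\<close> with a Lipschitz bound at the base point in
  a chart of \<open>G\<close>. The constant \<open>L\<close> may have either sign, hence
  \<open>\<bar>L\<bar> + 1\<close> in later estimates.\<close>

locale homogeneous_metric = group G for G (structure) +
  fixes GM :: "('a, 'e::euclidean_space) mfd" and H :: "'a set"
    and Q :: "('a set, 'h::euclidean_space) mfd" and D :: "'a set \<Rightarrow> 'a set \<Rightarrow> real"
  assumes lie: "lie_group G GM" and H: "subgroup H G" and homog: "homogeneous_space G GM H Q"
    and D_metric: "Metric_space (lcosets H) D"
    and D_inv: "\<And>g P R. g \<in> carrier G \<Longrightarrow> P \<in> lcosets H \<Longrightarrow> R \<in> lcosets H \<Longrightarrow> D (g <# P) (g <# R) = D P R"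
    and D_lip: "\<exists>c\<in>charts_at GM \<one>. \<exists>L U. openin (mtop GM) U \<and> \<one> \<in> U \<and> U \<subseteq> fst c \<and>
      (\<forall>g\<in>U. D H (g <# H) \<le> L * cdist c g \<one>)"
begin

lemma smooth_GM: "smooth_manifold GM" and topGM [simp]: "topspace (mtop GM) = carrier G"
  and smooth_mult: "smooth_map (prod_mfd GM GM) GM (\<lambda>(g, h). g \<otimes> h)"
  and smooth_inv: "smooth_map GM GM (\<lambda>g. inv g)"
  using lie by (auto simp: lie_group_def)

lemma smooth_Q: "smooth_manifold Q" and topQ [simp]: "topspace (mtop Q) = lcosets H"
  and quot: "quotient_map (mtop GM) (mtop Q) (\<lambda>g. g <# H)"
  and smooth_act: "smooth_map (prod_mfd GM Q) Q (\<lambda>(g, P). g <# P)"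
  using homog by (auto simp: homogeneous_space_def)

lemma lcGM: "locally_charted GM" and lcQ: "locally_charted Q"
  using smooth_GM smooth_Q smooth_manifold_imp_locally_charted by blast+

lemma Hsub: "H \<subseteq> carrier G"
  using H by (rule subgroup.subset)

lemma Hmem: "h \<in> H \<Longrightarrow> h \<in> carrier G"
  using Hsub by blast

lemma coset_in [simp, intro]: "g \<in> carrier G \<Longrightarrow> g <# H \<in> lcosets H"
  unfolding LCOSETS_def by blast

lemma lcosetsE:
  assumes "P \<in> lcosets H"
  obtains g where "g \<in> carrier G" "P = g <# H"
  using assms unfolding LCOSETS_def by blast

lemma one_coset [simp]: "\<one> <# H = H"
  by (rule lcos_mult_one[OF Hsub])

lemma H_in [simp, intro]: "H \<in> lcosets H"
  using coset_in[OF one_closed] by simp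

lemma act_coset: "g \<in> carrier G \<Longrightarrow> h \<in> carrier G \<Longrightarrow> g <# (h <# H) = (g \<otimes> h) <# H"
  by (rule lcos_m_assoc[OF Hsub])

lemma act_in [simp, intro]: "g \<in> carrier G \<Longrightarrow> P \<in> lcosets H \<Longrightarrow> g <# P \<in> lcosets H"
  by (elim lcosetsE) (simp add: act_coset)

lemma act_act: "g \<in> carrier G \<Longrightarrow> h \<in> carrier G \<Longrightarrow> P \<in> lcosets H \<Longrightarrow> g <# (h <# P) = (g \<otimes> h) <# P"
  by (elim lcosetsE) (simp add: act_coset m_assoc)

lemma act_one [simp]: "P \<in> lcosets H \<Longrightarrow> \<one> <# P = P"
  by (elim lcosetsE) (simp add: act_coset)

lemma act_inv [simp]: "g \<in> carrier G \<Longrightarrow> P \<in> lcosets H \<Longrightarrow> inv g <# (g <# P) = P"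
  "g \<in> carrier G \<Longrightarrow> P \<in> lcosets H \<Longrightarrow> g <# (inv g <# P) = P"
  by (simp_all add: act_act)

lemma coset_eq_H_iff: "g \<in> carrier G \<Longrightarrow> g <# H = H \<longleftrightarrow> g \<in> H"
  using coset_join3[OF _ H] lcos_self[OF _ H] by metis

lemma coset_mult_H: "g \<in> carrier G \<Longrightarrow> h \<in> H \<Longrightarrow> (g \<otimes> h) <# H = g <# H"
  using act_coset[of g h] coset_eq_H_iff[of h] Hmem by simp

lemma D_nonneg [simp]: "0 \<le> D P R" and D_commute: "D P R = D R P"
    and D_zero: "P \<in> lcosets H \<Longrightarrow> R \<in> lcosets H \<Longrightarrow> D P R = 0 \<longleftrightarrow> P = R"
    and D_triangle: "P \<in> lcosets H \<Longrightarrow> R \<in> lcosets H \<Longrightarrow> S \<in> lcosets H \<Longrightarrow> D P S \<le> D P R + D R S"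
  using D_metric by (auto simp: Metric_space_def)

lemma cont_mult: "continuous_map (prod_topology (mtop GM) (mtop GM)) (mtop GM) (\<lambda>(g, h). g \<otimes> h)"
  using smooth_mult by (simp add: smooth_map_def prod_mfd_def)

lemma cont_inv: "continuous_map (mtop GM) (mtop GM) (\<lambda>g. inv g)"
  using smooth_inv by (simp add: smooth_map_def)

lemma cont_act: "continuous_map (prod_topology (mtop GM) (mtop Q)) (mtop Q) (\<lambda>(g, P). g <# P)"
  using smooth_act by (simp add: smooth_map_def prod_mfd_def)

lemma cont_coset: "continuous_map (mtop GM) (mtop Q) (\<lambda>g. g <# H)"
  using quot by (rule quotient_imp_continuous_map)

lemma cont_act_left: "g \<in> carrier G \<Longrightarrow> continuous_map (mtop Q) (mtop Q) (\<lambda>P. g <# P)"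
  using continuous_map_compose[OF _ cont_act, of "mtop Q" "\<lambda>P. (g, P)"]
  by (simp add: continuous_map_pairedI o_def)

lemma cont_inv_act: "continuous_map (prod_topology (mtop GM) (mtop Q)) (mtop Q) (\<lambda>(g, P). inv g <# P)"
proof -
  have "continuous_map (prod_topology (mtop GM) (mtop Q)) (prod_topology (mtop GM) (mtop Q)) (\<lambda>p. (inv (fst p), snd p))"
    using continuous_map_compose[OF continuous_map_fst cont_inv]
    by (intro continuous_map_pairedI continuous_map_snd) (simp add: o_def)
  from continuous_map_compose[OF this cont_act] show ?thesis
    by (simp add: o_def case_prod_unfold)
qed

lemma cont_right_mult: "h \<in> carrier G \<Longrightarrow> continuous_map (mtop GM) (mtop GM) (\<lambda>g. g \<otimes> h)"
  using continuous_map_compose[OF _ cont_mult, of "mtop GM" "\<lambda>g. (g, h)"]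
  by (simp add: continuous_map_pairedI o_def)

lemma cont_left_mult: "h \<in> carrier G \<Longrightarrow> continuous_map (mtop GM) (mtop GM) (\<lambda>g. h \<otimes> g)"
  using continuous_map_compose[OF _ cont_mult, of "mtop GM" "\<lambda>g. (h, g)"]
  by (simp add: continuous_map_pairedI o_def)

lemma cont_mult_inv: "continuous_map (prod_topology (mtop GM) (mtop GM)) (mtop GM) (\<lambda>(g, h). g \<otimes> inv h)"
proof -
  have "continuous_map (prod_topology (mtop GM) (mtop GM)) (prod_topology (mtop GM) (mtop GM)) (\<lambda>p. (fst p, inv (snd p)))"
    using continuous_map_compose[OF continuous_map_snd cont_inv]
    by (intro continuous_map_pairedI continuous_map_fst) (simp add: o_def)
  from continuous_map_compose[OF this cont_mult] show ?thesis
    by (simp add: o_def case_prod_unfold)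
qed

lemma open_act:
  assumes "g \<in> carrier G" "openin (mtop Q) U"
  shows "openin (mtop Q) ((\<lambda>P. g <# P) ` U)"
proof -
  have "(\<lambda>P. g <# P) ` U = {P \<in> topspace (mtop Q). inv g <# P \<in> U}"
    using openin_subset[OF assms(2)] assms(1) by (auto simp: subset_iff intro!: image_eqI[of _ _ "inv g <# _"])
  then show ?thesis
    using openin_continuous_map_preimage[OF cont_act_left[OF inv_closed[OF assms(1)]] assms(2)] by simp
qed

text \<open>The preimage of the image, \<open>W\<close> times \<open>H\<close>, is a union of right
  translates of \<open>W\<close> and therefore open; a quotient map detects openness by
  preimages.\<close>

lemma open_coset_image:
  assumes W: "openin (mtop GM) W"
  shows "openin (mtop Q) ((\<lambda>g. g <# H) ` W)"
proof -
  have sub: "W \<subseteq> carrier G" using openin_subset[OF W] by simp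
  have "{g \<in> topspace (mtop GM). g <# H \<in> (\<lambda>g. g <# H) ` W} = (\<Union>h\<in>H. {g \<in> topspace (mtop GM). g \<otimes> h \<in> W})"
  proof safe
    fix g w assume g: "g \<in> topspace (mtop GM)" and w: "w \<in> W" "g <# H = w <# H"
    then have "inv g \<otimes> w \<in> H"
      using coset_eq_H_iff[of "inv g \<otimes> w"] act_coset[of "inv g" w] act_inv(1)[of g H] sub act_coset[of "inv g" g] by force
    moreover have "g \<otimes> (inv g \<otimes> w) = w"
      using g w sub by (simp add: m_assoc[symmetric] subset_iff)
    ultimately show "g \<in> (\<Union>h\<in>H. {g \<in> topspace (mtop GM). g \<otimes> h \<in> W})"
      using g w(1) by (intro UN_I[of "inv g \<otimes> w"]) auto
  next
    fix g h assume "g \<in> topspace (mtop GM)" "h \<in> H" "g \<otimes> h \<in> W"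
    then show "g <# H \<in> (\<lambda>g. g <# H) ` W"
      using coset_mult_H by (metis image_eqI topGM)
  qed
  moreover have "openin (mtop GM) (\<Union>h\<in>H. {g \<in> topspace (mtop GM). g \<otimes> h \<in> W})"
    by (intro openin_Union) (auto intro!: openin_continuous_map_preimage[OF cont_right_mult W] Hmem simp del: topGM)
  ultimately have "openin (mtop GM) {g \<in> topspace (mtop GM). g <# H \<in> (\<lambda>g. g <# H) ` W}" by simp
  moreover have "(\<lambda>g. g <# H) ` W \<subseteq> topspace (mtop Q)" using sub by auto
  ultimately show ?thesis
    using quot unfolding quotient_map_def by blast
qed

section \<open>Coset representatives of minimal norm\<close>

text \<open>The analogue of being orthogonal to \<open>H\<close>. Only elements of the coset inside
  the chart domain compete.\<close>

definition minimal_in_coset :: "('a, 'e) chart \<Rightarrow> 'a \<Rightarrow> bool"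
  where "minimal_in_coset c g \<longleftrightarrow>
    (\<forall>h\<in>H. g \<otimes> h \<in> fst c \<longrightarrow> cdist c g \<one> \<le> cdist c (g \<otimes> h) \<one>)"

lemma chart_at_oneD:
  assumes "c \<in> charts_at GM \<one>"
  shows "is_chart (mtop GM) (model GM) c" "fst c \<subseteq> carrier G" "\<one> \<in> fst c" "openin (mtop GM) (fst c)"
    "subspace (model GM)" "g \<in> fst c \<Longrightarrow> g \<in> carrier G" "g \<in> fst c \<Longrightarrow> snd c g \<in> model GM"
proof -
  note ch = charts_atD[OF smooth_GM assms]
  show "is_chart (mtop GM) (model GM) c" "\<one> \<in> fst c" "openin (mtop GM) (fst c)" "subspace (model GM)"
    by (fact ch)+
  show "fst c \<subseteq> carrier G" using is_chartD(2)[OF ch(1)] by simp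
  then show "g \<in> fst c \<Longrightarrow> g \<in> carrier G" by blast
  show "g \<in> fst c \<Longrightarrow> snd c g \<in> model GM" using is_chartD(4)[OF ch(1)] by blast
qed

lemma group_ball:
  assumes c: "c \<in> charts_at GM \<one>" and W: "openin (mtop GM) W" "\<one> \<in> W"
  obtains R where "R > 0" "\<And>g. g \<in> fst c \<Longrightarrow> cdist c g \<one> \<le> R \<Longrightarrow> g \<in> W"
    "\<And>z. z \<in> model GM \<Longrightarrow> norm (z - snd c \<one>) \<le> R \<Longrightarrow> chart_inv c z \<in> fst c \<and> snd c (chart_inv c z) = z"
proof -
  note ch = chart_at_oneD[OF c]
  obtain R where "R > 0" and R: "\<And>z. z \<in> model GM \<Longrightarrow> z \<in> cball (snd c \<one>) R \<Longrightarrow> chart_inv c z \<in> fst c"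
    "\<And>z. z \<in> model GM \<Longrightarrow> z \<in> cball (snd c \<one>) R \<Longrightarrow> chart_inv c z \<in> W"
    "\<And>z. z \<in> model GM \<Longrightarrow> z \<in> cball (snd c \<one>) R \<Longrightarrow> snd c (chart_inv c z) = z"
    using is_chart_nbhd[OF ch(1) W ch(3)] by metis
  show thesis
  proof (rule that[OF \<open>R > 0\<close>])
    fix g assume g: "g \<in> fst c" "cdist c g \<one> \<le> R"
    then show "g \<in> W"
      using R(2)[of "snd c g"] ch(1,7) by (simp add: dist_norm norm_minus_commute)
  next
    fix z assume "z \<in> model GM" "norm (z - snd c \<one>) \<le> R"
    then show "chart_inv c z \<in> fst c \<and> snd c (chart_inv c z) = z"
      using R by (simp add: dist_norm norm_minus_commute)
  qed
qed

lemma small_in_group_ball: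
  assumes c: "c \<in> charts_at GM \<one>" and "r > 0"
  shows "openin (mtop GM) {g \<in> fst c. cdist c g \<one> < r}"
    and "\<one> \<in> {g \<in> fst c. cdist c g \<one> < r}"
proof -
  have "{g \<in> fst c. cdist c g \<one> < r} = {g \<in> fst c. snd c g \<in> ball (snd c \<one>) r}"
    by (auto simp: dist_norm norm_minus_commute)
  then show "openin (mtop GM) {g \<in> fst c. cdist c g \<one> < r}"
    using is_chart_preimage_open[OF chart_at_oneD(1)[OF c] open_ball] by simp
  show "\<one> \<in> {g \<in> fst c. cdist c g \<one> < r}"
    using chart_at_oneD(3)[OF c] assms(2) by simp
qed

text \<open>
  If the bound fails, there are minimal \<open>g\<^sub>i \<longlonglongrightarrow> \<one>\<close> with \<open>E g\<^sub>i\<close> of smaller order than the chart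
  norm \<open>\<parallel>g\<^sub>i\<parallel>\<close>. After passing to a subsequence their directions converge to some \<open>w\<close>, and limits of
  the powers \<open>g\<^sub>i [^] \<lfloor>\<rho> / \<parallel>g\<^sub>i\<parallel>\<rfloor>\<close> are elements of \<open>H\<close> close to \<open>\<rho> w\<close>. Dividing \<open>g\<^sub>i\<close> by
  the element of \<open>H\<close> obtained for \<open>\<rho> = \<parallel>g\<^sub>i\<parallel>\<close> contradicts the minimality of \<open>g\<^sub>i\<close>.
\<close>

lemma gauge_lower_bound:
  assumes c: "c \<in> charts_at GM \<one>" and W: "openin (mtop GM) W" "\<one> \<in> W"
    and E0: "\<And>g. g \<in> W \<Longrightarrow> 0 \<le> E g"
    and Econt: "continuous_map (subtopology (mtop GM) W) euclideanreal E"
    and C: "C \<ge> 0"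
    and Epow: "\<And>g k. (\<And>j. j \<le> k \<Longrightarrow> g [^] j \<in> W) \<Longrightarrow> g \<in> carrier G \<Longrightarrow> E (g [^] (k::nat)) \<le> C * real k * E g"
    and EH: "\<And>g. g \<in> W \<Longrightarrow> E g = 0 \<Longrightarrow> g \<in> H"
  obtains c0 r where "c0 > 0" "r > 0"
    "\<And>g. g \<in> fst c \<Longrightarrow> cdist c g \<one> < r \<Longrightarrow> minimal_in_coset c g \<Longrightarrow> c0 * cdist c g \<one> \<le> E g"
proof -
  note ch = chart_at_oneD[OF c]
  let ?V = "model GM"
  define n where "n g = cdist c g \<one>" for g
  \<comment> \<open>The fraction \<open>1/8\<close> makes the errors collected at the end,
    \<open>1/8 + 1/8 + 9/64\<close> times the norm, smaller than the norm itself.\<close>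
  obtain U1 U2 where U: "openin (mtop GM) U1" "\<one> \<in> U1" "openin (mtop GM) U2" "\<one> \<in> U2"
    and U1f: "\<And>x y. x \<in> U1 \<Longrightarrow> y \<in> U2 \<Longrightarrow> x \<otimes> y \<in> fst c"
    and near: "\<And>x y y'. x \<in> U1 \<Longrightarrow> y \<in> U2 \<Longrightarrow> y' \<in> U2 \<Longrightarrow>
       norm (snd c (x \<otimes> y) - snd c (x \<otimes> y') - (snd c y - snd c y')) \<le> (1/8) * cdist c y y'"
    by (rule smooth_action_near_identity[OF lcGM lcGM smooth_mult c c, of "1/8"]) auto
  define W1 where "W1 = U1 \<inter> U2 \<inter> W"
  have W1: "openin (mtop GM) W1" "\<one> \<in> W1"
    using U W by (auto simp: W1_def)
  obtain R where "R > 0" and RW: "\<And>g. g \<in> fst c \<Longrightarrow> n g \<le> R \<Longrightarrow> g \<in> W1"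
    and Rinv: "\<And>z. z \<in> ?V \<Longrightarrow> norm (z - snd c \<one>) \<le> R \<Longrightarrow> chart_inv c z \<in> fst c \<and> snd c (chart_inv c z) = z"
    using group_ball[OF c W1] unfolding n_def by metis
  define B where "B = {g \<in> fst c. n g \<le> R}"
  have BW: "g \<in> W" "g \<in> U1" "g \<in> U2" "g \<in> carrier G" if "g \<in> B" for g
    using RW[of g] that ch(6) by (auto simp: B_def W1_def)
  have prod: "g \<otimes> h \<in> fst c" "norm (snd c (g \<otimes> h) - snd c g - (snd c h - snd c \<one>)) \<le> (1/8) * n h"
    if "g \<in> B" "h \<in> B" for g h
  proof -
    show "g \<otimes> h \<in> fst c" using U1f BW that by blast
    have "snd c (g \<otimes> \<one>) = snd c g" using BW(4)[OF that(1)] by simp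
    then show "norm (snd c (g \<otimes> h) - snd c g - (snd c h - snd c \<one>)) \<le> (1/8) * n h"
      using near[OF BW(2)[OF that(1)] BW(3)[OF that(2)] U(4)] by (simp add: n_def)
  qed
  \<comment> \<open>Each further factor \<open>g\<close> adds the coordinate vector of
    \<open>g\<close> up to the fraction \<open>1/8\<close>, so powers advance almost along a line.
    The limit \<open>R/2\<close> leaves room for the factor \<open>9/8\<close> inside the ball of
    radius \<open>R\<close>.\<close>
  have pow: "g [^] k \<in> B \<and> norm (snd c (g [^] k) - snd c \<one> - real k *\<^sub>R (snd c g - snd c \<one>)) \<le> (1/8) * (real k * n g)"
    if g: "g \<in> B" and k: "real k * n g \<le> R/2" for g and k :: nat
    using k
  proof (induction k)
    case 0
    have "n \<one> = 0" by (simp add: n_def)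
    then show ?case using ch(3) \<open>R > 0\<close> by (simp add: B_def)
  next
    case (Suc k)
    have ng: "n g \<ge> 0" by (simp add: n_def)
    have "real k * n g \<le> R/2" using Suc.prems ng by (simp add: algebra_simps)
    then have IH: "g [^] k \<in> B" "norm (snd c (g [^] k) - snd c \<one> - real k *\<^sub>R (snd c g - snd c \<one>)) \<le> (1/8) * (real k * n g)"
      using Suc.IH by auto
    have pS: "g [^] Suc k = g [^] k \<otimes> g" by simp
    have "snd c (g [^] Suc k) - snd c \<one> - real (Suc k) *\<^sub>R (snd c g - snd c \<one>)
      = (snd c (g [^] k \<otimes> g) - snd c (g [^] k) - (snd c g - snd c \<one>)) + (snd c (g [^] k) - snd c \<one> - real k *\<^sub>R (snd c g - snd c \<one>))"
      unfolding pS by (simp add: algebra_simps)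
    also have "norm \<dots> \<le> (1/8) * n g + (1/8) * (real k * n g)"
      by (rule norm_triangle_le[OF add_mono[OF prod(2)[OF IH(1) g] IH(2)]])
    also have "\<dots> = (1/8) * (real (Suc k) * n g)" by (simp add: algebra_simps)
    finally have est: "norm (snd c (g [^] Suc k) - snd c \<one> - real (Suc k) *\<^sub>R (snd c g - snd c \<one>)) \<le> (1/8) * (real (Suc k) * n g)" .
    have "n (g [^] Suc k) \<le> norm (real (Suc k) *\<^sub>R (snd c g - snd c \<one>)) + (1/8) * (real (Suc k) * n g)"
      using norm_triangle_sub[of "snd c (g [^] Suc k) - snd c \<one>" "real (Suc k) *\<^sub>R (snd c g - snd c \<one>)"] est
      unfolding n_def by linarith
    also have "\<dots> = (9/8) * (real (Suc k) * n g)" by (simp add: n_def)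
    also have "\<dots> \<le> R" using Suc.prems \<open>R > 0\<close> by linarith
    finally have "g [^] Suc k \<in> B"
      using prod(1)[OF IH(1) g] by (simp add: B_def)
    then show ?case using est by blast
  qed
  define K where "K = ?V \<inter> cball (snd c \<one>) R"
  have "compact K"
    unfolding K_def by (intro closed_Int_compact closed_subspace ch(5) compact_cball)
  have Kinv: "chart_inv c z \<in> B" "snd c (chart_inv c z) = z" if "z \<in> K" for z
    using Rinv[of z] that by (auto simp: K_def B_def n_def dist_norm norm_minus_commute)
  have BK: "snd c g \<in> K" if "g \<in> B" for g
    using that ch(7) by (auto simp: K_def B_def n_def dist_norm norm_minus_commute)
  have EK: "continuous_on K (\<lambda>z. E (chart_inv c z))"
  proof -
    have "continuous_map (top_of_set K) (mtop GM) (chart_inv c)"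
      using is_chart_inv_continuous[OF ch(1)]
      by (rule continuous_map_from_subtopology_mono) (use Kinv in \<open>force simp: B_def image_iff\<close>)
    then have "continuous_map (top_of_set K) (subtopology (mtop GM) W) (chart_inv c)"
      using Kinv BW by (auto simp: continuous_map_in_subtopology)
    from continuous_map_compose[OF this Econt] show ?thesis by (simp add: o_def)
  qed
  show thesis
  proof (rule ccontr)
    assume neg: "\<not> thesis"
    have "\<exists>g. g \<in> fst c \<and> n g < 1 / real (Suc i) \<and> minimal_in_coset c g \<and> \<not> (1 / real (Suc i)) * n g \<le> E g" for i
    proof (rule ccontr)
      assume "\<not> ?thesis"
      then have "thesis"
        by (intro that[of "1 / real (Suc i)" "1 / real (Suc i)"]) (auto simp: n_def)
      with neg show False ..
    qed
    then obtain g0 where g0: "\<And>i. g0 i \<in> fst c" "\<And>i. n (g0 i) < 1 / real (Suc i)"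
      "\<And>i. minimal_in_coset c (g0 i)" "\<And>i. E (g0 i) < (1 / real (Suc i)) * n (g0 i)"
      by (metis not_le)
    \<comment> \<open>Discarding the first \<open>i0\<close> terms brings all norms below
      \<open>R/2\<close>, the range of \<open>pow\<close>.\<close>
    obtain i0 where i0: "1 / real (Suc i0) < R/2"
      using \<open>R > 0\<close> reals_Archimedean[of "R/2"] by (auto simp: inverse_eq_divide)
    define g1 where "g1 i = g0 (i + i0)" for i
    have lei: "1 / real (Suc (i + i0)) \<le> 1 / real (Suc i)" "1 / real (Suc (i + i0)) \<le> 1 / real (Suc i0)" for i
      by (auto simp: frac_le)
    have g1: "g1 i \<in> B" "n (g1 i) < 1 / real (Suc i)" "n (g1 i) \<le> R/2" "minimal_in_coset c (g1 i)" for i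
    proof -
      show "n (g1 i) < 1 / real (Suc i)" "n (g1 i) \<le> R/2"
        using g0(2)[of "i + i0"] lei[of i] i0 unfolding g1_def by linarith+
      then show "g1 i \<in> B" using g0(1) \<open>R > 0\<close> by (simp add: B_def g1_def)
      show "minimal_in_coset c (g1 i)" using g0(3) by (simp add: g1_def)
    qed
    \<comment> \<open>The strict inequality \<open>E < n / (i + 1)\<close> together with
      \<open>E \<ge> 0\<close> excludes norm 0, so directions can be formed.\<close>
    have g1pos: "n (g1 i) > 0" for i
    proof -
      have "0 \<le> E (g1 i)" using E0 BW(1)[OF g1(1)] .
      then have "0 < (1 / real (Suc (i + i0))) * n (g1 i)" using g0(4)[of "i + i0"] by (simp add: g1_def)
      then show ?thesis by (simp add: zero_less_divide_iff)
    qed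
    have g1E: "E (g1 i) \<le> n (g1 i) / real (Suc i)" for i
      using g0(4)[of "i + i0"] mult_right_mono[OF lei(1)[of i], of "n (g1 i)"] g1pos[of i] by (simp add: g1_def)
    have "(snd c (g1 i) - snd c \<one>) /\<^sub>R n (g1 i) \<in> sphere 0 1" for i
      using g1pos[of i] by (simp add: n_def)
    then obtain w r where w: "w \<in> sphere 0 1" "strict_mono (r :: nat \<Rightarrow> nat)"
      "((\<lambda>i. (snd c (g1 i) - snd c \<one>) /\<^sub>R n (g1 i)) \<circ> r) \<longlonglongrightarrow> w"
      using compact_sphere[of "0 :: 'e" 1, unfolded compact_def, rule_format, of "\<lambda>i. (snd c (g1 i) - snd c \<one>) /\<^sub>R n (g1 i)"]
      by blast
    define g where "g i = g1 (r i)" for i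
    have ri: "1 / real (Suc (r i)) \<le> 1 / real (Suc i)" for i
      using seq_suble[OF w(2), of i] by (intro divide_left_mono) auto
    have g: "g i \<in> B" "n (g i) \<le> 1 / real (Suc i)" "n (g i) \<le> R/2" "minimal_in_coset c (g i)" "n (g i) > 0" for i
      using g1[of "r i"] g1pos[of "r i"] ri[of i] unfolding g_def by linarith+
    have gE: "E (g i) \<le> n (g i) / real (Suc i)" for i
      using g1E[of "r i"] mult_left_mono[OF ri[of i], of "n (g i)"] g(5)[of i] by (simp add: g_def)
    define v where "v i = (snd c (g i) - snd c \<one>) /\<^sub>R n (g i)" for i
    have v: "v \<longlonglongrightarrow> w" using w(3) by (simp add: v_def[abs_def] g_def o_def)
    have vg: "snd c (g i) - snd c \<one> = n (g i) *\<^sub>R v i" for i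
      using g(5)[of i] by (simp add: v_def)
    have lim0: "(\<lambda>i. 1 / real (Suc i)) \<longlonglongrightarrow> 0"
      using LIMSEQ_inverse_real_of_nat by (simp add: inverse_eq_divide)
    have n0: "(\<lambda>i. n (g i)) \<longlonglongrightarrow> 0"
      by (rule tendsto_sandwich[OF _ _ tendsto_const lim0]) (use g(2,5) less_imp_le in \<open>auto intro!: always_eventually\<close>)
    \<comment> \<open>\<open>H\<close> has elements close to \<open>\<rho> *\<^sub>R w\<close> at
      every small scale \<open>\<rho>\<close>, with an error proportional to \<open>\<rho>\<close>.
      The proportionality allows \<open>\<rho>\<close> to be matched with the norm of a single
      \<open>g i\<close> later.\<close>
    have star: "\<exists>h. h \<in> H \<and> h \<in> B \<and> norm (snd c h - snd c \<one> - \<rho> *\<^sub>R w) \<le> \<rho>/8" if \<rho>: "0 < \<rho>" "\<rho> \<le> R/2" for \<rho>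
    proof -
      \<comment> \<open>The number of factors that carries the power of \<open>g i\<close> to
        distance about \<open>\<rho>\<close>; rounding down loses at most \<open>n (g i)\<close>,
        which tends to 0.\<close>
      define k where "k i = nat \<lfloor>\<rho> / n (g i)\<rfloor>" for i
      have k: "real (k i) * n (g i) \<le> \<rho>" "\<rho> - n (g i) \<le> real (k i) * n (g i)" for i
      proof -
        have q: "\<rho> / n (g i) > 0" using \<rho>(1) g(5)[of i] by simp
        have rk: "real (k i) = of_int \<lfloor>\<rho> / n (g i)\<rfloor>"
          using q by (simp add: k_def)
        have "real (k i) \<le> \<rho> / n (g i)" "\<rho> / n (g i) - 1 \<le> real (k i)"
          unfolding rk by linarith+
        then show "real (k i) * n (g i) \<le> \<rho>" "\<rho> - n (g i) \<le> real (k i) * n (g i)"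
          using g(5)[of i] by (simp_all add: field_simps)
      qed
      define z where "z i = snd c (g i [^] k i)" for i
      have pk: "g i [^] j \<in> B" if "j \<le> k i" for i j
      proof -
        have "real j * n (g i) \<le> real (k i) * n (g i)" using that g(5)[of i] by simp
        then show ?thesis using pow[OF g(1)[of i], of j] k(1)[of i] \<rho>(2) by linarith
      qed
      have zest: "norm (z i - snd c \<one> - (real (k i) * n (g i)) *\<^sub>R v i) \<le> \<rho>/8" for i
        using pow[OF g(1)[of i], of "k i"] k(1)[of i] \<rho>(2) by (simp add: z_def vg)
      \<comment> \<open>The number of factors is about \<open>\<rho> / n (g i)\<close>, while
        \<open>E (g i)\<close> is at most \<open>n (g i) / (i + 1)\<close>. Their product tends to
        0, so \<open>E\<close> vanishes at any limit of the powers and the limit lies in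
        \<open>H\<close>.\<close>
      have Ez: "E (g i [^] k i) \<le> C * \<rho> * (1 / real (Suc i))" for i
      proof -
        have "E (g i [^] k i) \<le> C * real (k i) * E (g i)"
          using pk BW g(1) by (intro Epow) auto
        also have "\<dots> \<le> C * real (k i) * (n (g i) / real (Suc i))"
          using C by (intro mult_left_mono gE) auto
        also have "\<dots> = C * (real (k i) * n (g i)) * (1 / real (Suc i))" by simp
        also have "\<dots> \<le> C * \<rho> * (1 / real (Suc i))"
          using C k(1)[of i] by (intro mult_right_mono mult_left_mono) auto
        finally show ?thesis .
      qed
      have "z i \<in> K" for i unfolding z_def using BK pk by blast
      then obtain z' s where z': "z' \<in> K" "strict_mono (s :: nat \<Rightarrow> nat)" "(z \<circ> s) \<longlonglongrightarrow> z'"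
        using \<open>compact K\<close>[unfolded compact_def, rule_format, of z] by blast
      define h where "h = chart_inv c z'"
      have h: "h \<in> B" "snd c h = z'" using Kinv[OF z'(1)] by (auto simp: h_def)
      have "(\<lambda>i. E (chart_inv c ((z \<circ> s) i))) \<longlonglongrightarrow> E (chart_inv c z')"
        using EK z'(1,3) \<open>\<And>i. z i \<in> K\<close> unfolding continuous_on_sequentially by (auto simp: o_def)
      moreover have "chart_inv c ((z \<circ> s) i) = g (s i) [^] k (s i)" for i
        using pk[of "k (s i)" "s i"] ch(1) by (simp add: z_def B_def)
      ultimately have "(\<lambda>i. E (g (s i) [^] k (s i))) \<longlonglongrightarrow> E h" by (simp add: h_def)
      moreover have "(\<lambda>i. C * \<rho> * (1 / real (Suc (s i)))) \<longlonglongrightarrow> C * \<rho> * 0"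
        using LIMSEQ_subseq_LIMSEQ[OF lim0 z'(2)] by (intro tendsto_mult tendsto_const) (simp add: o_def)
      ultimately have "E h \<le> C * \<rho> * 0"
        by (rule LIMSEQ_le) (use Ez in blast)
      then have "h \<in> H" using EH[OF BW(1)[OF h(1)]] E0[OF BW(1)[OF h(1)]] by simp
      have kn: "(\<lambda>i. real (k i) * n (g i)) \<longlonglongrightarrow> \<rho>"
      proof (rule tendsto_sandwich[OF _ _ _ tendsto_const])
        show "(\<lambda>i. \<rho> - n (g i)) \<longlonglongrightarrow> \<rho>" using tendsto_diff[OF tendsto_const n0, of \<rho>] by simp
      qed (use k in \<open>auto intro!: always_eventually\<close>)
      have "(\<lambda>i. (real (k i) * n (g i)) *\<^sub>R v i) \<longlonglongrightarrow> \<rho> *\<^sub>R w"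
        by (intro tendsto_scaleR kn v)
      from LIMSEQ_subseq_LIMSEQ[OF this z'(2)]
      have "(\<lambda>i. norm ((z \<circ> s) i - snd c \<one> - (real (k (s i)) * n (g (s i))) *\<^sub>R v (s i))) \<longlonglongrightarrow> norm (z' - snd c \<one> - \<rho> *\<^sub>R w)"
        by (intro tendsto_norm tendsto_diff z'(3) tendsto_const) (simp add: o_def)
      then have "norm (z' - snd c \<one> - \<rho> *\<^sub>R w) \<le> \<rho>/8"
        by (rule LIMSEQ_le_const2) (use zest in auto)
      then show ?thesis using h \<open>h \<in> H\<close> by auto
    qed
    have small: "openin (mtop GM) {g \<in> fst c. cdist c g \<one> < R}" "\<one> \<otimes> inv \<one> \<in> {g \<in> fst c. cdist c g \<one> < R}"
      using small_in_group_ball[OF c \<open>R > 0\<close>] by auto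
    \<comment> \<open>Ensures that \<open>g i \<otimes> inv h\<close> stays in the ball on which the
      product estimate holds.\<close>
    obtain O1 O2 where O: "openin (mtop GM) O1" "\<one> \<in> O1" "openin (mtop GM) O2" "\<one> \<in> O2"
      "\<And>x y. x \<in> O1 \<Longrightarrow> y \<in> O2 \<Longrightarrow> x \<otimes> inv y \<in> {g \<in> fst c. cdist c g \<one> < R}"
      by (rule prod_nbhd[where f = "\<lambda>x y. x \<otimes> inv y", OF cont_mult_inv small(1) _ _ small(2)]) auto
    have O12: "openin (mtop GM) (O1 \<inter> O2)" "\<one> \<in> O1 \<inter> O2" using O by auto
    obtain \<delta> where "\<delta> > 0" and \<delta>: "\<And>g. g \<in> fst c \<Longrightarrow> n g \<le> \<delta> \<Longrightarrow> g \<in> O1 \<inter> O2"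
      using group_ball[OF c O12] unfolding n_def by metis
    have "eventually (\<lambda>i. n (g i) < \<delta>/2) sequentially"
      using order_tendstoD(2)[OF n0, of "\<delta>/2"] \<open>\<delta> > 0\<close> by simp
    moreover have "eventually (\<lambda>i. dist (v i) w < 1/8) sequentially"
      by (rule tendstoD[OF v]) simp
    ultimately have "eventually (\<lambda>i. n (g i) < \<delta>/2 \<and> dist (v i) w < 1/8) sequentially"
      by (rule eventually_conj)
    then obtain i where i: "n (g i) < \<delta>/2" "dist (v i) w < 1/8"
      using eventually_happens'[OF sequentially_bot] by blast
    define \<sigma> where "\<sigma> = n (g i)"
    have \<sigma>: "0 < \<sigma>" "\<sigma> \<le> R/2" using g(3,5)[of i] by (auto simp: \<sigma>_def)
    obtain h where h: "h \<in> H" "h \<in> B" and hest: "norm (snd c h - snd c \<one> - \<sigma> *\<^sub>R w) \<le> \<sigma>/8"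
      using star[OF \<sigma>] by blast
    have w1: "norm (\<sigma> *\<^sub>R w) = \<sigma>" using w(1) \<sigma>(1) by simp
    have nh: "n h \<le> (9/8) * \<sigma>"
      using norm_triangle_sub[of "snd c h - snd c \<one>" "\<sigma> *\<^sub>R w"] hest w1 unfolding n_def by linarith
    then have "n h \<le> \<delta>" "n (g i) \<le> \<delta>"
      using i(1) \<sigma>(1) unfolding \<sigma>_def by linarith+
    then have "g i \<in> O1" "h \<in> O2"
      using \<delta> g(1)[of i] h(2) by (auto simp: B_def)
    \<comment> \<open>Both \<open>g i\<close> and \<open>h\<close> lie near
      \<open>\<sigma> *\<^sub>R w\<close> in coordinates, so the quotient, which represents the same
      coset as \<open>g i\<close>, has norm at most \<open>25/64\<close> of
      \<open>\<sigma> = n (g i)\<close>.\<close>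
    define g' where "g' = g i \<otimes> inv h"
    have g'B: "g' \<in> B"
      using O(5)[OF \<open>g i \<in> O1\<close> \<open>h \<in> O2\<close>] by (auto simp: B_def g'_def n_def)
    have car: "g i \<in> carrier G" "h \<in> carrier G" using BW g(1) h(2) by auto
    have "g' \<otimes> h = g i" using car by (simp add: g'_def m_assoc)
    then have est: "norm (snd c (g i) - snd c g' - (snd c h - snd c \<one>)) \<le> (1/8) * n h"
      using prod(2)[OF g'B h(2)] by simp
    have "norm ((snd c (g i) - snd c \<one>) - \<sigma> *\<^sub>R w) = \<sigma> * norm (v i - w)"
      unfolding vg \<sigma>_def[symmetric] using \<sigma>(1) by (simp flip: scaleR_diff_right)
    also have "\<dots> \<le> \<sigma> * (1/8)"
      using i(2) \<sigma>(1) by (intro mult_left_mono) (auto simp: dist_norm)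
    finally have est2: "norm ((snd c (g i) - snd c \<one>) - \<sigma> *\<^sub>R w) \<le> \<sigma> * (1/8)" .
    have tri: "norm (x - y - z) \<le> norm x + norm y + norm z" for x y z :: 'e
      using norm_triangle_ineq4[of "x - y" z] norm_triangle_ineq4[of x y] by linarith
    have "snd c g' - snd c \<one> = ((snd c (g i) - snd c \<one>) - \<sigma> *\<^sub>R w) - (snd c h - snd c \<one> - \<sigma> *\<^sub>R w)
        - (snd c (g i) - snd c g' - (snd c h - snd c \<one>))"
      by simp
    then have "n g' \<le> norm ((snd c (g i) - snd c \<one>) - \<sigma> *\<^sub>R w) + norm (snd c h - snd c \<one> - \<sigma> *\<^sub>R w)
        + norm (snd c (g i) - snd c g' - (snd c h - snd c \<one>))"
      unfolding n_def by (simp only: tri)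
    also have "\<dots> \<le> \<sigma> * (1/8) + \<sigma>/8 + (1/8) * ((9/8) * \<sigma>)"
      using est est2 hest nh by (intro add_mono) auto
    also have "\<dots> < \<sigma>" using \<sigma>(1) by simp
    finally have "n g' < n (g i)" by (simp add: \<sigma>_def)
    moreover have "n (g i) \<le> n g'"
      using g(4)[of i] g'B subgroup.m_inv_closed[OF H h(1)] unfolding minimal_in_coset_def n_def g'_def B_def by blast
    ultimately show False by simp
  qed
qed

text \<open>Points of \<open>G/H\<close> are closed, so the representatives of a coset in a closed
  coordinate ball form a compact set, on which the norm attains its minimum.\<close>

lemma minimal_representatives:
  assumes c: "c \<in> charts_at GM \<one>" and "r > 0"
  obtains U where "openin (mtop Q) U" "H \<in> U"
    "\<And>P. P \<in> U \<Longrightarrow> \<exists>g\<in>fst c. cdist c g \<one> < r \<and> g <# H = P \<and> minimal_in_coset c g"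
proof -
  note ch = chart_at_oneD[OF c]
  obtain R where "R > 0" and Rinv: "\<And>z. z \<in> model GM \<Longrightarrow> norm (z - snd c \<one>) \<le> R \<Longrightarrow> chart_inv c z \<in> fst c \<and> snd c (chart_inv c z) = z"
    using group_ball[OF c ch(4,3)] by metis
  define r' where "r' = min r R"
  have r': "r' > 0" "r' \<le> r" "r' \<le> R" using \<open>r > 0\<close> \<open>R > 0\<close> by (auto simp: r'_def)
  define U where "U = (\<lambda>g. g <# H) ` {g \<in> fst c. cdist c g \<one> < r'}"
  show thesis
  proof (rule that[of U])
    show "openin (mtop Q) U"
      unfolding U_def by (rule open_coset_image[OF small_in_group_ball(1)[OF c r'(1)]])
    show "H \<in> U"
      unfolding U_def using small_in_group_ball(2)[OF c r'(1)] by (auto intro!: image_eqI[of _ _ \<one>])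
    fix P assume "P \<in> U"
    then obtain g0 where g0: "g0 \<in> fst c" "cdist c g0 \<one> < r'" "P = g0 <# H"
      unfolding U_def by blast
    \<comment> \<open>With the norm of \<open>g0\<close> as radius, \<open>S\<close> contains
      \<open>g0\<close>, and any element of the coset that beat the minimizer would lie in
      \<open>S\<close> too.\<close>
    define S where "S = model GM \<inter> cball (snd c \<one>) (cdist c g0 \<one>)"
    have inS: "z \<in> S \<longleftrightarrow> z \<in> model GM \<and> norm (z - snd c \<one>) \<le> cdist c g0 \<one>" for z
      by (simp add: S_def dist_norm norm_minus_commute)
    have S: "chart_inv c z \<in> fst c" "snd c (chart_inv c z) = z" if "z \<in> S" for z
      using Rinv[of z] that g0(2) r'(3) by (auto simp: inS)
    have "compact S"
      unfolding S_def by (intro closed_Int_compact closed_subspace ch(5) compact_cball)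
    have "continuous_map (top_of_set S) (mtop GM) (chart_inv c)"
      using is_chart_inv_continuous[OF ch(1)]
      by (rule continuous_map_from_subtopology_mono) (use S in \<open>force simp: image_iff\<close>)
    from continuous_map_compose[OF this cont_coset]
    have "continuous_map (top_of_set S) (mtop Q) (\<lambda>z. chart_inv c z <# H)" by (simp add: o_def)
    moreover have "closedin (mtop Q) {P}"
      using smooth_Q g0(1,3) ch(6) by (auto simp: smooth_manifold_def closedin_Hausdorff_singleton)
    ultimately have "closedin (top_of_set S) {z \<in> topspace (top_of_set S). chart_inv c z <# H \<in> {P}}"
      by (rule closedin_continuous_map_preimage)
    then have "compact {z \<in> S. chart_inv c z <# H = P}"
      using closedin_compact[OF \<open>compact S\<close>] by simp
    moreover have "snd c g0 \<in> {z \<in> S. chart_inv c z <# H = P}"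
      using g0 ch(1,7) by (simp add: inS)
    ultimately obtain z where z: "z \<in> S" "chart_inv c z <# H = P"
      and min: "\<And>z'. z' \<in> S \<Longrightarrow> chart_inv c z' <# H = P \<Longrightarrow> norm (z - snd c \<one>) \<le> norm (z' - snd c \<one>)"
      using continuous_attains_inf[of "{z \<in> S. chart_inv c z <# H = P}" "\<lambda>z. norm (z - snd c \<one>)"]
      by (force intro!: continuous_intros)
    define g where "g = chart_inv c z"
    have g: "g \<in> fst c" "snd c g = z" "g <# H = P" using S[OF z(1)] z(2) by (auto simp: g_def)
    have le: "cdist c g \<one> \<le> cdist c g0 \<one>"
      using z(1) by (simp add: g(2) inS)
    have "minimal_in_coset c g"
      unfolding minimal_in_coset_def
    proof (intro ballI impI, rule ccontr)
      fix h assume h: "h \<in> H" "g \<otimes> h \<in> fst c"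
        and less: "\<not> cdist c g \<one> \<le> cdist c (g \<otimes> h) \<one>"
      have "snd c (g \<otimes> h) \<in> S" using ch(7)[OF h(2)] less le by (simp add: inS)
      moreover have "chart_inv c (snd c (g \<otimes> h)) <# H = P"
        using h ch(1) coset_mult_H[OF ch(6)[OF g(1)] h(1)] g(3) by simp
      ultimately show False using min less g(2) by blast
    qed
    then show "\<exists>g\<in>fst c. cdist c g \<one> < r \<and> g <# H = P \<and> minimal_in_coset c g"
      using g le g0(2) r'(2) by (intro bexI[of _ g]) auto
  qed
qed

text \<open>By invariance all steps of the chain from \<open>H\<close> through the cosets of
  successive powers of \<open>g\<close> have the same length.\<close>

lemma D_power_le:
  assumes "g \<in> carrier G"
  shows "D H (g [^] (k::nat) <# H) \<le> real k * D H (g <# H)"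
proof (induction k)
  case 0
  then show ?case using D_zero[of H H] by simp
next
  case (Suc k)
  have "D H (g [^] Suc k <# H) \<le> D H (g [^] k <# H) + D (g [^] k <# H) (g [^] Suc k <# H)"
    using assms by (intro D_triangle) auto
  also have "D (g [^] k <# H) (g [^] Suc k <# H) = D H (g <# H)"
    using assms D_inv[of "g [^] k" H "g <# H"] by (simp add: act_coset)
  finally show ?case using Suc by (simp add: algebra_simps)
qed

text \<open>Invariance moves \<open>g\<close> to \<open>\<one>\<close>, where \<open>D_lip\<close>
  makes the distance small; the triangle inequality does the rest.\<close>

lemma D_coset_continuous:
  assumes "P \<in> lcosets H"
  shows "continuous_map (mtop GM) euclideanreal (\<lambda>g. D P (g <# H))"
  unfolding continuous_map_into_real_iff_local
proof (intro ballI allI impI)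
  fix g and e :: real assume "g \<in> topspace (mtop GM)" and "e > 0"
  then have g: "g \<in> carrier G" by simp
  obtain c L U where c: "c \<in> charts_at GM \<one>" and U: "openin (mtop GM) U" "\<one> \<in> U" "U \<subseteq> fst c"
    and L: "\<And>g. g \<in> U \<Longrightarrow> D H (g <# H) \<le> L * cdist c g \<one>"
    using D_lip by blast
  define r where "r = e / (\<bar>L\<bar> + 1)"
  have "r > 0" using \<open>e > 0\<close> by (simp add: r_def add_nonneg_pos)
  define W where "W = U \<inter> {g \<in> fst c. cdist c g \<one> < r}"
  have W: "openin (mtop GM) W" "\<one> \<in> W"
    using small_in_group_ball[OF c \<open>r > 0\<close>] U unfolding W_def by auto
  have DW: "D H (x <# H) < e" if "x \<in> W" for x
  proof -
    have "D H (x <# H) \<le> L * cdist c x \<one>" using that L by (auto simp: W_def)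
    also have "\<dots> \<le> (\<bar>L\<bar> + 1) * cdist c x \<one>" by (intro mult_right_mono) auto
    also have "\<dots> < (\<bar>L\<bar> + 1) * r" using that by (intro mult_strict_left_mono) (auto simp: W_def)
    also have "\<dots> = e" by (simp add: r_def add_nonneg_pos)
    finally show ?thesis .
  qed
  define O' where "O' = {x \<in> topspace (mtop GM). inv g \<otimes> x \<in> W}"
  have "\<bar>D P (x <# H) - D P (g <# H)\<bar> < e" if "x \<in> O'" for x
  proof -
    have x: "x \<in> carrier G" "inv g \<otimes> x \<in> W" using that by (auto simp: O'_def)
    have "D (g <# H) (x <# H) = D (g <# H) (g <# ((inv g \<otimes> x) <# H))"
      using g x by (simp add: act_coset m_assoc[symmetric])
    also have "\<dots> = D H ((inv g \<otimes> x) <# H)" using g x by (intro D_inv) auto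
    finally have "D (g <# H) (x <# H) < e" using DW[OF x(2)] by simp
    then show ?thesis
      using D_triangle[OF assms, of "g <# H" "x <# H"] D_triangle[OF assms, of "x <# H" "g <# H"] D_commute[of "g <# H" "x <# H"] g x
      by auto
  qed
  moreover have "openin (mtop GM) O'"
    unfolding O'_def using g W by (intro openin_continuous_map_preimage[OF cont_left_mult]) auto
  moreover have "g \<in> O'" using g W(2) by (simp add: O'_def)
  ultimately show "\<exists>U. openin (mtop GM) U \<and> g \<in> U \<and> (\<forall>y\<in>U. \<bar>D P (y <# H) - D P (g <# H)\<bar> < e)"
    by blast
qed

text \<open>The gauge argument on the whole group: invariance gives the growth of powers with
  constant 1, and \<open>D\<close> separates cosets.\<close>

lemma D_lower_bound:
  assumes c: "c \<in> charts_at GM \<one>"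
  obtains c0 r where "c0 > 0" "r > 0"
    "\<And>g. g \<in> fst c \<Longrightarrow> cdist c g \<one> < r \<Longrightarrow> minimal_in_coset c g \<Longrightarrow>
      c0 * cdist c g \<one> \<le> D H (g <# H)"
proof (rule gauge_lower_bound[OF c, of "carrier G" "\<lambda>g. D H (g <# H)" 1])
  show "openin (mtop GM) (carrier G)" using openin_topspace[of "mtop GM"] by simp
  show "continuous_map (subtopology (mtop GM) (carrier G)) euclideanreal (\<lambda>g. D H (g <# H))"
    by (intro continuous_map_from_subtopology D_coset_continuous H_in)
  show "g \<in> H" if "g \<in> carrier G" "D H (g <# H) = 0" for g
    using that D_zero[of H "g <# H"] coset_eq_H_iff[of g] by auto
qed (use D_power_le that in auto)

text \<open>Takes the place of the submersion property. The chart distance is not invariant, but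
  elements near \<open>\<one>\<close> stretch coordinate differences by at most \<open>3/2\<close>,
  so the chain of powers still gives linear growth, with constant 2, while the powers stay in
  \<open>W\<close>.\<close>

lemma chart_lower_bound:
  assumes c: "c \<in> charts_at GM \<one>" and k: "k \<in> charts_at Q H"
  obtains c0 r where "c0 > 0" "r > 0"
    "\<And>g. g \<in> fst c \<Longrightarrow> cdist c g \<one> < r \<Longrightarrow> minimal_in_coset c g \<Longrightarrow>
      c0 * cdist c g \<one> \<le> cdist k (g <# H) H"
proof -
  note chk = charts_atD[OF smooth_Q k]
  obtain U1 U2 where U: "openin (mtop GM) U1" "\<one> \<in> U1" "openin (mtop Q) U2" "H \<in> U2" "U2 \<subseteq> fst k"
    and near: "\<And>x y y'. x \<in> U1 \<Longrightarrow> y \<in> U2 \<Longrightarrow> y' \<in> U2 \<Longrightarrow>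
       norm (snd k (x <# y) - snd k (x <# y') - (snd k y - snd k y')) \<le> (1/2) * cdist k y y'"
    by (rule smooth_action_near_identity[OF lcGM lcQ smooth_act c k, of "1/2"]) auto
  define W where "W = U1 \<inter> {g \<in> topspace (mtop GM). g <# H \<in> U2}"
  have W: "openin (mtop GM) W" "\<one> \<in> W"
    using U openin_Int[OF U(1) openin_continuous_map_preimage[OF cont_coset U(3)]] unfolding W_def by auto
  have WD: "g \<in> U1" "g <# H \<in> U2" "g <# H \<in> fst k" "g \<in> carrier G" if "g \<in> W" for g
    using that U(5) by (auto simp: W_def)
  let ?E = "\<lambda>g. cdist k (g <# H) H"
  show thesis
  proof (rule gauge_lower_bound[OF c W, of ?E 2])
    have "continuous_map (subtopology (mtop GM) W) (subtopology (mtop Q) (fst k)) (\<lambda>g. g <# H)"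
      using WD by (auto simp: continuous_map_in_subtopology intro!: continuous_map_from_subtopology cont_coset)
    from continuous_map_compose[OF this is_chart_continuous[OF chk(1)]]
    have "continuous_map (subtopology (mtop GM) W) euclidean (\<lambda>g. snd k (g <# H))"
      by (simp add: o_def continuous_map_in_subtopology)
    then show "continuous_map (subtopology (mtop GM) W) euclideanreal ?E"
      by (intro continuous_map_norm continuous_map_diff) auto
  next
    fix g and m :: nat assume gW: "\<And>j. j \<le> m \<Longrightarrow> g [^] j \<in> W" and g: "g \<in> carrier G"
    show "?E (g [^] m) \<le> 2 * real m * ?E g"
      using gW
    proof (induction m)
      case (Suc m)
      have "g [^] (1::nat) \<in> W" using Suc.prems[of 1] by simp
      then have gW: "g \<in> W" using g by simp
      have m: "g [^] m \<in> W" using Suc.prems[of m] by simp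
      have IH: "?E (g [^] m) \<le> 2 * real m * ?E g" using Suc by simp
      have "norm (snd k (g [^] m <# (g <# H)) - snd k (g [^] m <# H) - (snd k (g <# H) - snd k H)) \<le> (1/2) * ?E g"
        using near[OF WD(1)[OF m] WD(2)[OF gW] U(4)] .
      then have "cdist k (g [^] m <# (g <# H)) (g [^] m <# H) \<le> 2 * ?E g"
        using norm_triangle_sub[of "snd k (g [^] m <# (g <# H)) - snd k (g [^] m <# H)" "snd k (g <# H) - snd k H"]
          norm_ge_zero[of "snd k (g <# H) - snd k H"] by linarith
      moreover have "g [^] m <# (g <# H) = g [^] Suc m <# H" using g by (simp add: act_coset)
      moreover have "?E (g [^] Suc m) \<le> cdist k (g [^] Suc m <# H) (g [^] m <# H) + ?E (g [^] m)"
        by (metis dist_norm dist_triangle)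
      ultimately show ?case using IH by (simp add: algebra_simps)
    qed simp
  next
    fix g assume "g \<in> W" "?E g = 0"
    then have "snd k (g <# H) = snd k H" "g <# H \<in> fst k" "g \<in> carrier G" using WD by auto
    then have "g <# H = H"
      using inj_onD[OF is_chartD(3)[OF chk(1)]] chk(3) by blast
    then show "g \<in> H" using coset_eq_H_iff \<open>g \<in> carrier G\<close> by blast
  qed (use that in auto)
qed

end

section \<open>Comparison of the invariant metric with chart distances\<close>

definition chart_comparable :: "('a, 'e::real_normed_vector) chart \<Rightarrow> 'a set \<Rightarrow> ('a \<Rightarrow> 'a \<Rightarrow> real) \<Rightarrow> bool"
  where "chart_comparable \<kappa> U D \<longleftrightarrow> (\<exists>a A. a > 0 \<and> A > 0 \<and>
    (\<forall>x\<in>U. \<forall>y\<in>U. a * cdist \<kappa> x y \<le> D x y \<and> D x y \<le> A * cdist \<kappa> x y))"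

context homogeneous_metric
begin

text \<open>For a minimal representative \<open>g\<close> of \<open>P\<close>, both
  \<open>D H P\<close> and the chart distance of \<open>P\<close> and \<open>H\<close> are
  comparable to the norm of \<open>g\<close>; eliminating this norm compares them with each
  other.\<close>

lemma D_base_comparison:
  assumes k: "k \<in> charts_at Q H"
  obtains U a A where "openin (mtop Q) U" "H \<in> U" "U \<subseteq> fst k" "a > 0" "A > 0"
    "\<And>P. P \<in> U \<Longrightarrow> a * cdist k P H \<le> D H P \<and> D H P \<le> A * cdist k P H"
proof -
  note chk = charts_atD[OF smooth_Q k]
  obtain c L U0 where c: "c \<in> charts_at GM \<one>" and U0: "openin (mtop GM) U0" "\<one> \<in> U0" "U0 \<subseteq> fst c"
    and L: "\<And>g. g \<in> U0 \<Longrightarrow> D H (g <# H) \<le> L * cdist c g \<one>"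
    using D_lip by blast
  have "k \<in> charts_at Q (\<one> <# H)" using k by simp
  then obtain U1 U2 L' where U1: "openin (mtop GM) U1" "\<one> \<in> U1" "U1 \<subseteq> fst c"
    and U2: "H \<in> U2" "U2 \<subseteq> fst k" and "L' > 0"
    and inU: "\<And>x y. x \<in> U1 \<Longrightarrow> y \<in> U2 \<Longrightarrow> x <# y \<in> fst k"
    and L'0: "\<And>x x' y y'. x \<in> U1 \<Longrightarrow> x' \<in> U1 \<Longrightarrow> y \<in> U2 \<Longrightarrow> y' \<in> U2 \<Longrightarrow>
       cdist k (x <# y) (x' <# y') \<le> L' * (cdist c x x' + cdist k y y')"
    by (rule smooth_map2_lipschitz[OF lcGM lcQ lcQ smooth_act c k]) auto
  have L': "cdist k (g <# H) H \<le> L' * cdist c g \<one>" if "g \<in> U1" for g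
    using L'0[OF that U1(2) U2(1) U2(1)] by simp
  obtain c1 r1 where c1: "c1 > 0" "r1 > 0" "\<And>g. g \<in> fst c \<Longrightarrow> cdist c g \<one> < r1 \<Longrightarrow> minimal_in_coset c g \<Longrightarrow>
      c1 * cdist c g \<one> \<le> D H (g <# H)"
    using D_lower_bound[OF c] by metis
  obtain c2 r2 where c2: "c2 > 0" "r2 > 0" "\<And>g. g \<in> fst c \<Longrightarrow> cdist c g \<one> < r2 \<Longrightarrow> minimal_in_coset c g \<Longrightarrow>
      c2 * cdist c g \<one> \<le> cdist k (g <# H) H"
    using chart_lower_bound[OF c k] by metis
  have "openin (mtop GM) (U0 \<inter> U1)" "\<one> \<in> U0 \<inter> U1" using U0 U1 by auto
  then obtain r3 where "r3 > 0" and r3: "\<And>g. g \<in> fst c \<Longrightarrow> cdist c g \<one> \<le> r3 \<Longrightarrow> g \<in> U0 \<inter> U1"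
    using group_ball[OF c] by metis
  define r where "r = min r1 (min r2 r3)"
  have r: "r > 0" "r \<le> r1" "r \<le> r2" "r \<le> r3" using c1 c2 \<open>r3 > 0\<close> by (auto simp: r_def)
  obtain U where U: "openin (mtop Q) U" "H \<in> U"
    and rep: "\<And>P. P \<in> U \<Longrightarrow> \<exists>g\<in>fst c. cdist c g \<one> < r \<and> g <# H = P \<and> minimal_in_coset c g"
    using minimal_representatives[OF c r(1)] by metis
  have key: "P \<in> fst k \<and> (c1 / L') * cdist k P H \<le> D H P \<and> D H P \<le> ((\<bar>L\<bar> + 1) / c2) * cdist k P H"
    if P: "P \<in> U" for P
  proof -
    obtain g where g: "g \<in> fst c" "cdist c g \<one> < r" "g <# H = P" "minimal_in_coset c g"
      using rep[OF P] by blast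
    let ?n = "cdist c g \<one>"
    have gU: "g \<in> U0" "g \<in> U1" using r3[OF g(1)] g(2) r(4) by auto
    have 1: "c1 * ?n \<le> D H P" using c1(3)[OF g(1) _ g(4)] g r(2) by simp
    have 2: "c2 * ?n \<le> cdist k P H" using c2(3)[OF g(1) _ g(4)] g r(3) by simp
    have 3: "cdist k P H \<le> L' * ?n" using L'[OF gU(2)] g(3) by simp
    have "D H P \<le> L * ?n" using L[OF gU(1)] g(3) by simp
    also have "\<dots> \<le> (\<bar>L\<bar> + 1) * ?n" by (intro mult_right_mono) auto
    also have "\<dots> = ((\<bar>L\<bar> + 1) / c2) * (c2 * ?n)" using c2(1) by simp
    also have "\<dots> \<le> ((\<bar>L\<bar> + 1) / c2) * cdist k P H"
      using 2 c2(1) by (intro mult_left_mono) auto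
    finally have 4: "D H P \<le> ((\<bar>L\<bar> + 1) / c2) * cdist k P H" .
    have "(c1 / L') * cdist k P H \<le> (c1 / L') * (L' * ?n)"
      using 3 c1(1) \<open>L' > 0\<close> by (intro mult_left_mono) auto
    also have "\<dots> \<le> D H P" using 1 \<open>L' > 0\<close> by simp
    finally show ?thesis using 4 inU[OF gU(2) U2(1)] g(3) by simp
  qed
  show thesis
    by (rule that[OF U, of "c1 / L'" "(\<bar>L\<bar> + 1) / c2"]) (use key c1 c2 \<open>L' > 0\<close> in \<open>auto simp: add_nonneg_pos\<close>)
qed

text \<open>For \<open>x = g <# H\<close> invariance gives \<open>D x y = D H (inv g <# y)\<close>,
  so the comparison with the base point applies. Since \<open>inv g\<close> is near
  \<open>\<one>\<close>, it changes the coordinate difference of \<open>x\<close> and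
  \<open>y\<close> by at most one half of it; this costs a factor 2.\<close>

lemma D_chart_comparable_base:
  assumes k: "k \<in> charts_at Q H"
  obtains U where "openin (mtop Q) U" "H \<in> U" "U \<subseteq> fst k" "chart_comparable k U D"
proof -
  note chk = charts_atD[OF smooth_Q k]
  obtain U a A where U: "openin (mtop Q) U" "H \<in> U" "U \<subseteq> fst k" and aA: "a > 0" "A > 0"
    and cmp: "\<And>P. P \<in> U \<Longrightarrow> a * cdist k P H \<le> D H P \<and> D H P \<le> A * cdist k P H"
    using D_base_comparison[OF k] by metis
  obtain c where c: "c \<in> charts_at GM \<one>"
    using chart_exists[OF smooth_GM] one_closed topGM by metis
  obtain V1 V2 where V: "openin (mtop GM) V1" "\<one> \<in> V1" "openin (mtop Q) V2" "H \<in> V2"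
    and near: "\<And>x y y'. x \<in> V1 \<Longrightarrow> y \<in> V2 \<Longrightarrow> y' \<in> V2 \<Longrightarrow>
       norm (snd k (x <# y) - snd k (x <# y') - (snd k y - snd k y')) \<le> (1/2) * cdist k y y'"
    by (rule smooth_action_near_identity[OF lcGM lcQ smooth_act c k, of "1/2"]) auto
  obtain W1 O1 where W1: "openin (mtop GM) W1" "\<one> \<in> W1" "openin (mtop Q) O1" "H \<in> O1"
    and inU: "\<And>x y. x \<in> W1 \<Longrightarrow> y \<in> O1 \<Longrightarrow> inv x <# y \<in> U"
    by (rule prod_nbhd[where f = "\<lambda>x y. inv x <# y", OF cont_inv_act U(1), of \<one> H]) (use U(2) in auto)
  define W where "W = W1 \<inter> {g \<in> topspace (mtop GM). inv g \<in> V1}"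
  have W: "openin (mtop GM) W" "\<one> \<in> W"
    using W1 V openin_Int[OF W1(1) openin_continuous_map_preimage[OF cont_inv V(1)]] unfolding W_def by auto
  \<comment> \<open>The coset map is open, so all cosets near \<open>H\<close> have a representative
    in \<open>W\<close>.\<close>
  define O' where "O' = (\<lambda>g. g <# H) ` W \<inter> O1 \<inter> V2 \<inter> U"
  have O': "openin (mtop Q) O'" "H \<in> O'" "O' \<subseteq> fst k"
    using open_coset_image[OF W(1)] W(2) W1 V U unfolding O'_def by (auto intro!: image_eqI[of _ _ \<one>])
  have "(a/2) * cdist k x y \<le> D x y \<and> D x y \<le> (2 * A) * cdist k x y"
    if x: "x \<in> O'" and y: "y \<in> O'" for x y
  proof -
    obtain g where g: "g \<in> W" "x = g <# H" using x unfolding O'_def by blast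
    have gc: "g \<in> carrier G" "g \<in> W1" "inv g \<in> V1" using g(1) by (auto simp: W_def)
    have xy: "x \<in> V2" "y \<in> V2" "y \<in> O1" using x y by (auto simp: O'_def)
    have yl: "y \<in> lcosets H" using openin_subset[OF O'(1)] y by auto
    define P where "P = inv g <# y"
    have P: "P \<in> U" using inU[OF gc(2) xy(3)] by (simp add: P_def)
    have gx: "inv g <# x = H" using g gc by simp
    have DP: "D x y = D H P"
      using D_inv[of "inv g" x y] gc(1) g(2) yl gx by (simp add: P_def)
    let ?p = "snd k P - snd k H" and ?q = "snd k y - snd k x"
    have "norm (?p - ?q) \<le> (1/2) * norm ?q"
      using near[OF gc(3) xy(2) xy(1)] gx by (simp add: P_def)
    then have "norm ?p \<le> 2 * norm ?q" "norm ?q \<le> 2 * norm ?p"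
      using norm_triangle_sub[of ?p ?q] norm_triangle_sub[of ?q ?p] norm_minus_commute[of ?p ?q] norm_ge_zero[of ?q]
      by linarith+
    then have "a * (norm ?q / 2) \<le> a * norm ?p" "A * norm ?p \<le> A * (2 * norm ?q)"
      using aA by auto
    then show ?thesis
      using cmp[OF P] DP by (simp add: norm_minus_commute algebra_simps)
  qed
  then have "chart_comparable k O' D"
    unfolding chart_comparable_def using aA by (intro exI[of _ "a/2"] exI[of _ "2 * A"]) auto
  then show thesis using that O' by blast
qed

lemma act_chart_lipschitz:
  assumes g: "g \<in> carrier G" and k: "k \<in> charts_at Q P" and k': "k' \<in> charts_at Q (g <# P)"
  obtains U L where "openin (mtop Q) U" "P \<in> U" "U \<subseteq> fst k" "L > 0"
    "\<And>y. y \<in> U \<Longrightarrow> g <# y \<in> fst k'"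
    "\<And>y y'. y \<in> U \<Longrightarrow> y' \<in> U \<Longrightarrow> cdist k' (g <# y) (g <# y') \<le> L * cdist k y y'"
proof -
  obtain c where c: "c \<in> charts_at GM g"
    using chart_exists[OF smooth_GM] g topGM by metis
  obtain U1 U2 L where U: "openin (mtop GM) U1" "g \<in> U1" "U1 \<subseteq> fst c" "openin (mtop Q) U2" "P \<in> U2" "U2 \<subseteq> fst k" "L > 0"
    and inU: "\<And>x y. x \<in> U1 \<Longrightarrow> y \<in> U2 \<Longrightarrow> x <# y \<in> fst k'"
    and L: "\<And>x x' y y'. x \<in> U1 \<Longrightarrow> x' \<in> U1 \<Longrightarrow> y \<in> U2 \<Longrightarrow> y' \<in> U2 \<Longrightarrow>
       cdist k' (x <# y) (x' <# y') \<le> L * (cdist c x x' + cdist k y y')"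
    by (rule smooth_map2_lipschitz[OF lcGM lcQ lcQ smooth_act c k k']) auto
  show thesis
  proof (rule that[OF U(4-7)])
    show "cdist k' (g <# y) (g <# y') \<le> L * cdist k y y'" if "y \<in> U2" "y' \<in> U2" for y y'
      using L[OF U(2) U(2) that] by simp
  qed (use inU U(2) in auto)
qed

text \<open>Transport from the base point: \<open>D\<close> does not change under translation, and a
  translation and its inverse are both locally Lipschitz in charts.\<close>

theorem D_chart_comparable:
  assumes P: "P \<in> lcosets H" and k': "k' \<in> charts_at Q P"
  obtains U where "openin (mtop Q) U" "P \<in> U" "U \<subseteq> fst k'" "chart_comparable k' U D"
proof -
  obtain g where g: "g \<in> carrier G" "P = g <# H" using P by (rule lcosetsE)
  obtain k where k: "k \<in> charts_at Q H"
    using chart_exists[OF smooth_Q] H_in topQ by metis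
  have gP: "inv g <# P = H" using g by simp
  obtain U where U: "openin (mtop Q) U" "H \<in> U" and cmp: "chart_comparable k U D"
    using D_chart_comparable_base[OF k] by metis
  then obtain a A where aA: "a > 0" "A > 0" and aA': "\<And>x y. x \<in> U \<Longrightarrow> y \<in> U \<Longrightarrow>
      a * cdist k x y \<le> D x y \<and> D x y \<le> A * cdist k x y"
    unfolding chart_comparable_def by blast
  have kk: "k' \<in> charts_at Q (g <# H)" "k \<in> charts_at Q (inv g <# P)" using k k' g gP by auto
  obtain U1 L1 where U1: "openin (mtop Q) U1" "H \<in> U1" and "L1 > 0"
    and L1: "\<And>y y'. y \<in> U1 \<Longrightarrow> y' \<in> U1 \<Longrightarrow> cdist k' (g <# y) (g <# y') \<le> L1 * cdist k y y'"
    using act_chart_lipschitz[OF g(1) k kk(1)] by metis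
  obtain U2 L2 where U2: "openin (mtop Q) U2" "P \<in> U2" "U2 \<subseteq> fst k'" and "L2 > 0"
    and L2: "\<And>y y'. y \<in> U2 \<Longrightarrow> y' \<in> U2 \<Longrightarrow> cdist k (inv g <# y) (inv g <# y') \<le> L2 * cdist k' y y'"
    using act_chart_lipschitz[OF inv_closed[OF g(1)] k' kk(2)] by metis
  define O' where "O' = (\<lambda>P. g <# P) ` (U \<inter> U1) \<inter> U2"
  have O': "openin (mtop Q) O'" "P \<in> O'" "O' \<subseteq> fst k'"
    using open_act[OF g(1) openin_Int[OF U(1) U1(1)]] U U1 U2 g(2) unfolding O'_def by auto
  have "(a / L1) * cdist k' x y \<le> D x y \<and> D x y \<le> (A * L2) * cdist k' x y"
    if x: "x \<in> O'" and y: "y \<in> O'" for x y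
  proof -
    obtain u v where uv: "u \<in> U" "u \<in> U1" "x = g <# u" "v \<in> U" "v \<in> U1" "y = g <# v" using x y unfolding O'_def by blast
    have l: "u \<in> lcosets H" "v \<in> lcosets H" using openin_subset[OF U(1)] uv by auto
    have DD: "D x y = D u v" using D_inv[OF g(1) l] uv by simp
    have "cdist k u v \<le> L2 * cdist k' x y"
      using L2[of x y] x y uv g(1) l by (simp add: O'_def)
    then have "A * cdist k u v \<le> A * (L2 * cdist k' x y)"
      using aA by simp
    moreover have "cdist k' x y \<le> L1 * cdist k u v"
      using L1[OF uv(2,5)] uv by simp
    then have "(a / L1) * cdist k' x y \<le> (a / L1) * (L1 * cdist k u v)"
      using aA \<open>L1 > 0\<close> by (intro mult_left_mono) auto
    moreover have "(a / L1) * (L1 * cdist k u v) = a * cdist k u v"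
      using \<open>L1 > 0\<close> by simp
    ultimately show ?thesis
      using aA'[OF uv(1,4)] DD by (simp add: mult.assoc)
  qed
  then have "chart_comparable k' O' D"
    unfolding chart_comparable_def using aA \<open>L1 > 0\<close> \<open>L2 > 0\<close> by (intro exI[of _ "a / L1"] exI[of _ "A * L2"]) auto
  then show thesis using that O' by blast
qed

end

section \<open>The intrinsic metric\<close>

lemma path_length_ge_dist:
  assumes "t \<in> {0..1}"
  shows "d (\<gamma> t) (\<gamma> 0) \<le> path_length d \<gamma>"
proof -
  \<comment> \<open>The partition \<open>0, t, 1\<close>. It is admissible for \<open>t = 0\<close>
    and \<open>t = 1\<close> as well, because partition points may coincide.\<close>
  define s :: "nat \<Rightarrow> real" where "s i = (if i = 0 then 0 else if i = 1 then t else 1)" for i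
  have "(\<Sum>i<2. d (\<gamma> (s (Suc i))) (\<gamma> (s i))) \<le> path_length d \<gamma>"
    unfolding path_length_def
    by (rule SUP_upper2[of "(2, s)"]) (use assms in \<open>auto simp: s_def less_2_cases_iff\<close>)
  moreover have "d (\<gamma> t) (\<gamma> 0) \<le> (\<Sum>i<2. d (\<gamma> (s (Suc i))) (\<gamma> (s i)))"
    by (simp add: s_def numeral_2_eq_2)
  ultimately show ?thesis by (rule order_trans[rotated])
qed

text \<open>The bounds on the pieces of a partition telescope to \<open>K\<close>.\<close>

lemma path_length_le_lipschitz:
  assumes lip: "\<And>s t. 0 \<le> s \<Longrightarrow> s \<le> t \<Longrightarrow> t \<le> 1 \<Longrightarrow> d (\<gamma> t) (\<gamma> s) \<le> ennreal (K * (t - s))" and "K \<ge> 0"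
  shows "path_length d \<gamma> \<le> ennreal K"
  unfolding path_length_def
proof (rule SUP_least, clarify)
  fix n and t :: "nat \<Rightarrow> real" assume t: "t 0 = 0" "t n = 1" and mono: "\<forall>i<n. t i \<le> t (Suc i)"
  have le: "t i \<le> t j" if "i \<le> j" "j \<le> n" for i j
    using that
  proof (induction rule: dec_induct)
    case (step m)
    then show ?case using mono[rule_format, of m] by simp
  qed simp
  have "(\<Sum>i<n. d (\<gamma> (t (Suc i))) (\<gamma> (t i))) \<le> (\<Sum>i<n. ennreal (K * (t (Suc i) - t i)))"
  proof (intro sum_mono lip)
    fix i assume "i \<in> {..<n}"
    then show "0 \<le> t i" "t i \<le> t (Suc i)" "t (Suc i) \<le> 1"
      using le[of 0 i] le[of i "Suc i"] le[of "Suc i" n] t by auto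
  qed
  also have "\<dots> = ennreal (\<Sum>i<n. K * (t (Suc i) - t i))"
    using mono \<open>K \<ge> 0\<close> by (intro sum_ennreal) auto
  also have "(\<Sum>i<n. K * (t (Suc i) - t i)) = K"
    using t by (simp flip: sum_distrib_left add: sum_lessThan_telescope)
  finally show "(\<Sum>i<n. d (\<gamma> (t (Suc i))) (\<gamma> (t i))) \<le> ennreal K" .
qed

lemma topspace_emetric_topology [simp]: "topspace (emetric_topology S d) = S"
proof
  show "topspace (emetric_topology S d) \<subseteq> S"
    using openin_topspace[of "emetric_topology S d"] unfolding openin_emetric_topology by blast
  have "openin (emetric_topology S d) S"
    unfolding openin_emetric_topology by (auto intro: exI[of _ 1])
  then show "S \<subseteq> topspace (emetric_topology S d)" by (rule openin_subset)
qed

lemma emetric_openin_mono: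
  assumes "\<And>x y. x \<in> S \<Longrightarrow> y \<in> S \<Longrightarrow> d x y \<le> d' x y" and U: "openin (emetric_topology S d) U"
  shows "openin (emetric_topology S d') U"
  using U assms(1) unfolding openin_emetric_topology by (meson le_less_trans subsetD)

text \<open>A local upper bound by a chart distance puts a manifold neighborhood into every ball of
  \<open>d\<close>. It serves both for \<open>d\<^sub>X\<close> and for its intrinsic
  metric.\<close>

lemma openin_manifold_if_emetric:
  fixes N :: "('a, 'e::euclidean_space) mfd"
  assumes N: "smooth_manifold N" and S: "topspace (mtop N) = S"
    and up: "\<And>x. x \<in> S \<Longrightarrow> \<exists>\<kappa>\<in>charts_at N x. \<exists>U A. openin (mtop N) U \<and> x \<in> U \<and> U \<subseteq> fst \<kappa> \<and> A > 0 \<and>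
      (\<forall>y\<in>U. d x y \<le> ennreal (A * cdist \<kappa> x y))"
    and V: "openin (emetric_topology S d) V"
  shows "openin (mtop N) V"
proof (subst openin_subopen, intro ballI)
  fix x assume x: "x \<in> V"
  then have xS: "x \<in> S" using V unfolding openin_emetric_topology by blast
  obtain r where r: "r > 0" "\<And>y. y \<in> S \<Longrightarrow> d x y < r \<Longrightarrow> y \<in> V"
    using V x unfolding openin_emetric_topology by blast
  \<comment> \<open>The radius may be infinite; a finite one is needed to choose a coordinate
    radius.\<close>
  obtain r' :: real where r': "r' > 0" "ennreal r' \<le> r"
  proof (cases r)
    case (real q)
    then show ?thesis using r(1) that[of q] by (cases "q = 0") auto
  next
    case top
    then show ?thesis using that[of 1] by simp
  qed
  obtain \<kappa> U A where \<kappa>: "\<kappa> \<in> charts_at N x" and U: "openin (mtop N) U" "x \<in> U" "U \<subseteq> fst \<kappa>" "A > 0"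
    and A: "\<And>y. y \<in> U \<Longrightarrow> d x y \<le> ennreal (A * cdist \<kappa> x y)"
    using up[OF xS] by blast
  define W where "W = U \<inter> {y \<in> fst \<kappa>. snd \<kappa> y \<in> ball (snd \<kappa> x) (r' / A)}"
  have "openin (mtop N) W" "x \<in> W"
    using U r' charts_atD(3)[OF N \<kappa>] is_chart_preimage_open[OF charts_atD(1)[OF N \<kappa>] open_ball]
    by (auto simp: W_def)
  moreover have "W \<subseteq> V"
  proof
    fix y assume y: "y \<in> W"
    then have "A * cdist \<kappa> x y < r'"
      using U(4) by (simp add: W_def dist_norm field_simps)
    then have "ennreal (A * cdist \<kappa> x y) < ennreal r'"
      using r'(1) by (intro ennreal_lessI) auto
    moreover have "d x y \<le> ennreal (A * cdist \<kappa> x y)"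
      using A y by (simp add: W_def)
    ultimately have "d x y < r" using r'(2) by (meson le_less_trans less_le_trans)
    moreover have "y \<in> S" using y openin_subset[OF U(1)] S by (auto simp: W_def)
    ultimately show "y \<in> V" using r(2) by blast
  qed
  ultimately show "\<exists>T. openin (mtop N) T \<and> x \<in> T \<and> T \<subseteq> V" by blast
qed

text \<open>Path lengths are formed with extended distances. \<open>dX\<close> coincides with the
  finite metric \<open>D\<close> on cosets; no equality is required on other sets.\<close>

locale homogeneous_emetric = homogeneous_metric +
  fixes dX :: "'a set \<Rightarrow> 'a set \<Rightarrow> ennreal"
  assumes dX: "\<And>P R. P \<in> lcosets H \<Longrightarrow> R \<in> lcosets H \<Longrightarrow> dX P R = ennreal (D P R)"
begin

abbreviation dhat where "dhat \<equiv> intrinsic_dist (lcosets H) dX"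

lemma emetric_path_in:
  fixes \<gamma> :: "real \<Rightarrow> 'a set"
  assumes "continuous_map (top_of_set {0..1}) (emetric_topology (lcosets H) dX) \<gamma>" "t \<in> {0..1}"
  shows "\<gamma> t \<in> lcosets H"
  using assms by (auto simp: continuous_map_def)

lemma dX_le_dhat:
  assumes "P \<in> lcosets H" "R \<in> lcosets H"
  shows "dX P R \<le> dhat P R"
  unfolding intrinsic_dist_def
proof (rule INF_greatest, clarify)
  fix \<gamma> :: "real \<Rightarrow> 'a set"
  assume "P = \<gamma> 0" "R = \<gamma> 1"
  then show "dX (\<gamma> 0) (\<gamma> 1) \<le> path_length dX \<gamma>"
    using path_length_ge_dist[of 1 dX \<gamma>] assms dX D_commute by simp
qed

lemma openin_Q_if_emetric_dX:
  assumes "openin (emetric_topology (lcosets H) dX) V"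
  shows "openin (mtop Q) V"
proof (rule openin_manifold_if_emetric[OF smooth_Q topQ _ assms])
  fix P assume P: "P \<in> lcosets H"
  obtain k where k: "k \<in> charts_at Q P" using chart_exists[OF smooth_Q] P topQ by metis
  obtain U where U: "openin (mtop Q) U" "P \<in> U" "U \<subseteq> fst k" "chart_comparable k U D"
    using D_chart_comparable[OF P k] by metis
  then obtain A where "A > 0" "\<And>x y. x \<in> U \<Longrightarrow> y \<in> U \<Longrightarrow> D x y \<le> A * cdist k x y"
    unfolding chart_comparable_def by blast
  moreover have "U \<subseteq> lcosets H" using openin_subset[OF U(1)] by simp
  ultimately show "\<exists>k\<in>charts_at Q P. \<exists>U A. openin (mtop Q) U \<and> P \<in> U \<and> U \<subseteq> fst k \<and> A > 0 \<and>
      (\<forall>y\<in>U. dX P y \<le> ennreal (A * cdist k P y))"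
    using k U(1-3) P dX by (intro bexI[OF _ k] exI[of _ U] exI[of _ A]) (auto intro!: ennreal_leI)
qed

text \<open>A chart segment is continuous for the manifold topology, hence for the coarser topology
  of \<open>dX\<close>. The bound of \<open>D\<close> by the chart distance makes \<open>dX\<close>
  Lipschitz along it.\<close>

lemma dhat_chart_upper:
  assumes P: "P \<in> lcosets H" and k: "k \<in> charts_at Q P"
  obtains U a A where "openin (mtop Q) U" "P \<in> U" "U \<subseteq> fst k" "a > 0" "A > 0"
    "\<And>x y. x \<in> U \<Longrightarrow> y \<in> U \<Longrightarrow> a * cdist k x y \<le> D x y \<and> D x y \<le> A * cdist k x y"
    "\<And>x y. x \<in> U \<Longrightarrow> y \<in> U \<Longrightarrow> dhat x y \<le> ennreal (A * cdist k x y)"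
proof -
  note ch = charts_atD[OF smooth_Q k]
  obtain U0 where U0: "openin (mtop Q) U0" "P \<in> U0" "U0 \<subseteq> fst k" "chart_comparable k U0 D"
    using D_chart_comparable[OF P k] by metis
  then obtain a A where aA: "a > 0" "A > 0"
    and cmp: "\<And>x y. x \<in> U0 \<Longrightarrow> y \<in> U0 \<Longrightarrow> a * cdist k x y \<le> D x y \<and> D x y \<le> A * cdist k x y"
    unfolding chart_comparable_def by blast
  have U0l: "U0 \<subseteq> lcosets H" using openin_subset[OF U0(1)] by simp
  obtain \<rho> where "\<rho> > 0" and \<rho>: "\<And>z. z \<in> model Q \<Longrightarrow> z \<in> cball (snd k P) \<rho> \<Longrightarrow> z \<in> snd k ` fst k"
    "\<And>z. z \<in> model Q \<Longrightarrow> z \<in> cball (snd k P) \<rho> \<Longrightarrow> chart_inv k z \<in> U0"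
    using is_chart_nbhd[OF ch(1) U0(1,2) ch(3)] by metis
  define U where "U = {x \<in> fst k. snd k x \<in> ball (snd k P) \<rho>}"
  have inU0: "x \<in> U0" if "x \<in> fst k" "snd k x \<in> cball (snd k P) \<rho>" for x
    using \<rho>(2)[of "snd k x"] that is_chartD(4)[OF ch(1)] ch(1) by force
  show thesis
  proof (rule that[of U a A])
    show "openin (mtop Q) U" unfolding U_def by (rule is_chart_preimage_open[OF ch(1) open_ball])
    show "P \<in> U" "U \<subseteq> fst k" using ch(3) \<open>\<rho> > 0\<close> by (auto simp: U_def)
    fix x y assume "x \<in> U" "y \<in> U"
    then have x: "x \<in> fst k" "snd k x \<in> cball (snd k P) \<rho>" and y: "y \<in> fst k" "snd k y \<in> cball (snd k P) \<rho>"
      by (auto simp: U_def)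
    show "a * cdist k x y \<le> D x y \<and> D x y \<le> A * cdist k x y"
      using cmp inU0 x y by blast
    let ?\<gamma> = "chart_segment k x y"
    note seg = chart_segment_facts[OF ch(1,5) \<rho>(1) x y]
    have "continuous_map (top_of_set {0..1}) (emetric_topology (lcosets H) dX) ?\<gamma>"
      unfolding continuous_map_def
    proof (intro conjI allI impI)
      show "?\<gamma> \<in> topspace (top_of_set {0..1}) \<rightarrow> topspace (emetric_topology (lcosets H) dX)"
        using inU0 seg(3,5) U0l by auto
      fix V assume "openin (emetric_topology (lcosets H) dX) V"
      then show "openin (top_of_set {0..1}) {t \<in> topspace (top_of_set {0..1}). ?\<gamma> t \<in> V}"
        by (intro openin_continuous_map_preimage[OF seg(6)] openin_Q_if_emetric_dX)
    qed
    then have "dhat x y \<le> path_length dX ?\<gamma>"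
      unfolding intrinsic_dist_def using seg(1,2) by (intro INF_lower) auto
    also have "\<dots> \<le> ennreal (A * cdist k x y)"
    proof (rule path_length_le_lipschitz)
      fix s t :: real assume st: "0 \<le> s" "s \<le> t" "t \<le> 1"
      then have g: "?\<gamma> s \<in> U0" "?\<gamma> t \<in> U0" using inU0 seg(3,5) by auto
      have "snd k (?\<gamma> t) - snd k (?\<gamma> s) = (t - s) *\<^sub>R (snd k y - snd k x)"
        using seg(4)[of s] seg(4)[of t] st by (simp add: algebra_simps)
      then have "cdist k (?\<gamma> t) (?\<gamma> s) = cdist k x y * (t - s)"
        using st by (simp add: norm_minus_commute)
      then have "D (?\<gamma> t) (?\<gamma> s) \<le> A * cdist k x y * (t - s)"
        using cmp[OF g(2,1)] by (simp add: mult.assoc)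
      then show "dX (?\<gamma> t) (?\<gamma> s) \<le> ennreal (A * cdist k x y * (t - s))"
        using dX g U0l by (auto intro!: ennreal_leI simp: subset_iff)
    qed (use aA in simp)
    finally show "dhat x y \<le> ennreal (A * cdist k x y)" .
  qed (use aA in auto)
qed

lemma D_continuous:
  assumes "P \<in> lcosets H"
  shows "continuous_map (mtop Q) euclideanreal (D P)"
  using D_coset_continuous[OF assms] continuous_compose_quotient_map_eq[OF quot, of euclideanreal "D P"]
  by (simp add: o_def)

text \<open>A \<open>dX\<close>-continuous path need not a priori be continuous into
  \<open>Q\<close>. Still, a compact set of \<open>Q\<close> is closed even for \<open>dX\<close>,
  because \<open>D y\<close> attains a positive minimum on it for every \<open>y\<close>
  outside.\<close>

lemma compact_preimage_closed:
  fixes \<gamma> :: "real \<Rightarrow> 'a set"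
  assumes \<gamma>: "continuous_map (top_of_set {0..1}) (emetric_topology (lcosets H) dX) \<gamma>" and K: "compactin (mtop Q) K"
  shows "closed {t \<in> {0..1}. \<gamma> t \<in> K}"
proof -
  have KS: "K \<subseteq> lcosets H" using compactin_subset_topspace[OF K] by simp
  have "openin (emetric_topology (lcosets H) dX) (lcosets H - K)"
    unfolding openin_emetric_topology
  proof (intro conjI ballI)
    fix y assume y: "y \<in> lcosets H - K"
    show "\<exists>r>0. \<forall>w\<in>lcosets H. dX y w < r \<longrightarrow> w \<in> lcosets H - K"
    proof (cases "K = {}")
      case True
      then show ?thesis by (intro exI[of _ 1]) auto
    next
      case False
      have "compact (D y ` K)"
        using image_compactin[OF K D_continuous[of y]] y by simp
      then obtain m where m: "m \<in> K" "\<And>w. w \<in> K \<Longrightarrow> D y m \<le> D y w"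
        using compact_attains_inf[of "D y ` K"] False by auto
      have "D y m \<noteq> 0" using D_zero[of y m] y m(1) KS by auto
      then have "D y m > 0" using D_nonneg[of y m] by linarith
      then show ?thesis
        using m(2) y dX by (intro exI[of _ "ennreal (D y m)"]) (force simp: ennreal_less_iff not_less[symmetric])
    qed
  qed auto
  from openin_continuous_map_preimage[OF \<gamma> this]
  have op: "openin (top_of_set {0..1}) {t \<in> {0..1}. \<gamma> t \<in> lcosets H - K}" by simp
  have eq: "{0..1} - {t \<in> {0..1}. \<gamma> t \<in> K} = {t \<in> {0..1}. \<gamma> t \<in> lcosets H - K}"
    using emetric_path_in[OF \<gamma>] by blast
  have "closedin (top_of_set {0..1}) {t \<in> {0..1}. \<gamma> t \<in> K}"
    unfolding closedin_def topspace_euclidean_subtopology eq using op by blast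
  then show ?thesis
    by (rule closedin_closed_trans) simp
qed

text \<open>
  A path that is continuous for \<open>dX\<close> only might a priori jump between the countably many sheets into
  which a \<open>dX\<close>-ball splits in the quotient topology. Each sheet is the trace of a compact set, so
  its preimage under the path is closed, and Sierpinski's theorem leaves room for one sheet only.
\<close>

lemma short_paths_stay_local:
  assumes k: "k \<in> charts_at Q H"
    and U: "openin (mtop Q) U" "H \<in> U" "U \<subseteq> fst k" and a: "a > 0"
    and low: "\<And>y. y \<in> U \<Longrightarrow> a * cdist k H y \<le> D H y"
  obtains r where "r > 0"
    "\<And>(\<gamma> :: real \<Rightarrow> 'a set) g. continuous_map (top_of_set {0..1}) (emetric_topology (lcosets H) dX) \<gamma> \<Longrightarrow> g \<in> carrier G \<Longrightarrow>
      \<gamma> 0 = g <# H \<Longrightarrow> (\<And>t. t \<in> {0..1} \<Longrightarrow> D (g <# H) (\<gamma> t) < r) \<Longrightarrow> inv g <# \<gamma> 1 \<in> U"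
proof -
  note ch = charts_atD[OF smooth_Q k]
  obtain \<rho> where "\<rho> > 0" and \<rho>: "\<And>z. z \<in> model Q \<Longrightarrow> z \<in> cball (snd k H) \<rho> \<Longrightarrow> z \<in> snd k ` fst k"
    "\<And>z. z \<in> model Q \<Longrightarrow> z \<in> cball (snd k H) \<rho> \<Longrightarrow> chart_inv k z \<in> U"
    using is_chart_nbhd[OF ch(1) U(1,2) ch(3)] by metis
  define V where "V = {x \<in> fst k. snd k x \<in> ball (snd k H) \<rho>}"
  define N where "N = {x \<in> fst k. snd k x \<in> cball (snd k H) (\<rho>/2)}"
  have V: "openin (mtop Q) V" "H \<in> V"
    unfolding V_def using is_chart_preimage_open[OF ch(1) open_ball] ch(3) \<open>\<rho> > 0\<close> by auto
  have VU: "V \<subseteq> U"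
  proof
    fix x assume "x \<in> V"
    then show "x \<in> U"
      using \<rho>(2)[of "snd k x"] is_chartD(4)[OF ch(1)] ch(1) by (force simp: V_def)
  qed
  have NV: "N \<subseteq> V" using \<open>\<rho> > 0\<close> by (auto simp: N_def V_def)
  have half: "cball (snd k H) (\<rho>/2) \<subseteq> cball (snd k H) \<rho>"
    using \<open>\<rho> > 0\<close> by (intro subset_cball) simp
  have "compactin (mtop Q) N"
    unfolding N_def using \<rho>(1) half by (intro compactin_chart_cball[OF ch(1,5)]) blast
  \<comment> \<open>Two points in a \<open>D\<close>-ball of radius \<open>r\<close> are less than
    \<open>2 * r = a * \<rho> / 2\<close> apart. By the lower bound, points of \<open>V\<close> this
    close to \<open>H\<close> lie within \<open>\<rho>/2\<close> in the chart, that is, in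
    \<open>N\<close>.\<close>
  define r where "r = a * \<rho> / 4"
  have "r > 0" using a \<open>\<rho> > 0\<close> by (simp add: r_def)
  have trap: "y \<in> N" if "y \<in> V" "D H y < 2 * r" for y
  proof -
    have "a * cdist k H y \<le> D H y"
      using low that(1) VU by blast
    also have "\<dots> < a * (\<rho>/2)"
      using that(2) by (simp add: r_def mult.commute)
    finally have "cdist k H y < \<rho>/2"
      using a by (simp only: mult_less_cancel_left_pos)
    then show ?thesis using that(1) by (simp add: V_def N_def dist_norm)
  qed
  show thesis
  proof (rule that[OF \<open>r > 0\<close>])
    fix \<gamma> :: "real \<Rightarrow> 'a set" and g0
    assume \<gamma>: "continuous_map (top_of_set {0..1}) (emetric_topology (lcosets H) dX) \<gamma>"
      and g0: "g0 \<in> carrier G" and \<gamma>0: "\<gamma> 0 = g0 <# H"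
      and close: "\<And>t. t \<in> {0..1} \<Longrightarrow> D (g0 <# H) (\<gamma> t) < r"
    note \<gamma>in = emetric_path_in[OF \<gamma>]
    define B where "B = {y \<in> topspace (mtop Q). D (g0 <# H) y \<in> {..<r}}"
    have Bo: "openin (mtop Q) B"
      unfolding B_def using g0 by (intro openin_continuous_map_preimage[OF D_continuous]) auto
    have Bl: "B \<subseteq> lcosets H" by (auto simp: B_def)
    define cov where "cov g = B \<inter> (\<lambda>P. g <# P) ` V" for g
    define I where "I = {g \<in> carrier G. g <# H \<in> B}"
    \<comment> \<open>Inside \<open>B\<close> a translate of the open set \<open>V\<close> meets no
      more than the translate of the compact set \<open>N\<close>. This gap between \<open>N\<close>
      and \<open>V\<close> is what separates the sheets.\<close>
    have trap': "y \<in> (\<lambda>P. g <# P) ` N" if g: "g \<in> I" and y: "y \<in> B" "y \<in> (\<lambda>P. g <# P) ` V" for g y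
    proof -
      obtain v where v: "v \<in> V" "y = g <# v" using y(2) by blast
      have vl: "v \<in> lcosets H" using v(1) openin_subset[OF V(1)] by auto
      have gc: "g \<in> carrier G" "D (g0 <# H) (g <# H) < r" using g by (auto simp: I_def B_def)
      have "D H v = D (g <# H) y" using D_inv[OF gc(1) H_in vl] v(2) by simp
      also have "\<dots> \<le> D (g <# H) (g0 <# H) + D (g0 <# H) y"
        using gc g0 y(1) Bl by (intro D_triangle) auto
      also have "\<dots> < 2 * r"
        using gc(2) y(1) D_commute[of "g <# H" "g0 <# H"] by (simp add: B_def)
      finally show ?thesis using trap[OF v(1)] v(2) by blast
    qed
    \<comment> \<open>Second countability reduces the translates to countably many, as Sierpinski's
      theorem requires.\<close>
    have "Lindelof_space (subtopology (mtop Q) B)"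
      using smooth_Q by (intro second_countable_imp_Lindelof_space second_countable_subtopology) (simp add: smooth_manifold_def)
    moreover have "\<forall>W\<in>cov ` I. openin (subtopology (mtop Q) B) W"
    proof (rule ballI, erule imageE)
      fix W g assume "W = cov g" "g \<in> I"
      then show "openin (subtopology (mtop Q) B) W"
        unfolding cov_def by (auto intro!: openin_subtopology_Int2 open_act[OF _ V(1)] simp: I_def)
    qed
    moreover have "\<Union>(cov ` I) = topspace (subtopology (mtop Q) B)"
    proof
      show "\<Union>(cov ` I) \<subseteq> topspace (subtopology (mtop Q) B)"
        using Bl by (auto simp: cov_def)
      show "topspace (subtopology (mtop Q) B) \<subseteq> \<Union>(cov ` I)"
      proof
        fix y assume "y \<in> topspace (subtopology (mtop Q) B)"
        then have y: "y \<in> B" "y \<in> lcosets H" by auto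
        then obtain g where g: "g \<in> carrier G" "y = g <# H" using lcosetsE by metis
        then have "y \<in> cov g" using y V(2) by (auto simp: cov_def)
        then show "y \<in> \<Union>(cov ` I)" using g y by (auto simp: I_def)
      qed
    qed
    ultimately obtain \<V> where \<V>: "countable \<V>" "\<V> \<subseteq> cov ` I" "\<Union>\<V> = topspace (subtopology (mtop Q) B)"
      unfolding Lindelof_space_def by meson
    obtain C where C: "countable C" "C \<subseteq> I" "\<V> = cov ` C"
      using countable_subset_image[of \<V> cov I] \<V> by blast
    have g0I: "g0 \<in> I"
      using g0 \<open>r > 0\<close> D_zero[of "g0 <# H" "g0 <# H"] by (auto simp: I_def B_def)
    \<comment> \<open>The enumeration starts with \<open>g0\<close>, so that sheet 0 contains the
      start of the path. Inserting \<open>g0\<close> also keeps the enumerated set nonempty.\<close>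
    define e where "e i = (case i of 0 \<Rightarrow> g0 | Suc j \<Rightarrow> from_nat_into (insert g0 C) j)" for i :: nat
    have e0: "e 0 = g0" by (simp add: e_def)
    have eI: "e i \<in> I" for i
    proof (cases i)
      case (Suc j)
      have "from_nat_into (insert g0 C) j \<in> insert g0 C" by (rule from_nat_into) simp
      then show ?thesis using Suc C(2) g0I by (auto simp: e_def)
    qed (simp add: e_def g0I)
    have eC: "\<exists>i. e i = g" if g: "g \<in> C" for g
    proof -
      obtain j where "from_nat_into (insert g0 C) j = g"
        using from_nat_into_surj[of "insert g0 C" g] C(1) g by auto
      then show ?thesis by (intro exI[of _ "Suc j"]) (simp add: e_def)
    qed
    have \<gamma>B: "\<gamma> t \<in> B" if "t \<in> {0..1}" for t
      using close[OF that] \<gamma>in[OF that] by (simp add: B_def)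
    have \<gamma>cov: "\<exists>i. \<gamma> t \<in> (\<lambda>P. e i <# P) ` V" if t: "t \<in> {0..1}" for t
    proof -
      have "\<gamma> t \<in> \<Union>\<V>" using \<gamma>B[OF t] \<gamma>in[OF t] \<V>(3) by simp
      then obtain g where "g \<in> C" "\<gamma> t \<in> cov g" using C(3) by blast
      then show ?thesis using eC unfolding cov_def by blast
    qed
    \<comment> \<open>Removing the earlier open translates keeps the sheet compact and makes the
      sheets disjoint. Every path point is still covered: it is in the sheet of the first translate
      of \<open>V\<close> that contains it, by \<open>trap'\<close>.\<close>
    define sheet where "sheet i = (\<lambda>P. e i <# P) ` N - (\<Union>j<i. (\<lambda>P. e j <# P) ` V)" for i
    have ec: "e i \<in> carrier G" for i using eI[of i] by (simp add: I_def)
    have sheet_compact: "compactin (mtop Q) (sheet i)" for i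
    proof -
      have "compactin (mtop Q) ((\<lambda>P. e i <# P) ` N)"
        by (rule image_compactin[OF \<open>compactin (mtop Q) N\<close> cont_act_left[OF ec]])
      moreover have "closedin (mtop Q) (topspace (mtop Q) - (\<Union>j<i. (\<lambda>P. e j <# P) ` V))"
        by (intro closedin_diff closedin_topspace openin_Union) (auto intro: open_act[OF ec V(1)])
      ultimately have "compactin (mtop Q) ((topspace (mtop Q) - (\<Union>j<i. (\<lambda>P. e j <# P) ` V)) \<inter> (\<lambda>P. e i <# P) ` N)"
        by (intro closed_Int_compactin)
      moreover have "(topspace (mtop Q) - (\<Union>j<i. (\<lambda>P. e j <# P) ` V)) \<inter> (\<lambda>P. e i <# P) ` N = sheet i"
        using compactin_subset_topspace[OF \<open>compactin (mtop Q) ((\<lambda>P. e i <# P) ` N)\<close>] by (auto simp: sheet_def)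
      ultimately show ?thesis by simp
    qed
    define T where "T i = {t \<in> {0..1}. \<gamma> t \<in> sheet i}" for i
    have Tclosed: "closed (T i)" for i
      unfolding T_def by (rule compact_preimage_closed[OF \<gamma> sheet_compact])
    have Tcover: "\<exists>i. t \<in> T i" if t: "t \<in> {0..1}" for t
    proof -
      define i where "i = (LEAST i. \<gamma> t \<in> (\<lambda>P. e i <# P) ` V)"
      have i: "\<gamma> t \<in> (\<lambda>P. e i <# P) ` V"
        unfolding i_def using \<gamma>cov[OF t] by (rule LeastI_ex)
      have "\<gamma> t \<notin> (\<lambda>P. e j <# P) ` V" if "j < i" for j
        using not_less_Least[of j "\<lambda>i. \<gamma> t \<in> (\<lambda>P. e i <# P) ` V"] that unfolding i_def by blast
      then have "\<gamma> t \<in> sheet i"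
        using trap'[OF eI \<gamma>B[OF t] i] by (auto simp: sheet_def)
      then show ?thesis using t by (auto simp: T_def)
    qed
    have Tdisj: "T i \<inter> T j = {}" if "i < j" for i j
    proof -
      have "sheet i \<subseteq> (\<lambda>P. e i <# P) ` V"
        unfolding sheet_def by (rule order_trans[OF Diff_subset image_mono[OF NV]])
      moreover have "sheet j \<inter> (\<lambda>P. e i <# P) ` V = {}"
        unfolding sheet_def using that by auto
      ultimately show ?thesis unfolding T_def by auto
    qed
    \<comment> \<open>Sierpinski's theorem speaks of nonempty sets, so empty preimages are
      dropped.\<close>
    define \<U> where "\<U> = {T i | i. T i \<noteq> {}}"
    have "\<U> = {{0..1}}"
    proof (rule real_Sierpinski_lemma)
      show "countable \<U>"
        unfolding \<U>_def by (rule countable_subset[of _ "range T"]) auto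
      show "pairwise disjnt \<U>"
      proof (rule pairwiseI)
        fix A B assume "A \<in> \<U>" "B \<in> \<U>" "A \<noteq> B"
        then obtain i j where "A = T i" "B = T j" "i \<noteq> j" by (auto simp: \<U>_def)
        then show "disjnt A B"
          using Tdisj[of i j] Tdisj[of j i] by (auto simp: disjnt_def neq_iff)
      qed
      show "\<Union>\<U> = {0..1}"
      proof
        show "\<Union>\<U> \<subseteq> {0..1}" by (auto simp: \<U>_def T_def)
        show "{0..1} \<subseteq> \<Union>\<U>"
        proof
          fix t :: real assume "t \<in> {0..1}"
          then obtain i where "t \<in> T i" using Tcover by blast
          then show "t \<in> \<Union>\<U>" by (auto simp: \<U>_def)
        qed
      qed
    qed (auto simp: \<U>_def Tclosed)
    \<comment> \<open>The starting parameter lies in \<open>T 0\<close>, which identifies the one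
      remaining set.\<close>
    moreover have "\<gamma> 0 \<in> (\<lambda>P. e 0 <# P) ` V"
      using V(2) \<gamma>0 e0 by auto
    then have "0 \<in> T 0"
      using trap'[OF eI \<gamma>B[of 0]] by (simp add: T_def sheet_def)
    then have "T 0 \<in> \<U>" by (auto simp: \<U>_def)
    ultimately have "T 0 = {0..1}" by simp
    then have "1 \<in> T 0" by simp
    then have "\<gamma> 1 \<in> sheet 0" by (simp add: T_def)
    then obtain v where v: "v \<in> N" "\<gamma> 1 = g0 <# v" by (auto simp: sheet_def e0)
    have "v \<in> lcosets H" using v(1) compactin_subset_topspace[OF \<open>compactin (mtop Q) N\<close>] by auto
    then show "inv g0 <# \<gamma> 1 \<in> U" using v g0 NV VU by auto
  qed
qed

text \<open>Points at small intrinsic distance are joined by a path of length below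
  \<open>r\<close>. Each of its points is then within \<open>r\<close> of the start for
  \<open>D\<close>, so the path cannot reach another sheet and its end stays in a prescribed
  neighborhood. The other inclusion is the upper bound along segments.\<close>

theorem emetric_topology_dhat: "emetric_topology (lcosets H) dhat = mtop Q"
  unfolding topology_eq
proof (intro allI iffI)
  fix V assume "openin (emetric_topology (lcosets H) dhat) V"
  then show "openin (mtop Q) V"
  proof (rule openin_manifold_if_emetric[OF smooth_Q topQ, rotated])
    fix P assume P: "P \<in> lcosets H"
    obtain k where k: "k \<in> charts_at Q P" using chart_exists[OF smooth_Q] P topQ by metis
    obtain U a A where "openin (mtop Q) U" "P \<in> U" "U \<subseteq> fst k" "A > 0"
      "\<And>x y. x \<in> U \<Longrightarrow> y \<in> U \<Longrightarrow> dhat x y \<le> ennreal (A * cdist k x y)"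
      using dhat_chart_upper[OF P k] by metis
    then show "\<exists>k\<in>charts_at Q P. \<exists>U A. openin (mtop Q) U \<and> P \<in> U \<and> U \<subseteq> fst k \<and> A > 0 \<and>
        (\<forall>y\<in>U. dhat P y \<le> ennreal (A * cdist k P y))"
      using k by blast
  qed
next
  fix W assume W: "openin (mtop Q) W"
  show "openin (emetric_topology (lcosets H) dhat) W"
    unfolding openin_emetric_topology
  proof (intro conjI ballI)
    show "W \<subseteq> lcosets H" using openin_subset[OF W] by simp
    fix x assume x: "x \<in> W"
    then obtain g where g: "g \<in> carrier G" "x = g <# H"
      using \<open>W \<subseteq> lcosets H\<close> lcosetsE by blast
    obtain k where k: "k \<in> charts_at Q H"
      using chart_exists[OF smooth_Q] H_in topQ by metis
    obtain U0 where U0: "openin (mtop Q) U0" "H \<in> U0" "U0 \<subseteq> fst k" "chart_comparable k U0 D"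
      using D_chart_comparable_base[OF k] by metis
    then obtain a where a: "a > 0" "\<And>y. y \<in> U0 \<Longrightarrow> a * cdist k H y \<le> D H y"
      unfolding chart_comparable_def by blast
    \<comment> \<open>\<open>W\<close> is translated back to the base point, where
      \<open>short_paths_stay_local\<close> applies.\<close>
    define U where "U = U0 \<inter> (\<lambda>P. inv g <# P) ` W"
    have U: "openin (mtop Q) U" "H \<in> U" "U \<subseteq> fst k"
      using U0 open_act[OF inv_closed[OF g(1)] W] x g by (auto simp: U_def intro!: image_eqI[of _ _ x])
    obtain r where r: "r > 0" and stay: "\<And>(\<gamma> :: real \<Rightarrow> 'a set) g. continuous_map (top_of_set {0..1}) (emetric_topology (lcosets H) dX) \<gamma> \<Longrightarrow> g \<in> carrier G \<Longrightarrow>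
      \<gamma> 0 = g <# H \<Longrightarrow> (\<And>t. t \<in> {0..1} \<Longrightarrow> D (g <# H) (\<gamma> t) < r) \<Longrightarrow> inv g <# \<gamma> 1 \<in> U"
      by (rule short_paths_stay_local[OF k U a(1)]) (use a(2) in \<open>auto simp: U_def\<close>)
    have "y \<in> W" if y: "y \<in> lcosets H" and less: "dhat x y < ennreal r" for y
    proof -
      obtain \<gamma> where \<gamma>: "continuous_map (top_of_set {0..1}) (emetric_topology (lcosets H) dX) \<gamma>" "\<gamma> 0 = x" "\<gamma> 1 = y"
        and len: "path_length dX \<gamma> < ennreal r"
        using less unfolding intrinsic_dist_def INF_less_iff by blast
      have "D (g <# H) (\<gamma> t) < r" if t: "t \<in> {0..1}" for t
      proof -
        have "ennreal (D (\<gamma> t) (\<gamma> 0)) < ennreal r"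
          using path_length_ge_dist[OF t, of dX \<gamma>] len dX[OF emetric_path_in[OF \<gamma>(1) t] emetric_path_in[OF \<gamma>(1), of 0]] by simp
        then show ?thesis
          using \<gamma>(2) g(2) D_commute[of "\<gamma> t" "\<gamma> 0"] by (simp add: ennreal_less_iff)
      qed
      then have "inv g <# y \<in> U" using stay[OF \<gamma>(1) g(1)] \<gamma>(2,3) g(2) by simp
      then obtain w where w: "w \<in> W" "inv g <# y = inv g <# w" unfolding U_def by blast
      have "y = w"
        using act_inv(2)[OF g(1) y] act_inv(2)[OF g(1), of w] w \<open>W \<subseteq> lcosets H\<close> by auto
      then show ?thesis using w(1) by simp
    qed
    then show "\<exists>r>0. \<forall>y\<in>lcosets H. dhat x y < r \<longrightarrow> y \<in> W"
      using r by (intro exI[of _ "ennreal r"]) auto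
  qed
qed

end

section \<open>The Hausdorff metric on the orbit of a compact set\<close>

context Metric_space
begin

text \<open>Distances to compact sets are attained, so the bound can be tested on points with
  non-strict inequalities. This removes infima and extended reals from the later arguments.\<close>

lemma hausdorff_dist_le_iff:
  assumes A: "compactin mtopology A" and B: "compactin mtopology B" and ne: "A \<noteq> {}" "B \<noteq> {}" and "0 \<le> r"
  shows "hausdorff_dist d A B \<le> ennreal r \<longleftrightarrow> (\<forall>a\<in>A. \<exists>b\<in>B. d a b \<le> r) \<and> (\<forall>b\<in>B. \<exists>a\<in>A. d b a \<le> r)"
proof -
  have inf: "(INF b\<in>S. ennreal (d a b)) \<le> ennreal r \<longleftrightarrow> (\<exists>b\<in>S. d a b \<le> r)"
    if S: "compactin mtopology S" "S \<noteq> {}" and a: "a \<in> M" for a S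
  proof
    assume le: "(INF b\<in>S. ennreal (d a b)) \<le> ennreal r"
    have "continuous_map mtopology euclideanreal (d a)"
      unfolding continuous_map_into_real_iff_local
    proof (intro ballI allI impI)
      fix x and e :: real assume x: "x \<in> topspace mtopology" and "e > 0"
      have "\<bar>d a y - d a x\<bar> < e" if "y \<in> mball x e" for y
        using that a triangle[of a x y] triangle[of a y x] commute[of x y] by auto
      then show "\<exists>U. openin mtopology U \<and> x \<in> U \<and> (\<forall>y\<in>U. \<bar>d a y - d a x\<bar> < e)"
        using x \<open>e > 0\<close> by (intro exI[of _ "mball x e"]) auto
    qed
    then have "compact (d a ` S)"
      using image_compactin[OF S(1), of euclideanreal "d a"] by simp
    then obtain b where b: "b \<in> S" "\<And>b'. b' \<in> S \<Longrightarrow> d a b \<le> d a b'"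
      using compact_attains_inf[of "d a ` S"] S(2) by auto
    then have "ennreal (d a b) \<le> (INF b\<in>S. ennreal (d a b))"
      by (intro INF_greatest ennreal_leI)
    then have "ennreal (d a b) \<le> ennreal r" using le by (rule order_trans)
    then show "\<exists>b\<in>S. d a b \<le> r" using b(1) \<open>0 \<le> r\<close> by auto
  next
    assume "\<exists>b\<in>S. d a b \<le> r"
    then obtain b where "b \<in> S" "d a b \<le> r" by blast
    then show "(INF b\<in>S. ennreal (d a b)) \<le> ennreal r"
      by (intro INF_lower2[of b] ennreal_leI) auto
  qed
  have sub: "A \<subseteq> M" "B \<subseteq> M"
    using compactin_subset_topspace[OF A] compactin_subset_topspace[OF B] by auto
  have "hausdorff_dist d A B \<le> ennreal r \<longleftrightarrow>
    (\<forall>a\<in>A. (INF b\<in>B. ennreal (d a b)) \<le> ennreal r) \<and> (\<forall>b\<in>B. (INF a\<in>A. ennreal (d b a)) \<le> ennreal r)"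
    unfolding hausdorff_dist_def max.bounded_iff SUP_le_iff by blast
  also have "\<dots> \<longleftrightarrow> (\<forall>a\<in>A. \<exists>b\<in>B. d a b \<le> r) \<and> (\<forall>b\<in>B. \<exists>a\<in>A. d b a \<le> r)"
    using inf[OF A ne(1)] inf[OF B ne(2)] sub by (intro conj_cong ball_cong refl) blast+
  finally show ?thesis .
qed

lemma hausdorff_dist_finite:
  assumes A: "compactin mtopology A" and B: "compactin mtopology B" and ne: "A \<noteq> {}" "B \<noteq> {}"
  shows "hausdorff_dist d A B = ennreal (enn2real (hausdorff_dist d A B))"
proof -
  have "mbounded (A \<union> B)"
    using compactin_imp_mbounded[OF A] compactin_imp_mbounded[OF B] by (simp add: mbounded_Un)
  then obtain r where r: "\<And>x y. x \<in> A \<union> B \<Longrightarrow> y \<in> A \<union> B \<Longrightarrow> d x y \<le> r"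
    unfolding mbounded_alt by blast
  have "hausdorff_dist d A B \<le> ennreal (max r 0)"
    using r ne by (subst hausdorff_dist_le_iff[OF A B ne]) (auto intro: le_max_iff_disj[THEN iffD2] simp: ex_in_conv[symmetric])
  then have "hausdorff_dist d A B \<noteq> \<infinity>"
    by (auto simp: top_unique)
  then show ?thesis by (simp add: less_top)
qed

end

text \<open>Two distances pinched by the same third one are equivalent; below, \<open>f\<close> is a
  chart map.\<close>

lemma lipschitz_equiv_on_norm:
  assumes pos: "a > 0" "A > 0" "b > 0" "B > 0"
    and d: "\<And>x y. x \<in> U \<Longrightarrow> y \<in> U \<Longrightarrow> ennreal (a * norm (f x - f y)) \<le> d x y \<and> d x y \<le> ennreal (A * norm (f x - f y))"
    and d': "\<And>x y. x \<in> U \<Longrightarrow> y \<in> U \<Longrightarrow> ennreal (b * norm (f x - f y)) \<le> d' x y \<and> d' x y \<le> ennreal (B * norm (f x - f y))"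
  shows "lipschitz_equiv_on U d d'"
  unfolding lipschitz_equiv_on_def
proof (rule exI[of _ "b / A"], rule exI[of _ "B / a"], intro conjI ballI)
  fix x y assume xy: "x \<in> U" "y \<in> U"
  let ?n = "norm (f x - f y)"
  have "ennreal (b / A) * d x y \<le> ennreal (b / A) * ennreal (A * ?n)"
    using d[OF xy] by (intro mult_left_mono) auto
  also have "\<dots> = ennreal (b * ?n)"
    using pos by (subst ennreal_mult[symmetric]) auto
  also have "\<dots> \<le> d' x y" using d'[OF xy] by blast
  finally show "ennreal (b / A) * d x y \<le> d' x y" .
  have "d' x y \<le> ennreal (B * ?n)" using d'[OF xy] by blast
  also have "\<dots> = ennreal (B / a) * ennreal (a * ?n)"
    using pos by (subst ennreal_mult[symmetric]) auto
  also have "\<dots> \<le> ennreal (B / a) * d x y"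
    using d[OF xy] by (intro mult_left_mono) auto
  finally show "d' x y \<le> ennreal (B / a) * d x y" .
qed (use pos in auto)

section \<open>Isometric actions and the orbit of a compact set\<close>

locale isometric_action = group G for G (structure) +
  fixes GM :: "('g, 'e::euclidean_space) mfd" and M :: "('m, 'f::euclidean_space) mfd"
    and \<phi> :: "'g \<Rightarrow> 'm \<Rightarrow> 'm" and d :: "'m \<Rightarrow> 'm \<Rightarrow> real" and X :: "'m set"
  assumes lie: "lie_group G GM" and M: "smooth_manifold M"
    and action: "group_action G (topspace (mtop M)) \<phi>"
    and smooth: "smooth_map (prod_mfd GM M) M (\<lambda>(g, x). \<phi> g x)"
    and d: "d \<in> locally_finsler_metrics M"
    and isom: "\<And>g x y. g \<in> carrier G \<Longrightarrow> x \<in> topspace (mtop M) \<Longrightarrow> y \<in> topspace (mtop M) \<Longrightarrow> d (\<phi> g x) (\<phi> g y) = d x y"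
    and X: "compactin (mtop M) X" and Xne: "X \<noteq> {}"
begin

abbreviation E where "E \<equiv> topspace (mtop M)"
abbreviation H where "H \<equiv> set_stabilizer G \<phi> X"

sublocale E: Metric_space E d
  using d by (simp add: locally_finsler_metrics_def)

lemma mtop [simp]: "E.mtopology = mtop M"
  using d by (simp add: locally_finsler_metrics_def)

lemma XE: "X \<subseteq> E" using compactin_subset_topspace[OF X] .

lemma act_E: "g \<in> carrier G \<Longrightarrow> x \<in> E \<Longrightarrow> \<phi> g x \<in> E"
  using group_action.element_image[OF action] by blast

lemma act_mult: "g \<in> carrier G \<Longrightarrow> h \<in> carrier G \<Longrightarrow> x \<in> E \<Longrightarrow> \<phi> (g \<otimes> h) x = \<phi> g (\<phi> h x)"
  using group_action.composition_rule[OF action] by blast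

lemma act_1: "x \<in> E \<Longrightarrow> \<phi> \<one> x = x"
  using group_action.id_eq_one[OF action] by (metis restrict_apply')

lemma image_mult: "g \<in> carrier G \<Longrightarrow> h \<in> carrier G \<Longrightarrow> \<phi> (g \<otimes> h) ` X = \<phi> g ` \<phi> h ` X"
  using XE by (force simp: act_mult image_image intro!: image_cong)

lemma image_one: "\<phi> \<one> ` X = X"
  using XE act_1 by (force simp: subset_iff image_iff)

lemma H_iff: "g \<in> H \<longleftrightarrow> g \<in> carrier G \<and> \<phi> g ` X = X"
  by (simp add: set_stabilizer_def stabilizer_def)

lemma subgroup_H: "subgroup H G"
proof (rule subgroupI)
  show "H \<subseteq> carrier G" using H_iff by blast
  show "H \<noteq> {}" using H_iff image_one by blast
  show "inv g \<in> H" if "g \<in> H" for g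
    using that image_mult[of "inv g" g] image_one by (auto simp: H_iff)
  show "g \<otimes> h \<in> H" if "g \<in> H" "h \<in> H" for g h
    using that image_mult by (simp add: H_iff)
qed

lemma coset_eq_if_image_eq:
  assumes g: "g \<in> carrier G" "h \<in> carrier G" and eq: "\<phi> g ` X = \<phi> h ` X"
  shows "g <# H = h <# H"
proof (rule l_repr_independence[OF _ g(1) subgroup_H])
  have "\<phi> (inv g \<otimes> h) ` X = X"
    using g eq image_mult[of "inv g" h] image_mult[of "inv g" g] image_one by simp
  then have "inv g \<otimes> h \<in> H" using g by (simp add: H_iff)
  moreover have "h = g \<otimes> (inv g \<otimes> h)" using g by (simp add: m_assoc[symmetric])
  ultimately show "h \<in> g <# H" unfolding l_coset_def by blast
qed

lemma act_continuous: "g \<in> carrier G \<Longrightarrow> continuous_map (mtop M) (mtop M) (\<phi> g)"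
  using smooth lie continuous_map_compose[of "mtop M" "prod_topology (mtop GM) (mtop M)" "\<lambda>x. (g, x)" "mtop M" "\<lambda>(g, x). \<phi> g x"]
  by (simp add: smooth_map_def prod_mfd_def lie_group_def continuous_map_pairedI o_def)

lemma image_compact: "g \<in> carrier G \<Longrightarrow> compactin (mtop M) (\<phi> g ` X)"
  using image_compactin[OF X act_continuous] .

text \<open>\<open>enn2real\<close> sends infinity to 0, but Hausdorff distances of nonempty compact
  sets are finite, so on cosets nothing is lost.\<close>

definition D :: "'g set \<Rightarrow> 'g set \<Rightarrow> real"
  where "D P R = enn2real (coset_dist d \<phi> X P R)"

lemma coset_dist_D:
  assumes "g \<in> carrier G" "h \<in> carrier G"
  shows "coset_dist d \<phi> X (g <# H) (h <# H) = ennreal (D (g <# H) (h <# H))"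
    and "0 \<le> r \<Longrightarrow> D (g <# H) (h <# H) \<le> r \<longleftrightarrow>
      (\<forall>x\<in>X. \<exists>y\<in>X. d (\<phi> g x) (\<phi> h y) \<le> r) \<and> (\<forall>y\<in>X. \<exists>x\<in>X. d (\<phi> h y) (\<phi> g x) \<le> r)"
proof -
  have eq: "coset_dist d \<phi> X (g <# H) (h <# H) = hausdorff_dist d (\<phi> g ` X) (\<phi> h ` X)"
    by (rule coset_dist_eq[OF action XE assms])
  have c: "compactin E.mtopology (\<phi> g ` X)" "compactin E.mtopology (\<phi> h ` X)" "\<phi> g ` X \<noteq> {}" "\<phi> h ` X \<noteq> {}"
    using image_compact assms Xne by auto
  show fin: "coset_dist d \<phi> X (g <# H) (h <# H) = ennreal (D (g <# H) (h <# H))"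
    unfolding D_def eq by (rule E.hausdorff_dist_finite[OF c])
  show "D (g <# H) (h <# H) \<le> r \<longleftrightarrow>
      (\<forall>x\<in>X. \<exists>y\<in>X. d (\<phi> g x) (\<phi> h y) \<le> r) \<and> (\<forall>y\<in>X. \<exists>x\<in>X. d (\<phi> h y) (\<phi> g x) \<le> r)" if "0 \<le> r"
  proof -
    have "D (g <# H) (h <# H) \<le> r \<longleftrightarrow> hausdorff_dist d (\<phi> g ` X) (\<phi> h ` X) \<le> ennreal r"
      using that unfolding eq[symmetric] fin by simp
    also have "\<dots> \<longleftrightarrow> (\<forall>x\<in>X. \<exists>y\<in>X. d (\<phi> g x) (\<phi> h y) \<le> r) \<and> (\<forall>y\<in>X. \<exists>x\<in>X. d (\<phi> h y) (\<phi> g x) \<le> r)"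
      using E.hausdorff_dist_le_iff[OF c that] by simp
    finally show ?thesis .
  qed
qed

lemma D_nonneg': "0 \<le> D P R" by (simp add: D_def)

text \<open>At distance 0 the attained distances give equal images of \<open>X\<close>, and equal
  images differ by an element of the stabilizer; so \<open>D\<close> separates cosets. The triangle
  inequality chains nearest points.\<close>

lemma D_metric: "Metric_space (lcosets H) D"
proof
  show "0 \<le> D P R" for P R by (rule D_nonneg')
  show "D P R = D R P" for P R
    by (simp add: D_def coset_dist_def hausdorff_dist_def max.commute)
  show "D P R = 0 \<longleftrightarrow> P = R" if "P \<in> lcosets H" "R \<in> lcosets H" for P R
  proof -
    obtain g h where gh: "g \<in> carrier G" "h \<in> carrier G" "P = g <# H" "R = h <# H"
      using \<open>P \<in> lcosets H\<close> \<open>R \<in> lcosets H\<close> unfolding LCOSETS_def by blast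
    have in_E: "\<phi> g x \<in> E" "\<phi> h x \<in> E" if "x \<in> X" for x
      using act_E gh that XE by blast+
    have "P = R" if "D P R = 0"
    proof -
      have "\<forall>x\<in>X. \<exists>y\<in>X. d (\<phi> g x) (\<phi> h y) \<le> 0" "\<forall>y\<in>X. \<exists>x\<in>X. d (\<phi> h y) (\<phi> g x) \<le> 0"
        using that coset_dist_D(2)[OF gh(1,2), of 0] gh by auto
      then have "\<forall>x\<in>X. \<exists>y\<in>X. \<phi> g x = \<phi> h y" "\<forall>y\<in>X. \<exists>x\<in>X. \<phi> h y = \<phi> g x"
        using in_E E.zero E.nonneg by (meson order_antisym)+
      then have "\<phi> g ` X = \<phi> h ` X" by blast
      then show ?thesis unfolding gh(3,4) by (rule coset_eq_if_image_eq[OF gh(1,2)])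
    qed
    moreover have "D P P = 0"
    proof (rule antisym[OF _ D_nonneg'])
      have "\<exists>y\<in>X. d (\<phi> g x) (\<phi> g y) \<le> 0" if "x \<in> X" for x
        using that in_E(1)[OF that] by (intro bexI[of _ x]) auto
      then show "D P P \<le> 0"
        unfolding gh(3) coset_dist_D(2)[OF gh(1,1) order_refl] by blast
    qed
    ultimately show ?thesis by blast
  qed
  show "D P S \<le> D P R + D R S" if "P \<in> lcosets H" "R \<in> lcosets H" "S \<in> lcosets H" for P R S
  proof -
    obtain g h k where ghk: "g \<in> carrier G" "h \<in> carrier G" "k \<in> carrier G" "P = g <# H" "R = h <# H" "S = k <# H"
      using \<open>P \<in> lcosets H\<close> \<open>R \<in> lcosets H\<close> \<open>S \<in> lcosets H\<close> unfolding LCOSETS_def by blast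
    have in_E: "\<phi> g x \<in> E" "\<phi> h x \<in> E" "\<phi> k x \<in> E" if "x \<in> X" for x
      using act_E ghk that XE by blast+
    have 1: "\<forall>x\<in>X. \<exists>y\<in>X. d (\<phi> g x) (\<phi> h y) \<le> D P R" "\<forall>y\<in>X. \<exists>x\<in>X. d (\<phi> h y) (\<phi> g x) \<le> D P R"
      using coset_dist_D(2)[OF ghk(1,2) D_nonneg'[of P R]] by (simp_all add: ghk(4,5))
    have 2: "\<forall>x\<in>X. \<exists>y\<in>X. d (\<phi> h x) (\<phi> k y) \<le> D R S" "\<forall>y\<in>X. \<exists>x\<in>X. d (\<phi> k y) (\<phi> h x) \<le> D R S"
      using coset_dist_D(2)[OF ghk(2,3) D_nonneg'[of R S]] by (simp_all add: ghk(5,6))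
    have "0 \<le> D P R + D R S" by (simp add: D_nonneg')
    then have "D (g <# H) (k <# H) \<le> D P R + D R S"
    proof (subst coset_dist_D(2)[OF ghk(1,3)], assumption, intro conjI ballI)
      fix x assume x: "x \<in> X"
      obtain y where y: "y \<in> X" "d (\<phi> g x) (\<phi> h y) \<le> D P R" using 1 x by blast
      obtain z where z: "z \<in> X" "d (\<phi> h y) (\<phi> k z) \<le> D R S" using 2 y(1) by blast
      show "\<exists>z\<in>X. d (\<phi> g x) (\<phi> k z) \<le> D P R + D R S"
        using E.triangle[OF in_E(1)[OF x] in_E(2)[OF y(1)] in_E(3)[OF z(1)]] y z by (intro bexI[of _ z]) auto
    next
      fix z assume z: "z \<in> X"
      obtain y where y: "y \<in> X" "d (\<phi> k z) (\<phi> h y) \<le> D R S" using 2 z by blast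
      obtain x where x: "x \<in> X" "d (\<phi> h y) (\<phi> g x) \<le> D P R" using 1 y(1) by blast
      show "\<exists>x\<in>X. d (\<phi> k z) (\<phi> g x) \<le> D P R + D R S"
        using E.triangle[OF in_E(3)[OF z] in_E(2)[OF y(1)] in_E(1)[OF x(1)]] x y by (intro bexI[of _ x]) auto
    qed
    then show ?thesis using ghk by simp
  qed
qed

text \<open>Isometries leave the pointwise criterion for \<open>D \<le> r\<close> unchanged for all
  \<open>r \<ge> 0\<close>. Taking each of the two distances as \<open>r\<close> gives
  equality.\<close>

lemma D_inv:
  assumes g: "g \<in> carrier G" and P: "P \<in> lcosets H" and R: "R \<in> lcosets H"
  shows "D (g <# P) (g <# R) = D P R"
proof -
  obtain h k where hk: "h \<in> carrier G" "k \<in> carrier G" "P = h <# H" "R = k <# H"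
    using P R unfolding LCOSETS_def by blast
  have HG: "H \<subseteq> carrier G" using subgroup.subset[OF subgroup_H] .
  have gP: "g <# (h <# H) = (g \<otimes> h) <# H" "g <# (k <# H) = (g \<otimes> k) <# H"
    using lcos_m_assoc[OF HG g] hk by auto
  have eq: "d (\<phi> (g \<otimes> a) x) (\<phi> (g \<otimes> b) y) = d (\<phi> a x) (\<phi> b y)"
    if "a \<in> carrier G" "b \<in> carrier G" "x \<in> X" "y \<in> X" for a b x y
    using that g XE by (simp add: act_mult act_E isom subset_iff)
  have iff: "D (g <# P) (g <# R) \<le> r \<longleftrightarrow> D P R \<le> r" if "0 \<le> r" for r
    unfolding hk(3,4) gP coset_dist_D(2)[OF m_closed[OF g hk(1)] m_closed[OF g hk(2)] that] coset_dist_D(2)[OF hk(1,2) that]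
    using eq hk by simp
  show ?thesis
    using iff[of "D P R"] iff[of "D (g <# P) (g <# R)"] D_nonneg' by (simp add: order_antisym)
qed

text \<open>Here the local Finsler comparison of \<open>d\<close> enters: near \<open>p\<close> it
  bounds \<open>d\<close> by a chart distance, and in charts the action is Lipschitz in the group
  variable. Since \<open>\<one>\<close> fixes \<open>x\<close>, the displacement is bounded by the
  norm of \<open>g\<close>.\<close>

lemma displacement_local:
  assumes p: "p \<in> X" and c: "c \<in> charts_at GM \<one>"
  obtains L U W where "L \<ge> 0" "openin (mtop GM) U" "\<one> \<in> U" "U \<subseteq> fst c" "openin (mtop M) W" "p \<in> W"
    "\<And>g x. g \<in> U \<Longrightarrow> x \<in> W \<Longrightarrow> d x (\<phi> g x) \<le> L * cdist c g \<one>"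
proof -
  have GM: "smooth_manifold GM" using lie by (simp add: lie_group_def)
  have pE: "p \<in> E" using p XE by blast
  obtain \<kappa> where \<kappa>: "\<kappa> \<in> charts_at M p" using chart_exists[OF M pE] by metis
  obtain F' where F': "finsler_metric M F'"
    and loc: "\<And>p. p \<in> E \<Longrightarrow> \<exists>U. openin (mtop M) U \<and> p \<in> U \<and> lipschitz_equiv_on U (\<lambda>x y. ennreal (d x y)) (finsler_dist M F')"
    using d unfolding locally_finsler_metrics_def by blast
  obtain U1 where U1: "openin (mtop M) U1" "p \<in> U1" "lipschitz_equiv_on U1 (\<lambda>x y. ennreal (d x y)) (finsler_dist M F')"
    using loc[OF pE] by blast
  then obtain a where a: "a > 0" "\<And>x y. x \<in> U1 \<Longrightarrow> y \<in> U1 \<Longrightarrow> ennreal a * ennreal (d x y) \<le> finsler_dist M F' x y"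
    unfolding lipschitz_equiv_on_def by blast
  obtain U2 C where U2: "openin (mtop M) U2" "p \<in> U2" and C: "C > 0"
    "\<And>x y. x \<in> U2 \<Longrightarrow> y \<in> U2 \<Longrightarrow> finsler_dist M F' x y \<le> ennreal (C * cdist \<kappa> x y)"
    using finsler_dist_chart_upper[OF M F' \<kappa>] by metis
  have dC: "d x y \<le> (C / a) * cdist \<kappa> x y" if "x \<in> U1 \<inter> U2" "y \<in> U1 \<inter> U2" for x y
  proof -
    have "ennreal (a * d x y) \<le> ennreal (C * cdist \<kappa> x y)"
      using a(2)[of x y] C(2)[of x y] that a(1) by (auto simp: ennreal_mult intro: order_trans)
    then have "a * d x y \<le> C * cdist \<kappa> x y"
      using C(1) by (subst (asm) ennreal_le_iff) auto
    then show ?thesis using a(1) by (simp add: field_simps)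
  qed
  have \<phi>p: "\<phi> \<one> p = p" by (rule act_1[OF pE])
  then have "\<kappa> \<in> charts_at M (\<phi> \<one> p)" using \<kappa> by simp
  then obtain V1 V2 L where V: "openin (mtop GM) V1" "\<one> \<in> V1" "V1 \<subseteq> fst c" "openin (mtop M) V2" "p \<in> V2" "L > 0"
    and L: "\<And>g g' x x'. g \<in> V1 \<Longrightarrow> g' \<in> V1 \<Longrightarrow> x \<in> V2 \<Longrightarrow> x' \<in> V2 \<Longrightarrow>
      cdist \<kappa> (\<phi> g x) (\<phi> g' x') \<le> L * (cdist c g g' + cdist \<kappa> x x')"
    by (rule smooth_map2_lipschitz[OF smooth_manifold_imp_locally_charted[OF GM] smooth_manifold_imp_locally_charted[OF M]
          smooth_manifold_imp_locally_charted[OF M] smooth c \<kappa>]) auto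
  have cont: "continuous_map (prod_topology (mtop GM) (mtop M)) (mtop M) (\<lambda>(g, x). \<phi> g x)"
    using smooth by (simp add: smooth_map_def prod_mfd_def)
  \<comment> \<open>Keeps \<open>\<phi> g x\<close> in the neighborhood on which \<open>dC\<close>
    bounds \<open>d\<close>.\<close>
  obtain W1 W2 where W: "openin (mtop GM) W1" "\<one> \<in> W1" "openin (mtop M) W2" "p \<in> W2"
    and W12: "\<And>g x. g \<in> W1 \<Longrightarrow> x \<in> W2 \<Longrightarrow> \<phi> g x \<in> U1 \<inter> U2"
    by (rule prod_nbhd[OF cont openin_Int[OF U1(1) U2(1)], of \<one> p])
      (use U1 U2 \<phi>p pE lie in \<open>auto simp: lie_group_def\<close>)
  show thesis
  proof (rule that[of "(C / a) * L" "V1 \<inter> W1" "V2 \<inter> W2 \<inter> U1 \<inter> U2"])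
    fix g x assume g: "g \<in> V1 \<inter> W1" and x: "x \<in> V2 \<inter> W2 \<inter> U1 \<inter> U2"
    have xE: "x \<in> E" using x openin_subset[OF U1(1)] by blast
    have "cdist \<kappa> (\<phi> g x) (\<phi> \<one> x) \<le> L * cdist c g \<one>"
      using L[of g \<one> x x] g x V(2) by simp
    then have le: "cdist \<kappa> x (\<phi> g x) \<le> L * cdist c g \<one>"
      using act_1[OF xE] by (simp add: norm_minus_commute)
    have "d x (\<phi> g x) \<le> (C / a) * cdist \<kappa> x (\<phi> g x)"
      using dC[of x "\<phi> g x"] W12[of g x] g x by blast
    also have "\<dots> \<le> (C / a) * (L * cdist c g \<one>)"
      using le C(1) a(1) by (intro mult_left_mono) auto
    finally show "d x (\<phi> g x) \<le> (C / a) * L * cdist c g \<one>" by (simp add: mult.assoc)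
  qed (use V W U1 U2 C a in auto)
qed

text \<open>Compactness of \<open>X\<close> turns the local displacement bounds into one
  neighborhood of \<open>\<one>\<close> and one constant. Pairing each \<open>x\<close> with
  \<open>\<phi> g x\<close> bounds both halves of the Hausdorff distance.\<close>

lemma D_lip:
  "\<exists>c\<in>charts_at GM \<one>. \<exists>L U. openin (mtop GM) U \<and> \<one> \<in> U \<and> U \<subseteq> fst c \<and>
      (\<forall>g\<in>U. D H (g <# H) \<le> L * cdist c g \<one>)"
proof -
  have GM: "smooth_manifold GM" "topspace (mtop GM) = carrier G" using lie by (auto simp: lie_group_def)
  obtain c where c: "c \<in> charts_at GM \<one>" using chart_exists[OF GM(1)] GM(2) by (metis one_closed)
  define n where "n g = cdist c g \<one>" for g
  define P where "P p L U W \<longleftrightarrow> L \<ge> 0 \<and> openin (mtop GM) U \<and> \<one> \<in> U \<and> U \<subseteq> fst c \<and> openin (mtop M) W \<and> p \<in> W \<and>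
    (\<forall>g\<in>U. \<forall>x\<in>W. d x (\<phi> g x) \<le> L * n g)" for p L U W
  have "\<exists>L U W. P p L U W" if "p \<in> X" for p
    unfolding P_def n_def by (rule displacement_local[OF that c]) blast
  then obtain L U W where P: "\<And>p. p \<in> X \<Longrightarrow> P p (L p) (U p) (W p)" by metis
  have "\<exists>\<F>. finite \<F> \<and> \<F> \<subseteq> W ` X \<and> X \<subseteq> \<Union>\<F>"
    using X P unfolding compactin_def P_def by (elim conjE allE[of _ "W ` X"]) blast
  then obtain Y where Y: "finite Y" "Y \<subseteq> X" "X \<subseteq> \<Union>(W ` Y)"
    by (metis finite_subset_image)
  have Yne: "Y \<noteq> {}" using Y Xne by blast
  \<comment> \<open>A sum of finitely many nonnegative constants dominates each of them.\<close>
  define L' where "L' = (\<Sum>p\<in>Y. L p)"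
  have L': "L p \<le> L'" if "p \<in> Y" for p
    unfolding L'_def using P Y that by (intro member_le_sum) (auto simp: P_def)
  have L'0: "L' \<ge> 0" unfolding L'_def using P Y by (intro sum_nonneg) (auto simp: P_def)
  define V where "V = (\<Inter>p\<in>Y. U p)"
  have V: "openin (mtop GM) V" "\<one> \<in> V" "V \<subseteq> fst c"
  proof -
    have PY: "P p (L p) (U p) (W p)" if "p \<in> Y" for p using P Y(2) that by blast
    show "openin (mtop GM) V"
      unfolding V_def using PY Y(1) Yne by (intro openin_Inter) (auto simp: P_def)
    show "\<one> \<in> V" unfolding V_def using PY by (auto simp: P_def)
    obtain p where "p \<in> Y" using Yne by blast
    then show "V \<subseteq> fst c" using PY[of p] by (auto simp: P_def V_def)
  qed
  have disp: "d x (\<phi> g x) \<le> L' * n g" if g: "g \<in> V" and x: "x \<in> X" for g x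
  proof -
    obtain p where p: "p \<in> Y" "x \<in> W p" using Y(3) x by blast
    have "d x (\<phi> g x) \<le> L p * n g" using P[of p] p Y(2) g unfolding P_def V_def by blast
    also have "\<dots> \<le> L' * n g" using L'[OF p(1)] by (intro mult_right_mono) (auto simp: n_def)
    finally show ?thesis .
  qed
  have "D H (g <# H) \<le> L' * n g" if g: "g \<in> V" for g
  proof -
    have gc: "g \<in> carrier G" using g openin_subset[OF V(1)] GM(2) by blast
    have "0 \<le> L' * n g" using L'0 by (simp add: n_def)
    then have "D (\<one> <# H) (g <# H) \<le> L' * n g"
    proof (subst coset_dist_D(2)[OF one_closed gc], assumption, intro conjI ballI)
      fix x assume x: "x \<in> X"
      then have "x \<in> E" "\<phi> g x \<in> E" using XE act_E gc by blast+
      then show "\<exists>y\<in>X. d (\<phi> \<one> x) (\<phi> g y) \<le> L' * n g" "\<exists>y\<in>X. d (\<phi> g x) (\<phi> \<one> y) \<le> L' * n g"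
        using disp[OF g x] x act_1 E.commute[of x "\<phi> g x"] by (auto intro!: bexI[of _ x])
    qed
    then show ?thesis using lcos_mult_one[OF subgroup.subset[OF subgroup_H]] by simp
  qed
  then show ?thesis using c V unfolding n_def by blast
qed

end

section \<open>Local Lipschitz equivalence and comparison of the topologies\<close>

theorem theorem7p1:
  fixes G :: "('g, 'r) monoid_scheme"
    and GM :: "('g, 'e::euclidean_space) mfd"
    and M :: "('m, 'f::euclidean_space) mfd"
    and Q :: "('g set, 'h::euclidean_space) mfd"
    and \<phi> :: "'g \<Rightarrow> 'm \<Rightarrow> 'm"
    and d :: "'m \<Rightarrow> 'm \<Rightarrow> real"
    and X :: "'m set"
    and F :: "'g set \<times> (('g set, 'h) chart \<Rightarrow> 'h) \<Rightarrow> real"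
  defines "H \<equiv> set_stabilizer G \<phi> X"
    and "d\<^sub>X \<equiv> coset_dist d \<phi> X"
    and "dhat\<^sub>X \<equiv> intrinsic_dist (lcosets\<^bsub>G\<^esub> (set_stabilizer G \<phi> X)) (coset_dist d \<phi> X)"
    and "d\<^sub>F \<equiv> finsler_dist Q F"
  assumes "lie_group G GM"
    and "smooth_manifold M"
    and "group_action G (topspace (mtop M)) \<phi>"
    and "smooth_map (prod_mfd GM M) M (\<lambda>(g, x). \<phi> g x)"
    and "d \<in> locally_finsler_metrics M"
    and "\<And>g x y. g \<in> carrier G \<Longrightarrow> x \<in> topspace (mtop M) \<Longrightarrow> y \<in> topspace (mtop M) \<Longrightarrow>
           d (\<phi> g x) (\<phi> g y) = d x y"
    and "compactin (mtop M) X" and "X \<noteq> {}"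
    and "homogeneous_space G GM H Q"
    and "finsler_metric Q F"
  shows "(\<forall>g\<in>carrier G. \<exists>O'. openin (mtop Q) O' \<and> g <#\<^bsub>G\<^esub> H \<in> O' \<and>
            lipschitz_equiv_on O' d\<^sub>F d\<^sub>X \<and>
            lipschitz_equiv_on O' d\<^sub>X dhat\<^sub>X \<and>
            lipschitz_equiv_on O' d\<^sub>F dhat\<^sub>X) \<and>
         (\<forall>U. openin (emetric_topology (lcosets\<^bsub>G\<^esub> H) d\<^sub>X) U \<longrightarrow>
              openin (emetric_topology (lcosets\<^bsub>G\<^esub> H) dhat\<^sub>X) U) \<and>
         emetric_topology (lcosets\<^bsub>G\<^esub> H) dhat\<^sub>X = mtop Q"
proof -
  interpret group G using assms(5) by (simp add: lie_group_def)
  interpret A: isometric_action G GM M \<phi> d X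
    by (intro isometric_action.intro isometric_action_axioms.intro group_axioms assms(5-12))
  have homog: "homogeneous_space G GM (set_stabilizer G \<phi> X) Q"
    using assms(13) unfolding H_def .
  interpret B: homogeneous_emetric G GM "set_stabilizer G \<phi> X" Q A.D "coset_dist d \<phi> X"
  proof (intro homogeneous_emetric.intro homogeneous_metric.intro homogeneous_metric_axioms.intro
      homogeneous_emetric_axioms.intro group_axioms A.D_metric)
    show "lie_group G GM" by fact
    show "subgroup (set_stabilizer G \<phi> X) G" by (rule A.subgroup_H)
    show "homogeneous_space G GM (set_stabilizer G \<phi> X) Q" by (rule homog)
    show "\<exists>c\<in>charts_at GM \<one>\<^bsub>G\<^esub>. \<exists>L U. openin (mtop GM) U \<and> \<one>\<^bsub>G\<^esub> \<in> U \<and> U \<subseteq> fst c \<and>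
      (\<forall>g\<in>U. A.D (set_stabilizer G \<phi> X) (g <#\<^bsub>G\<^esub> set_stabilizer G \<phi> X) \<le> L * cdist c g \<one>\<^bsub>G\<^esub>)"
      by (rule A.D_lip)
    show "A.D (g <#\<^bsub>G\<^esub> P) (g <#\<^bsub>G\<^esub> R) = A.D P R"
      if "g \<in> carrier G" "P \<in> lcosets\<^bsub>G\<^esub> set_stabilizer G \<phi> X" "R \<in> lcosets\<^bsub>G\<^esub> set_stabilizer G \<phi> X" for g P R
      using that by (rule A.D_inv)
    show "coset_dist d \<phi> X P R = ennreal (A.D P R)"
      if "P \<in> lcosets\<^bsub>G\<^esub> set_stabilizer G \<phi> X" "R \<in> lcosets\<^bsub>G\<^esub> set_stabilizer G \<phi> X" for P R
      using that A.coset_dist_D(1) unfolding LCOSETS_def by auto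
  qed
  have part1: "\<exists>O'. openin (mtop Q) O' \<and> g <#\<^bsub>G\<^esub> H \<in> O' \<and>
            lipschitz_equiv_on O' d\<^sub>F d\<^sub>X \<and> lipschitz_equiv_on O' d\<^sub>X dhat\<^sub>X \<and> lipschitz_equiv_on O' d\<^sub>F dhat\<^sub>X"
    if g: "g \<in> carrier G" for g
  proof -
    have P: "g <#\<^bsub>G\<^esub> H \<in> lcosets\<^bsub>G\<^esub> (set_stabilizer G \<phi> X)" using g by (auto simp: H_def)
    obtain k where k: "k \<in> charts_at Q (g <#\<^bsub>G\<^esub> H)" using chart_exists[OF B.smooth_Q] P B.topQ by metis
    obtain U1 a A where U1: "openin (mtop Q) U1" "g <#\<^bsub>G\<^esub> H \<in> U1" and aA: "a > 0" "A > 0"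
      and D: "\<And>x y. x \<in> U1 \<Longrightarrow> y \<in> U1 \<Longrightarrow> a * cdist k x y \<le> A.D x y \<and> A.D x y \<le> A * cdist k x y"
      and dh: "\<And>x y. x \<in> U1 \<Longrightarrow> y \<in> U1 \<Longrightarrow> B.dhat x y \<le> ennreal (A * cdist k x y)"
      using B.dhat_chart_upper[OF P k] by metis
    obtain U2 C where U2: "openin (mtop Q) U2" "g <#\<^bsub>G\<^esub> H \<in> U2" and C: "C > 0"
      "\<And>x y. x \<in> U2 \<Longrightarrow> y \<in> U2 \<Longrightarrow> finsler_dist Q F x y \<le> ennreal (C * cdist k x y)"
      using finsler_dist_chart_upper[OF B.smooth_Q assms(14) k] by metis
    obtain U3 c where U3: "openin (mtop Q) U3" "g <#\<^bsub>G\<^esub> H \<in> U3" and c: "c > 0"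
      "\<And>x y. x \<in> U3 \<Longrightarrow> y \<in> U3 \<Longrightarrow> ennreal (c * cdist k x y) \<le> finsler_dist Q F x y"
      using finsler_dist_chart_lower[OF B.smooth_Q assms(14) k] by metis
    \<comment> \<open>On this set all three distances are pinched between multiples of the same
      \<open>cdist k\<close>.\<close>
    define O' where "O' = U1 \<inter> U2 \<inter> U3"
    have O': "openin (mtop Q) O'" "g <#\<^bsub>G\<^esub> H \<in> O'" using U1 U2 U3 by (auto simp: O'_def)
    have l: "x \<in> lcosets\<^bsub>G\<^esub> (set_stabilizer G \<phi> X)" if "x \<in> O'" for x
      using openin_subset[OF O'(1)] that B.topQ by blast
    have F: "ennreal (c * cdist k x y) \<le> d\<^sub>F x y \<and> d\<^sub>F x y \<le> ennreal (C * cdist k x y)"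
      if "x \<in> O'" "y \<in> O'" for x y
      using that C(2) c(2) by (auto simp: O'_def d\<^sub>F_def)
    have DX: "ennreal (a * cdist k x y) \<le> d\<^sub>X x y \<and> d\<^sub>X x y \<le> ennreal (A * cdist k x y)"
      if "x \<in> O'" "y \<in> O'" for x y
      using D[of x y] B.dX[OF l[OF that(1)] l[OF that(2)]] that by (auto simp: O'_def d\<^sub>X_def intro!: ennreal_leI)
    \<comment> \<open>The lower bound is inherited from \<open>d\<^sub>X\<close>, which the
      intrinsic metric dominates.\<close>
    have DH: "ennreal (a * cdist k x y) \<le> dhat\<^sub>X x y \<and> dhat\<^sub>X x y \<le> ennreal (A * cdist k x y)"
      if "x \<in> O'" "y \<in> O'" for x y
      using DX[OF that] B.dX_le_dhat[OF l[OF that(1)] l[OF that(2)]] dh[of x y] that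
      unfolding dhat\<^sub>X_def d\<^sub>X_def O'_def by (meson IntD1 order_trans)
    show ?thesis
    proof (intro exI conjI)
      show "openin (mtop Q) O'" "g <#\<^bsub>G\<^esub> H \<in> O'" by (fact O')+
      show "lipschitz_equiv_on O' d\<^sub>F d\<^sub>X"
        by (rule lipschitz_equiv_on_norm[OF c(1) C(1) aA F DX])
      show "lipschitz_equiv_on O' d\<^sub>X dhat\<^sub>X"
        by (rule lipschitz_equiv_on_norm[OF aA aA DX DH])
      show "lipschitz_equiv_on O' d\<^sub>F dhat\<^sub>X"
        by (rule lipschitz_equiv_on_norm[OF c(1) C(1) aA F DH])
    qed
  qed
  \<comment> \<open>The larger metric has smaller balls and hence the finer topology.\<close>
  moreover have "openin (emetric_topology (lcosets\<^bsub>G\<^esub> H) dhat\<^sub>X) U"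
    if "openin (emetric_topology (lcosets\<^bsub>G\<^esub> H) d\<^sub>X) U" for U
    using that B.dX_le_dhat unfolding H_def d\<^sub>X_def dhat\<^sub>X_def by (rule emetric_openin_mono[rotated]) auto
  moreover have "emetric_topology (lcosets\<^bsub>G\<^esub> H) dhat\<^sub>X = mtop Q"
    using B.emetric_topology_dhat unfolding H_def dhat\<^sub>X_def .
  ultimately show ?thesis by blast
qed

end
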